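(* The kernels of the two surjective algebra morphisms $\mathbb{C}[H^0(B_n)]\twoheadrightarrow\mathbb{C}[R_n^0]$ and $\mathbb{C}[R_n^0]\twoheadrightarrow\mathbb{C}[H^0(A_{n+1})]$ (each sending $\pi_i\mapsto\pi_i$ for $0\le i\le n-1$) are contained in the square of the radical of their respective domains. Consequently, these three algebras have the same (Ext-)quiver.
   Context: All three monoids are generated by $\pi_0,\dots,\pi_{n-1}$ with $\pi_i^2=\pi_i$ for all $i$, $\pi_i\pi_{i+1}\pi_i=\pi_{i+1}\pi_i\pi_{i+1}$ for $1\le i\le n-2$, and $\pi_i\pi_j=\pi_j\pi_i$ for $0\le i,j\le n-1$, $|i-j|\ge2$; in addition: in $H^0(B_n)$ (the $0$-Hecke monoid of type $B_n$) one has $\pi_0\pi_1\pi_0\pi_1=\pi_1\pi_0\pi_1\pi_0$; in $R_n^0$ one has $\pi_1\pi_0\pi_1\pi_0=\pi_0\pi_1\pi_0=\pi_0\pi_1\pi_0\pi_1$; and $H^0(A_{n+1})$ denotes the monoid in which $\pi_0\pi_1\pi_0=\pi_1\pi_0\pi_1$ (the $0$-Hecke monoid of the symmetric group whose simple transpositions correspond to $\pi_0,\dots,\pi_{n-1}$). $\mathbb{C}[M]$ denotes the monoid algebra and the radical is the Jacobson radical. *)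

theory Defs
  imports
    "HOL-Algebra.Ideal_Product"
    "HOL-Algebra.QuotRing"
    "Jordan_Normal_Form.VS_Connect"
    "Graph_Theory.Digraph_Isomorphism"
begin

section \<open>Monoids given by generators and relations\<close>

text \<open>Words over the alphabet \<open>0, \<dots>, n - 1\<close>; the letter \<open>i\<close> stands for the generator
  \<open>\<pi>\<^sub>i\<close>. A set of relations is a set of pairs of words.\<close>

inductive_set pres_cong :: "nat \<Rightarrow> (nat list \<times> nat list) set \<Rightarrow> (nat list \<times> nat list) set"
  for n R where
  rel: "\<lbrakk>(u, v) \<in> R; a \<in> lists {..<n}; b \<in> lists {..<n}\<rbrakk> \<Longrightarrow> (a @ u @ b, a @ v @ b) \<in> pres_cong n R"
| refl: "w \<in> lists {..<n} \<Longrightarrow> (w, w) \<in> pres_cong n R"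
| sym: "(u, v) \<in> pres_cong n R \<Longrightarrow> (v, u) \<in> pres_cong n R"
| trans: "\<lbrakk>(u, v) \<in> pres_cong n R; (v, w) \<in> pres_cong n R\<rbrakk> \<Longrightarrow> (u, w) \<in> pres_cong n R"

definition pres_monoid :: "nat \<Rightarrow> (nat list \<times> nat list) set \<Rightarrow> nat list set monoid" where
  "pres_monoid n R =
    \<lparr>carrier = lists {..<n} // pres_cong n R,
     monoid.mult = (\<lambda>X Y. \<Union>u\<in>X. \<Union>v\<in>Y. pres_cong n R `` {u @ v}),
     one = pres_cong n R `` {[]}\<rparr>"

definition pres_gen :: "nat \<Rightarrow> (nat list \<times> nat list) set \<Rightarrow> nat \<Rightarrow> nat list set" where
  "pres_gen n R i = pres_cong n R `` {[i]}"

definition common_rels :: "nat \<Rightarrow> (nat list \<times> nat list) set" where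
  "common_rels n =
     {([i, i], [i]) | i. i < n}
   \<union> {([i, i + 1, i], [i + 1, i, i + 1]) | i. 1 \<le> i \<and> i + 2 \<le> n}
   \<union> {([i, j], [j, i]) | i j. i < n \<and> j < n \<and> 2 \<le> \<bar>int i - int j\<bar>}"

text \<open>The relations between \<open>\<pi>\<^sub>0\<close> and \<open>\<pi>\<^sub>1\<close> are imposed only if both generators exist.\<close>

definition H0_B_rels :: "nat \<Rightarrow> (nat list \<times> nat list) set" where
  "H0_B_rels n = common_rels n \<union> (if 2 \<le> n then {([0,1,0,1], [1,0,1,0])} else {})"

definition R0_rels :: "nat \<Rightarrow> (nat list \<times> nat list) set" where
  "R0_rels n = common_rels n \<union>
    (if 2 \<le> n then {([1,0,1,0], [0,1,0]), ([0,1,0], [0,1,0,1])} else {})"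

definition H0_A_rels :: "nat \<Rightarrow> (nat list \<times> nat list) set" where
  "H0_A_rels n = common_rels n \<union> (if 2 \<le> n then {([0,1,0], [1,0,1])} else {})"

definition H0_B :: "nat \<Rightarrow> nat list set monoid" where
  "H0_B n = pres_monoid n (H0_B_rels n)"

definition R0 :: "nat \<Rightarrow> nat list set monoid" where
  "R0 n = pres_monoid n (R0_rels n)"

text \<open>\<open>H0_A n\<close> has the \<open>n\<close> generators \<open>\<pi>\<^sub>0, \<dots>, \<pi>\<^sub>n\<^sub>-\<^sub>1\<close>: it is the monoid written
  \<open>H\<^sup>0(A\<^sub>n\<^sub>+\<^sub>1)\<close>, the \<open>0\<close>-Hecke monoid of the symmetric group on \<open>n + 1\<close> letters.\<close>

definition H0_A :: "nat \<Rightarrow> nat list set monoid" where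
  "H0_A n = pres_monoid n (H0_A_rels n)"


section \<open>Monoid algebras\<close>

text \<open>An algebra is a ring record together with its scalar multiplication \<open>smult\<close>.
  Elements of the monoid algebra are the finitely supported functions, with convolution.\<close>

definition monoid_algebra :: "('m, 'e) monoid_scheme \<Rightarrow> (complex, 'm \<Rightarrow> complex) module" where
  "monoid_algebra M =
    \<lparr>carrier = {f. finite {x. f x \<noteq> 0} \<and> {x. f x \<noteq> 0} \<subseteq> carrier M},
     monoid.mult = (\<lambda>f g z. \<Sum>(x, y) | f x \<noteq> 0 \<and> g y \<noteq> 0 \<and> x \<otimes>\<^bsub>M\<^esub> y = z. f x * g y),
     one = (\<lambda>z. if z = \<one>\<^bsub>M\<^esub> then 1 else 0),
     zero = (\<lambda>z. 0),
     add = (\<lambda>f g z. f z + g z),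
     smult = (\<lambda>c f z. c * f z)\<rparr>"

definition monoid_basis :: "'m \<Rightarrow> 'm \<Rightarrow> complex" where
  "monoid_basis m = (\<lambda>z. if z = m then 1 else 0)"

definition alg_hom ::
  "(complex, 'a, 'e) module_scheme \<Rightarrow> (complex, 'b, 'f) module_scheme \<Rightarrow> ('a \<Rightarrow> 'b) set" where
  "alg_hom A B = {\<phi> \<in> Ring.ring_hom A B. \<forall>c. \<forall>x\<in>carrier A. \<phi> (c \<odot>\<^bsub>A\<^esub> x) = c \<odot>\<^bsub>B\<^esub> \<phi> x}"

text \<open>\<open>\<phi>\<close> is a morphism between the algebras of two monoids, presented on the same generators
  by \<open>R\<close> and \<open>S\<close>, which sends \<open>\<pi>\<^sub>i\<close> to \<open>\<pi>\<^sub>i\<close>.\<close>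

definition generator_morphism ::
  "nat \<Rightarrow> (nat list \<times> nat list) set \<Rightarrow> (nat list \<times> nat list) set
    \<Rightarrow> ((nat list set \<Rightarrow> complex) \<Rightarrow> (nat list set \<Rightarrow> complex)) \<Rightarrow> bool" where
  "generator_morphism n R S \<phi> \<longleftrightarrow>
     \<phi> \<in> alg_hom (monoid_algebra (pres_monoid n R)) (monoid_algebra (pres_monoid n S)) \<and>
     (\<forall>i<n. \<phi> (monoid_basis (pres_gen n R i)) = monoid_basis (pres_gen n S i))"


section \<open>Left modules over a noncommutative ring\<close>

text \<open>The library locale \<open>module\<close> requires a commutative ring; as there, the fields \<open>mult\<close> and
  \<open>one\<close> of a module record are irrelevant.\<close>

locale left_module = A?: ring A + M?: abelian_group M
  for A :: "('a, 'e) ring_scheme" (structure) and M :: "('a, 'm, 'f) module_scheme" (structure) +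
  assumes lsmult_closed:
      "\<lbrakk>a \<in> carrier A; x \<in> carrier M\<rbrakk> \<Longrightarrow> a \<odot>\<^bsub>M\<^esub> x \<in> carrier M"
    and lsmult_l_distr:
      "\<lbrakk>a \<in> carrier A; b \<in> carrier A; x \<in> carrier M\<rbrakk> \<Longrightarrow>
        (a \<oplus>\<^bsub>A\<^esub> b) \<odot>\<^bsub>M\<^esub> x = a \<odot>\<^bsub>M\<^esub> x \<oplus>\<^bsub>M\<^esub> b \<odot>\<^bsub>M\<^esub> x"
    and lsmult_r_distr:
      "\<lbrakk>a \<in> carrier A; x \<in> carrier M; y \<in> carrier M\<rbrakk> \<Longrightarrow>
        a \<odot>\<^bsub>M\<^esub> (x \<oplus>\<^bsub>M\<^esub> y) = a \<odot>\<^bsub>M\<^esub> x \<oplus>\<^bsub>M\<^esub> a \<odot>\<^bsub>M\<^esub> y"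
    and lsmult_assoc:
      "\<lbrakk>a \<in> carrier A; b \<in> carrier A; x \<in> carrier M\<rbrakk> \<Longrightarrow>
        (a \<otimes>\<^bsub>A\<^esub> b) \<odot>\<^bsub>M\<^esub> x = a \<odot>\<^bsub>M\<^esub> (b \<odot>\<^bsub>M\<^esub> x)"
    and lsmult_one:
      "x \<in> carrier M \<Longrightarrow> \<one>\<^bsub>A\<^esub> \<odot>\<^bsub>M\<^esub> x = x"

definition simple_module :: "('a, 'e) ring_scheme \<Rightarrow> ('a, 'm, 'f) module_scheme \<Rightarrow> bool" where
  "simple_module A M \<longleftrightarrow> left_module A M \<and> carrier M \<noteq> {\<zero>\<^bsub>M\<^esub>} \<and>
     (\<forall>H. Module.submodule H A M \<longrightarrow> H = {\<zero>\<^bsub>M\<^esub>} \<or> H = carrier M)"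

definition module_isomorphic ::
  "('a, 'e) ring_scheme \<Rightarrow> ('a, 'm, 'f) module_scheme \<Rightarrow> ('a, 'n, 'g) module_scheme \<Rightarrow> bool" where
  "module_isomorphic A M N \<longleftrightarrow> (\<exists>f \<in> LinearCombinations.module_hom A M N. bij_betw f (carrier M) (carrier N))"

definition regular_module :: "('a, 'e) ring_scheme \<Rightarrow> ('a, 'a) module" where
  "regular_module A =
    \<lparr>carrier = carrier A, monoid.mult = monoid.mult A, one = one A, zero = zero A, add = add A,
     smult = monoid.mult A\<rparr>"

definition maximal_left_ideal :: "'a set \<Rightarrow> ('a, 'e) ring_scheme \<Rightarrow> bool" where
  "maximal_left_ideal L A \<longleftrightarrow>
     Module.submodule L A (regular_module A) \<and> L \<noteq> carrier A \<and>
     (\<forall>J. Module.submodule J A (regular_module A) \<and> L \<subseteq> J \<longrightarrow> J = L \<or> J = carrier A)"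

definition jacobson_radical :: "('a, 'e) ring_scheme \<Rightarrow> 'a set" where
  "jacobson_radical A = carrier A \<inter> \<Inter> {L. maximal_left_ideal L A}"

definition radical_square :: "('a, 'e) ring_scheme \<Rightarrow> 'a set" where
  "radical_square A = ideal_prod A (jacobson_radical A) (jacobson_radical A)"


section \<open>Ext and the Ext-quiver\<close>

text \<open>For left modules \<open>M\<close> and \<open>N\<close> over a complex algebra \<open>A\<close>, the space \<open>Hom\<^sub>A(M, N)\<close>;
  the scalar \<open>c\<close> acts on \<open>N\<close> through the element \<open>c \<cdot> 1\<close> of \<open>A\<close>.\<close>

definition hom_space ::
  "(complex, 'a, 'e) module_scheme \<Rightarrow> ('a, 'm, 'f) module_scheme \<Rightarrow> ('a, 'n, 'g) module_scheme
    \<Rightarrow> (complex, 'm \<Rightarrow> 'n) module" where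
  "hom_space A M N =
    \<lparr>carrier = LinearCombinations.module_hom A M N \<inter> extensional (carrier M),
     monoid.mult = undefined, one = undefined,
     zero = (\<lambda>x\<in>carrier M. \<zero>\<^bsub>N\<^esub>),
     add = (\<lambda>f g. \<lambda>x\<in>carrier M. f x \<oplus>\<^bsub>N\<^esub> g x),
     smult = (\<lambda>c f. \<lambda>x\<in>carrier M. (c \<odot>\<^bsub>A\<^esub> \<one>\<^bsub>A\<^esub>) \<odot>\<^bsub>N\<^esub> f x)\<rparr>"

definition quotient_space ::
  "(complex, 'v, 'e) module_scheme \<Rightarrow> 'v set \<Rightarrow> (complex, 'v set) module" where
  "quotient_space V W =
    \<lparr>carrier = a_rcosets\<^bsub>V\<^esub> W,
     monoid.mult = undefined, one = undefined,
     zero = W,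
     add = set_add V,
     smult = (\<lambda>c X. \<Union>x\<in>X. W +>\<^bsub>V\<^esub> (c \<odot>\<^bsub>V\<^esub> x))\<rparr>"

text \<open>The free left module on a set \<open>X\<close> of basis elements.\<close>

definition free_module :: "('a, 'e) ring_scheme \<Rightarrow> 's set \<Rightarrow> ('a, 's \<Rightarrow> 'a) module" where
  "free_module A X =
    \<lparr>carrier = {f. range f \<subseteq> carrier A \<and> finite {x. f x \<noteq> \<zero>\<^bsub>A\<^esub>} \<and> {x. f x \<noteq> \<zero>\<^bsub>A\<^esub>} \<subseteq> X},
     monoid.mult = undefined, one = undefined,
     zero = (\<lambda>x. \<zero>\<^bsub>A\<^esub>),
     add = (\<lambda>f g x. f x \<oplus>\<^bsub>A\<^esub> g x),
     smult = (\<lambda>a f x. a \<otimes>\<^bsub>A\<^esub> f x)\<rparr>"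

text \<open>The kernel \<open>K\<close> of the canonical surjection \<open>F \<rightarrow> S\<close> from the free module \<open>F\<close> on the
  underlying set of \<open>S\<close>, which sends the basis element \<open>s\<close> to \<open>s\<close>.\<close>

definition syzygies ::
  "('a, 'e) ring_scheme \<Rightarrow> ('a, 's, 'f) module_scheme \<Rightarrow> ('s \<Rightarrow> 'a) set" where
  "syzygies A S =
    {f \<in> carrier (free_module A (carrier S)).
       (\<Oplus>\<^bsub>S\<^esub>s\<in>{s. f s \<noteq> \<zero>\<^bsub>A\<^esub>}. f s \<odot>\<^bsub>S\<^esub> s) = \<zero>\<^bsub>S\<^esub>}"

text \<open>\<open>Ext\<^sup>1\<^sub>A(S, T)\<close> is the cokernel of the restriction map \<open>Hom\<^sub>A(F, T) \<rightarrow> Hom\<^sub>A(K, T)\<close>, computed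
  from the free presentation \<open>0 \<rightarrow> K \<rightarrow> F \<rightarrow> S \<rightarrow> 0\<close>.\<close>

definition Ext1 ::
  "(complex, 'a, 'e) module_scheme \<Rightarrow> ('a, 's, 'f) module_scheme \<Rightarrow> ('a, 't, 'g) module_scheme
    \<Rightarrow> (complex, (('s \<Rightarrow> 'a) \<Rightarrow> 't) set) module" where
  "Ext1 A S T =
    (let F = free_module A (carrier S); K = syzygies A S
     in quotient_space (hom_space A (F\<lparr>carrier := K\<rparr>) T)
          ((\<lambda>g. restrict g K) ` carrier (hom_space A F T)))"

definition Ext1_dim ::
  "(complex, 'a, 'e) module_scheme \<Rightarrow> ('a, 's, 'f) module_scheme \<Rightarrow> ('a, 't, 'g) module_scheme
    \<Rightarrow> nat" where
  "Ext1_dim A S T = vectorspace.dim (class_ring :: complex ring) (Ext1 A S T)"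

text \<open>Isomorphism classes of simple modules. Every simple module is isomorphic to a quotient of
  the regular module, whose elements are cosets, so it suffices to consider simple modules whose
  elements are sets of elements of \<open>A\<close>.\<close>

definition simple_classes :: "(complex, 'a, 'e) module_scheme \<Rightarrow> ('a, 'a set) module set set" where
  "simple_classes A =
     {M. simple_module A M} //
       {(M, N). simple_module A M \<and> simple_module A N \<and> module_isomorphic A M N}"

text \<open>The vertices are the isomorphism classes of simple modules, and there are
  \<open>dim Ext\<^sup>1\<^sub>A(S, T)\<close> arrows from \<open>S\<close> to \<open>T\<close>, told apart by a number. The quiver is meant for
  finite-dimensional algebras, where these dimensions are finite.\<close>

definition Ext_quiver ::
  "(complex, 'a, 'e) module_scheme \<Rightarrow>
    (('a, 'a set) module set, ('a, 'a set) module set \<times> ('a, 'a set) module set \<times> nat) pre_digraph"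
  where
  "Ext_quiver A =
    \<lparr>verts = simple_classes A,
     arcs = {(X, Y, k). X \<in> simple_classes A \<and> Y \<in> simple_classes A \<and>
                        k < Ext1_dim A (SOME S. S \<in> X) (SOME T. T \<in> Y)},
     tail = (\<lambda>(X, Y, k). X),
     head = (\<lambda>(X, Y, k). Y)\<rparr>"

end

theory Submission
  imports Defs
begin

text \<open>Every nonzero module over a monoid algebra satisfying the relations of \<open>H\<^sup>0(B\<^sub>n)\<close> contains a common
  eigenvector of all \<open>\<pi>\<^sub>i\<close> with eigenvalues in \<open>{0, 1}\<close>: adjoin the generators one at a time, and apply
  to the eigenvector found so far the last element of the chain of minimal coset representatives
  that does not kill it. Hence differences of words with the same letters lie in the radical. If \<open>z\<close>
  absorbs the idempotents \<open>x\<close> and \<open>y\<close> on both sides, then \<open>(x y - z) (y x - z) = x y x - z\<close>. With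
  \<open>z = \<pi>\<^sub>0 \<pi>\<^sub>1 \<pi>\<^sub>0 \<pi>\<^sub>1\<close> in \<open>H\<^sup>0(B\<^sub>n)\<close> and \<open>z = \<pi>\<^sub>0 \<pi>\<^sub>1 \<pi>\<^sub>0\<close> in \<open>R\<^sub>n\<^sup>0\<close> this writes the generators of the
  kernels as products of two elements of the radical.

  For the quivers, a morphism from the syzygies of a simple module to a simple module vanishes on
  the square of the radical times the free module, because the radical maps the free module into the
  syzygies and annihilates the target. So \<open>Ext\<^sup>1\<close> between simple modules is the same over both
  algebras.\<close>

section \<open>Monoid algebras\<close>

text \<open>The radical is an intersection of maximal left ideals and is handled as a left ideal
  only. This shapes two things. Eigenvectors are taken modulo a left ideal \<open>L\<close>:
  elements outside \<open>L\<close> on which every generator acts as 0 or 1 up to \<open>L\<close>.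
  And factors on the right are carried along, in \<open>same_letters_mult_radical\<close> and in the
  contexts of \<open>rad_cong\<close>. The chain property matters because a generator that moves the
  last surviving representative has only one place to move it to, and that place is already killed.
  For \<open>2 \<le> n\<close> the element \<open>z\<close> is the zero of the submonoid generated
  by the first two generators. The first quotient identifies \<open>0, 1, 0\<close> with this zero,
  the second identifies \<open>1, 0, 1\<close> with it. A kernel is spanned by differences of words
  that become congruent, so the defining relations of the quotient, placed in arbitrary contexts,
  decide the inclusion. Since the kernel acts as zero on simple modules, the simple modules over the
  two algebras correspond, which gives the vertices of the quivers.\<close>

locale complex_algebra = ring A for A :: "(complex, 'a, 'e) module_scheme" (structure) +
  assumes scale_closed: "x \<in> carrier A \<Longrightarrow> c \<odot> x \<in> carrier A"
    and scale_l_distr: "x \<in> carrier A \<Longrightarrow> (c + d) \<odot> x = c \<odot> x \<oplus> d \<odot> x"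
    and scale_r_distr: "\<lbrakk>x \<in> carrier A; y \<in> carrier A\<rbrakk> \<Longrightarrow> c \<odot> (x \<oplus> y) = c \<odot> x \<oplus> c \<odot> y"
    and scale_assoc: "x \<in> carrier A \<Longrightarrow> (c * d) \<odot> x = c \<odot> (d \<odot> x)"
    and scale_one: "x \<in> carrier A \<Longrightarrow> 1 \<odot> x = x"
    and scale_mult_left: "\<lbrakk>x \<in> carrier A; y \<in> carrier A\<rbrakk> \<Longrightarrow> (c \<odot> x) \<otimes> y = c \<odot> (x \<otimes> y)"
    and scale_mult_right: "\<lbrakk>x \<in> carrier A; y \<in> carrier A\<rbrakk> \<Longrightarrow> x \<otimes> (c \<odot> y) = c \<odot> (x \<otimes> y)"
begin

lemma scale_zero_left: "x \<in> carrier A \<Longrightarrow> 0 \<odot> x = \<zero>"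
  by (metis add.l_cancel_one' add.r_cancel_one add_0 scale_closed scale_l_distr)

end

lemma monoid_algebra_carrier:
  "f \<in> carrier (monoid_algebra M) \<longleftrightarrow> finite {x. f x \<noteq> 0} \<and> {x. f x \<noteq> 0} \<subseteq> carrier M"
  by (simp add: monoid_algebra_def)

lemma monoid_algebra_sel:
  "f \<oplus>\<^bsub>monoid_algebra M\<^esub> g = (\<lambda>z. f z + g z)"
  "\<zero>\<^bsub>monoid_algebra M\<^esub> = (\<lambda>z. 0)"
  "c \<odot>\<^bsub>monoid_algebra M\<^esub> f = (\<lambda>z. c * f z)"
  "\<one>\<^bsub>monoid_algebra M\<^esub> = monoid_basis \<one>\<^bsub>M\<^esub>"
  by (simp_all add: monoid_algebra_def monoid_basis_def)

lemma monoid_algebra_add_closed: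
  "\<lbrakk>f \<in> carrier (monoid_algebra M); g \<in> carrier (monoid_algebra M)\<rbrakk>
    \<Longrightarrow> (\<lambda>z. f z + g z) \<in> carrier (monoid_algebra M)"
  by (auto simp: monoid_algebra_carrier
        intro: finite_subset[of _ "{x. f x \<noteq> 0} \<union> {x. g x \<noteq> 0}"]) force

lemma monoid_algebra_scale_closed:
  "f \<in> carrier (monoid_algebra M) \<Longrightarrow> (\<lambda>z. c * f z) \<in> carrier (monoid_algebra M)"
  by (auto simp: monoid_algebra_carrier elim: rev_finite_subset)

lemma monoid_algebra_zero_closed: "(\<lambda>z. 0) \<in> carrier (monoid_algebra M)"
  by (simp add: monoid_algebra_carrier)

lemma monoid_basis_closed: "x \<in> carrier M \<Longrightarrow> monoid_basis x \<in> carrier (monoid_algebra M)"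
  by (auto simp: monoid_algebra_carrier monoid_basis_def)

text \<open>The sum in the product runs over supports, which may shrink when functions are added.
  Over fixed finite supersets the summand is bilinear in \<open>f\<close> and \<open>g\<close>, so
  distributivity reduces to \<open>sum.distrib\<close>.\<close>

lemma monoid_algebra_mult_eq:
  assumes "finite F" "finite G" "{x. f x \<noteq> 0} \<subseteq> F" "{y. g y \<noteq> 0} \<subseteq> G"
  shows "(f \<otimes>\<^bsub>monoid_algebra M\<^esub> g) z = (\<Sum>x\<in>F. \<Sum>y\<in>G. if x \<otimes>\<^bsub>M\<^esub> y = z then f x * g y else 0)"
proof -
  have "(f \<otimes>\<^bsub>monoid_algebra M\<^esub> g) z
      = (\<Sum>(x, y) | f x \<noteq> 0 \<and> g y \<noteq> 0 \<and> x \<otimes>\<^bsub>M\<^esub> y = z. f x * g y)"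
    by (simp add: monoid_algebra_def)
  also have "\<dots> = (\<Sum>(x, y) \<in> F \<times> G. if x \<otimes>\<^bsub>M\<^esub> y = z then f x * g y else 0)"
    using assms by (intro sum.mono_neutral_cong_left) (auto split: if_splits)
  finally show ?thesis by (simp add: sum.cartesian_product)
qed

text \<open>Peels points off a finite set containing the support, so that identities that are linear
  in each factor need checking on basis elements only.\<close>

lemma monoid_algebra_induct [consumes 2, case_names basis scale add]:
  assumes f: "f \<in> carrier (monoid_algebra M)" and M: "monoid M"
    and basis: "\<And>x. x \<in> carrier M \<Longrightarrow> P (monoid_basis x)"
    and scale: "\<And>c f. \<lbrakk>f \<in> carrier (monoid_algebra M); P f\<rbrakk> \<Longrightarrow> P (\<lambda>z. c * f z)"
    and add: "\<And>f g. \<lbrakk>f \<in> carrier (monoid_algebra M); g \<in> carrier (monoid_algebra M); P f; P g\<rbrakk>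
                \<Longrightarrow> P (\<lambda>z. f z + g z)"
  shows "P f"
proof -
  have "P f" if "finite F" "F \<subseteq> carrier M" "{x. f x \<noteq> 0} \<subseteq> F" for F f
    using that
  proof (induction F arbitrary: f)
    case empty
    \<comment> \<open>The zero function is obtained as 0 times the basis element of the unit, which
      is why \<open>M\<close> has to be a monoid.\<close>
    have "P (\<lambda>z. 0 * monoid_basis \<one>\<^bsub>M\<^esub> z)"
      using M by (intro scale basis monoid_basis_closed) auto
    moreover have "f = (\<lambda>z. 0 * monoid_basis \<one>\<^bsub>M\<^esub> z)" using empty by auto
    ultimately show ?case by simp
  next
    case (insert x F)
    let ?g = "\<lambda>z. f x * monoid_basis x z" and ?h = "\<lambda>z. if z = x then 0 else f z"
    have x: "x \<in> carrier M" using insert by auto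
    have h: "{z. ?h z \<noteq> 0} \<subseteq> F" using insert by auto
    have "P (\<lambda>z. ?g z + ?h z)"
    proof (rule add)
      show "?g \<in> carrier (monoid_algebra M)"
        by (fact monoid_algebra_scale_closed[OF monoid_basis_closed[OF x]])
      show "P ?g"
        by (fact scale[OF monoid_basis_closed[OF x] basis[OF x]])
      show "P ?h" using h insert by auto
      show "?h \<in> carrier (monoid_algebra M)"
        using h insert by (auto simp: monoid_algebra_carrier intro: finite_subset)
    qed
    moreover have "(\<lambda>z. ?g z + ?h z) = f" by (auto simp: monoid_basis_def)
    ultimately show ?case by simp
  qed
  then show ?thesis using f by (auto simp: monoid_algebra_carrier)
qed

lemma monoid_algebra_mult_add_left:
  assumes "f \<in> carrier (monoid_algebra M)" "g \<in> carrier (monoid_algebra M)"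
    "h \<in> carrier (monoid_algebra M)"
  shows "(\<lambda>z. f z + g z) \<otimes>\<^bsub>monoid_algebra M\<^esub> h
    = (\<lambda>z. (f \<otimes>\<^bsub>monoid_algebra M\<^esub> h) z + (g \<otimes>\<^bsub>monoid_algebra M\<^esub> h) z)"
proof
  fix z
  let ?F = "{x. f x \<noteq> 0} \<union> {x. g x \<noteq> 0}" and ?H = "{x. h x \<noteq> 0}"
  have fin: "finite ?F" "finite ?H" using assms by (auto simp: monoid_algebra_carrier)
  have e: "(k \<otimes>\<^bsub>monoid_algebra M\<^esub> h) z = (\<Sum>x\<in>?F. \<Sum>y\<in>?H. if x \<otimes>\<^bsub>M\<^esub> y = z then k x * h y else 0)"
    if "{x. k x \<noteq> 0} \<subseteq> ?F" for k
    by (rule monoid_algebra_mult_eq[OF fin that order_refl])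
  have "((\<lambda>z. f z + g z) \<otimes>\<^bsub>monoid_algebra M\<^esub> h) z
      = (\<Sum>x\<in>?F. \<Sum>y\<in>?H. if x \<otimes>\<^bsub>M\<^esub> y = z then (f x + g x) * h y else 0)"
    by (rule e) auto
  also have "\<dots> = (\<Sum>x\<in>?F. \<Sum>y\<in>?H. (if x \<otimes>\<^bsub>M\<^esub> y = z then f x * h y else 0)
      + (if x \<otimes>\<^bsub>M\<^esub> y = z then g x * h y else 0))"
    by (intro sum.cong[OF HOL.refl]) (simp add: algebra_simps)
  also have "\<dots> = (f \<otimes>\<^bsub>monoid_algebra M\<^esub> h) z + (g \<otimes>\<^bsub>monoid_algebra M\<^esub> h) z"
    by (simp only: sum.distrib) (subst (1 2) e, auto)
  finally show "((\<lambda>z. f z + g z) \<otimes>\<^bsub>monoid_algebra M\<^esub> h) z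
    = (f \<otimes>\<^bsub>monoid_algebra M\<^esub> h) z + (g \<otimes>\<^bsub>monoid_algebra M\<^esub> h) z" .
qed

lemma monoid_algebra_mult_add_right:
  assumes "f \<in> carrier (monoid_algebra M)" "g \<in> carrier (monoid_algebra M)"
    "h \<in> carrier (monoid_algebra M)"
  shows "h \<otimes>\<^bsub>monoid_algebra M\<^esub> (\<lambda>z. f z + g z)
    = (\<lambda>z. (h \<otimes>\<^bsub>monoid_algebra M\<^esub> f) z + (h \<otimes>\<^bsub>monoid_algebra M\<^esub> g) z)"
proof
  fix z
  let ?F = "{x. f x \<noteq> 0} \<union> {x. g x \<noteq> 0}" and ?H = "{x. h x \<noteq> 0}"
  have fin: "finite ?H" "finite ?F" using assms by (auto simp: monoid_algebra_carrier)
  have e: "(h \<otimes>\<^bsub>monoid_algebra M\<^esub> k) z = (\<Sum>x\<in>?H. \<Sum>y\<in>?F. if x \<otimes>\<^bsub>M\<^esub> y = z then h x * k y else 0)"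
    if "{x. k x \<noteq> 0} \<subseteq> ?F" for k
    by (rule monoid_algebra_mult_eq[OF fin order_refl that])
  have "(h \<otimes>\<^bsub>monoid_algebra M\<^esub> (\<lambda>z. f z + g z)) z
      = (\<Sum>x\<in>?H. \<Sum>y\<in>?F. if x \<otimes>\<^bsub>M\<^esub> y = z then h x * (f y + g y) else 0)"
    by (rule e) auto
  also have "\<dots> = (\<Sum>x\<in>?H. \<Sum>y\<in>?F. (if x \<otimes>\<^bsub>M\<^esub> y = z then h x * f y else 0)
      + (if x \<otimes>\<^bsub>M\<^esub> y = z then h x * g y else 0))"
    by (intro sum.cong[OF HOL.refl]) (simp add: algebra_simps)
  also have "\<dots> = (h \<otimes>\<^bsub>monoid_algebra M\<^esub> f) z + (h \<otimes>\<^bsub>monoid_algebra M\<^esub> g) z"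
    by (simp only: sum.distrib) (subst (1 2) e, auto)
  finally show "(h \<otimes>\<^bsub>monoid_algebra M\<^esub> (\<lambda>z. f z + g z)) z
    = (h \<otimes>\<^bsub>monoid_algebra M\<^esub> f) z + (h \<otimes>\<^bsub>monoid_algebra M\<^esub> g) z" .
qed

lemma monoid_algebra_mult_scale:
  assumes "f \<in> carrier (monoid_algebra M)" "g \<in> carrier (monoid_algebra M)"
  shows "(\<lambda>z. c * f z) \<otimes>\<^bsub>monoid_algebra M\<^esub> g = (\<lambda>z. c * (f \<otimes>\<^bsub>monoid_algebra M\<^esub> g) z)" (is "?l = _")
    and "f \<otimes>\<^bsub>monoid_algebra M\<^esub> (\<lambda>z. c * g z) = (\<lambda>z. c * (f \<otimes>\<^bsub>monoid_algebra M\<^esub> g) z)" (is "?r = _")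
proof -
  let ?F = "{x. f x \<noteq> 0}" and ?G = "{x. g x \<noteq> 0}"
  have fin: "finite ?F" "finite ?G" using assms by (auto simp: monoid_algebra_carrier)
  have e: "(k \<otimes>\<^bsub>monoid_algebra M\<^esub> l) z = (\<Sum>x\<in>?F. \<Sum>y\<in>?G. if x \<otimes>\<^bsub>M\<^esub> y = z then k x * l y else 0)"
    if "{x. k x \<noteq> 0} \<subseteq> ?F" "{x. l x \<noteq> 0} \<subseteq> ?G" for k l z
    by (rule monoid_algebra_mult_eq[OF fin that])
  show "?l = (\<lambda>z. c * (f \<otimes>\<^bsub>monoid_algebra M\<^esub> g) z)"
    by (rule ext, subst (1 2) e) (auto simp: sum_distrib_left mult.assoc intro!: sum.cong)
  show "?r = (\<lambda>z. c * (f \<otimes>\<^bsub>monoid_algebra M\<^esub> g) z)"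
    by (rule ext, subst (1 2) e) (auto simp: sum_distrib_left mult.left_commute intro!: sum.cong)
qed

lemma monoid_basis_mult:
  "monoid_basis x \<otimes>\<^bsub>monoid_algebra M\<^esub> monoid_basis y = monoid_basis (x \<otimes>\<^bsub>M\<^esub> y)"
  by (rule ext, subst monoid_algebra_mult_eq[where F = "{x}" and G = "{y}"])
     (auto simp: monoid_basis_def)

lemmas monoid_algebra_mult_linear =
  monoid_algebra_mult_add_left monoid_algebra_mult_add_right monoid_algebra_mult_scale

lemma monoid_algebra_mult_closed:
  assumes "monoid M" "f \<in> carrier (monoid_algebra M)" "g \<in> carrier (monoid_algebra M)"
  shows "f \<otimes>\<^bsub>monoid_algebra M\<^esub> g \<in> carrier (monoid_algebra M)"
  using assms(2,1)
proof (induction rule: monoid_algebra_induct)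
  case (basis x)
  from assms(3,1) show ?case
  proof (induction rule: monoid_algebra_induct)
    case (basis y)
    then show ?case
      using \<open>x \<in> carrier M\<close> assms(1)
      by (auto simp: monoid_basis_mult intro!: monoid_basis_closed monoid.m_closed)
  qed (use basis in \<open>auto simp: monoid_algebra_mult_linear monoid_basis_closed
      intro: monoid_algebra_add_closed monoid_algebra_scale_closed\<close>)
qed (use assms in \<open>auto simp: monoid_algebra_mult_linear
      intro: monoid_algebra_add_closed monoid_algebra_scale_closed\<close>)

lemmas monoid_algebra_closed =
  monoid_algebra_zero_closed monoid_algebra_add_closed monoid_algebra_scale_closed
  monoid_algebra_mult_closed monoid_basis_closed

lemma monoid_algebra_assoc:
  assumes M: "monoid M" and f: "f \<in> carrier (monoid_algebra M)"
    and g: "g \<in> carrier (monoid_algebra M)" and h: "h \<in> carrier (monoid_algebra M)"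
  shows "(f \<otimes>\<^bsub>monoid_algebra M\<^esub> g) \<otimes>\<^bsub>monoid_algebra M\<^esub> h
    = f \<otimes>\<^bsub>monoid_algebra M\<^esub> (g \<otimes>\<^bsub>monoid_algebra M\<^esub> h)"
  using f M
proof (induction rule: monoid_algebra_induct)
  case (basis x)
  note x = basis
  from g M show ?case
  proof (induction rule: monoid_algebra_induct)
    case (basis y)
    note y = basis
    from h M show ?case
    proof (induction rule: monoid_algebra_induct)
      case (basis z)
      then show ?case using x y M by (simp add: monoid_basis_mult monoid.m_assoc)
    qed (use x y M in \<open>simp_all add: monoid_algebra_mult_linear monoid_algebra_closed\<close>)
  qed (use x h M in \<open>simp_all add: monoid_algebra_mult_linear monoid_algebra_closed\<close>)
qed (use g h M in \<open>simp_all add: monoid_algebra_mult_linear monoid_algebra_closed\<close>)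

lemma monoid_algebra_one:
  assumes M: "monoid M" and f: "f \<in> carrier (monoid_algebra M)"
  shows "monoid_basis \<one>\<^bsub>M\<^esub> \<otimes>\<^bsub>monoid_algebra M\<^esub> f = f" "f \<otimes>\<^bsub>monoid_algebra M\<^esub> monoid_basis \<one>\<^bsub>M\<^esub> = f"
  using f M
  by (induction rule: monoid_algebra_induct)
     (use M in \<open>simp_all add: monoid_basis_mult monoid_algebra_mult_linear monoid_basis_closed
        monoid.one_closed monoid.l_one monoid.r_one\<close>)

lemma complex_algebra_monoid_algebra:
  assumes M: "monoid M"
  shows "complex_algebra (monoid_algebra M)"
proof -
  note [simp] = monoid_algebra_sel monoid_algebra_closed M monoid.one_closed[OF M]
    monoid_algebra_mult_linear
  have "ring (monoid_algebra M)"
  proof (intro ringI abelian_groupI monoidI)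
    fix x assume x: "x \<in> carrier (monoid_algebra M)"
    have "(\<lambda>z. -1 * x z) \<in> carrier (monoid_algebra M)"
      using x by (rule monoid_algebra_scale_closed)
    then show "\<exists>y\<in>carrier (monoid_algebra M). y \<oplus>\<^bsub>monoid_algebra M\<^esub> x = \<zero>\<^bsub>monoid_algebra M\<^esub>"
      by (intro bexI[of _ "\<lambda>z. -1 * x z"]) auto
  qed (auto simp: monoid_algebra_assoc monoid_algebra_one algebra_simps)
  then interpret ring "monoid_algebra M" .
  show ?thesis
    by unfold_locales (auto simp: algebra_simps)
qed

section \<open>Functoriality of the monoid algebra\<close>

definition monoid_algebra_map :: "('m \<Rightarrow> 'n) \<Rightarrow> ('m \<Rightarrow> complex) \<Rightarrow> 'n \<Rightarrow> complex" where
  "monoid_algebra_map h f = (\<lambda>t. \<Sum>x | f x \<noteq> 0 \<and> h x = t. f x)"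

lemma monoid_algebra_map_eq:
  assumes "finite F" "{x. f x \<noteq> 0} \<subseteq> F"
  shows "monoid_algebra_map h f t = (\<Sum>x\<in>F. if h x = t then f x else 0)"
  unfolding monoid_algebra_map_def using assms
  by (intro sum.mono_neutral_cong_left) auto

lemma monoid_algebra_map_basis: "monoid_algebra_map h (monoid_basis x) = monoid_basis (h x)"
  by (rule ext, subst monoid_algebra_map_eq[where F = "{x}"]) (auto simp: monoid_basis_def)

lemma monoid_algebra_map_linear:
  assumes "f \<in> carrier (monoid_algebra M)" "g \<in> carrier (monoid_algebra M)"
  shows "monoid_algebra_map h (\<lambda>z. f z + g z)
      = (\<lambda>t. monoid_algebra_map h f t + monoid_algebra_map h g t)" (is ?add)
    and "monoid_algebra_map h (\<lambda>z. c * f z) = (\<lambda>t. c * monoid_algebra_map h f t)" (is ?scale)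
proof -
  let ?F = "{x. f x \<noteq> 0} \<union> {x. g x \<noteq> 0}"
  have fin: "finite ?F" using assms by (auto simp: monoid_algebra_carrier)
  have e: "monoid_algebra_map h k t = (\<Sum>x\<in>?F. if h x = t then k x else 0)"
    if "{x. k x \<noteq> 0} \<subseteq> ?F" for k t
    by (rule monoid_algebra_map_eq[OF fin that])
  have "monoid_algebra_map h (\<lambda>z. f z + g z) t
      = (\<Sum>x\<in>?F. (if h x = t then f x else 0) + (if h x = t then g x else 0))" for t
    by (subst e, force, rule sum.cong) auto
  then show ?add
    by (simp only: sum.distrib) (subst (1 2) e, auto)
  have "monoid_algebra_map h (\<lambda>z. c * f z) t = (\<Sum>x\<in>?F. c * (if h x = t then f x else 0))" for t
    by (subst e) (auto intro!: sum.cong)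
  then show ?scale
    by (simp only: sum_distrib_left[symmetric]) (subst e, auto)
qed

lemma monoid_algebra_map_closed:
  assumes "f \<in> carrier (monoid_algebra M)" "monoid M" "\<And>x. x \<in> carrier M \<Longrightarrow> h x \<in> carrier N"
  shows "monoid_algebra_map h f \<in> carrier (monoid_algebra N)"
  using assms(1,2)
  by (induction rule: monoid_algebra_induct)
     (use assms(2,3) in \<open>auto simp: monoid_algebra_map_basis monoid_algebra_map_linear
        intro!: monoid_algebra_closed\<close>)

lemma monoid_algebra_map_alg_hom:
  assumes M: "monoid M" and N: "monoid N" and h: "h \<in> hom M N" "h \<one>\<^bsub>M\<^esub> = \<one>\<^bsub>N\<^esub>"
  shows "monoid_algebra_map h \<in> alg_hom (monoid_algebra M) (monoid_algebra N)"
proof -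
  have cl: "monoid_algebra_map h f \<in> carrier (monoid_algebra N)"
    if "f \<in> carrier (monoid_algebra M)" for f
    using that M h by (intro monoid_algebra_map_closed) (auto simp: hom_def)
  have mult: "monoid_algebra_map h (f \<otimes>\<^bsub>monoid_algebra M\<^esub> g)
      = monoid_algebra_map h f \<otimes>\<^bsub>monoid_algebra N\<^esub> monoid_algebra_map h g"
    if f: "f \<in> carrier (monoid_algebra M)" and g: "g \<in> carrier (monoid_algebra M)" for f g
    using f M
  proof (induction rule: monoid_algebra_induct)
    case (basis x)
    note x = basis
    from g M show ?case
    proof (induction rule: monoid_algebra_induct)
      case (basis y)
      then show ?case using x h
        by (simp add: monoid_basis_mult monoid_algebra_map_basis hom_mult)
    next
      case (scale c f)
      then show ?case using x M cl monoid_basis_closed[OF x]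
        by (simp add: monoid_algebra_mult_linear monoid_algebra_map_linear(2)[OF _ scale(1)]
            monoid_algebra_map_linear(2)[where M = M] monoid_algebra_closed)
    next
      case (add f g)
      then show ?case using x M cl monoid_basis_closed[OF x]
        by (simp add: monoid_algebra_mult_linear monoid_algebra_map_linear(1)[where M = M]
            monoid_algebra_closed)
    qed
  next
    case (scale c f)
    then show ?case using g M cl
      by (simp add: monoid_algebra_mult_linear monoid_algebra_map_linear(2)[where M = M]
          monoid_algebra_closed)
  next
    case (add f g')
    then show ?case using g M cl
      by (simp add: monoid_algebra_mult_linear monoid_algebra_map_linear(1)[where M = M]
          monoid_algebra_closed)
  qed
  show ?thesis
    unfolding alg_hom_def
    using cl mult h(2)
    by (auto intro!: ring_hom_memI simp: monoid_algebra_sel monoid_algebra_map_basis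
        monoid_algebra_map_linear[where M = M])
qed

section \<open>Left modules and the radical\<close>

context left_module
begin

lemma lsmult_zero_left:
  assumes "x \<in> carrier M"
  shows "\<zero>\<^bsub>A\<^esub> \<odot>\<^bsub>M\<^esub> x = \<zero>\<^bsub>M\<^esub>"
proof -
  have "\<zero>\<^bsub>A\<^esub> \<odot>\<^bsub>M\<^esub> x \<oplus>\<^bsub>M\<^esub> \<zero>\<^bsub>A\<^esub> \<odot>\<^bsub>M\<^esub> x = \<zero>\<^bsub>A\<^esub> \<odot>\<^bsub>M\<^esub> x"
    using assms lsmult_l_distr[of "\<zero>\<^bsub>A\<^esub>" "\<zero>\<^bsub>A\<^esub>" x] by simp
  then show ?thesis using assms by (metis A.zero_closed M.add.l_cancel_one' lsmult_closed)
qed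

lemma lsmult_zero_right:
  assumes "a \<in> carrier A"
  shows "a \<odot>\<^bsub>M\<^esub> \<zero>\<^bsub>M\<^esub> = \<zero>\<^bsub>M\<^esub>"
proof -
  have "a \<odot>\<^bsub>M\<^esub> \<zero>\<^bsub>M\<^esub> \<oplus>\<^bsub>M\<^esub> a \<odot>\<^bsub>M\<^esub> \<zero>\<^bsub>M\<^esub> = a \<odot>\<^bsub>M\<^esub> \<zero>\<^bsub>M\<^esub>"
    using assms lsmult_r_distr[of a "\<zero>\<^bsub>M\<^esub>" "\<zero>\<^bsub>M\<^esub>"] by simp
  then show ?thesis using assms by (metis M.zero_closed M.add.l_cancel_one' lsmult_closed)
qed

lemma lsmult_minus_left:
  assumes "a \<in> carrier A" "x \<in> carrier M"
  shows "(\<ominus>\<^bsub>A\<^esub> a) \<odot>\<^bsub>M\<^esub> x = \<ominus>\<^bsub>M\<^esub> (a \<odot>\<^bsub>M\<^esub> x)"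
proof -
  have "(\<ominus>\<^bsub>A\<^esub> a) \<odot>\<^bsub>M\<^esub> x \<oplus>\<^bsub>M\<^esub> a \<odot>\<^bsub>M\<^esub> x = \<zero>\<^bsub>M\<^esub>"
    using assms lsmult_l_distr[of "\<ominus>\<^bsub>A\<^esub> a" a x] by (simp add: A.l_neg lsmult_zero_left)
  then show ?thesis using assms by (simp add: M.minus_equality lsmult_closed)
qed

lemma submodule_iff:
  "Module.submodule H A M \<longleftrightarrow> H \<subseteq> carrier M \<and> \<zero>\<^bsub>M\<^esub> \<in> H \<and>
    (\<forall>x\<in>H. \<forall>y\<in>H. x \<oplus>\<^bsub>M\<^esub> y \<in> H) \<and> (\<forall>a\<in>carrier A. \<forall>x\<in>H. a \<odot>\<^bsub>M\<^esub> x \<in> H)"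
proof
  assume "Module.submodule H A M"
  then interpret H: Module.submodule H A M .
  show "H \<subseteq> carrier M \<and> \<zero>\<^bsub>M\<^esub> \<in> H \<and>
    (\<forall>x\<in>H. \<forall>y\<in>H. x \<oplus>\<^bsub>M\<^esub> y \<in> H) \<and> (\<forall>a\<in>carrier A. \<forall>x\<in>H. a \<odot>\<^bsub>M\<^esub> x \<in> H)"
    using H.subset H.one_closed H.m_closed by auto
next
  assume H: "H \<subseteq> carrier M \<and> \<zero>\<^bsub>M\<^esub> \<in> H \<and>
    (\<forall>x\<in>H. \<forall>y\<in>H. x \<oplus>\<^bsub>M\<^esub> y \<in> H) \<and> (\<forall>a\<in>carrier A. \<forall>x\<in>H. a \<odot>\<^bsub>M\<^esub> x \<in> H)"
  have "\<ominus>\<^bsub>M\<^esub> x \<in> H" if "x \<in> H" for x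
  proof -
    have x: "x \<in> carrier M" using H that by blast
    have "(\<ominus>\<^bsub>A\<^esub> \<one>\<^bsub>A\<^esub>) \<odot>\<^bsub>M\<^esub> x \<in> H"
      using H that A.a_inv_closed[OF A.one_closed] by blast
    then show ?thesis using lsmult_minus_left[OF A.one_closed x] x by (simp add: lsmult_one)
  qed
  then have "subgroup H (add_monoid M)"
    using H by (intro subgroup.intro) (auto simp: a_inv_def[symmetric])
  then show "Module.submodule H A M"
    using H by (auto simp: Module.submodule_def submodule_axioms_def)
qed

end

lemma (in ring) regular_left_module: "left_module R (regular_module R)"
proof -
  have "abelian_group (regular_module R)"
    by (rule abelian_groupI) (auto simp: regular_module_def a_ac intro: l_neg)
  then show ?thesis
    by (intro left_module.intro ring_axioms left_module_axioms.intro)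
       (auto simp: regular_module_def l_distr r_distr m_assoc)
qed

lemma (in ring) left_ideal_iff:
  "Module.submodule L R (regular_module R) \<longleftrightarrow> L \<subseteq> carrier R \<and> \<zero> \<in> L \<and>
    (\<forall>x\<in>L. \<forall>y\<in>L. x \<oplus> y \<in> L) \<and> (\<forall>a\<in>carrier R. \<forall>x\<in>L. a \<otimes> x \<in> L)"
  by (subst left_module.submodule_iff[OF regular_left_module]) (simp add: regular_module_def)

lemma (in ring) left_ideal_minus_closed:
  assumes L: "Module.submodule L R (regular_module R)" and "x \<in> L" "y \<in> L"
  shows "x \<ominus> y \<in> L"
proof -
  note L' = L[unfolded left_ideal_iff]
  have y: "y \<in> carrier R" using L' assms(3) by blast
  have "(\<ominus> \<one>) \<otimes> y \<in> L" using L' assms(3) a_inv_closed[OF one_closed] by blast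
  then have "\<ominus> y \<in> L" using y by (simp add: l_minus)
  then show ?thesis using L' assms(2) by (simp add: a_minus_def)
qed

lemma (in ring) jacobson_radical_left_ideal:
  "Module.submodule (jacobson_radical R) R (regular_module R)"
proof -
  let ?lid = "\<lambda>L. L \<subseteq> carrier R \<and> \<zero> \<in> L \<and> (\<forall>x\<in>L. \<forall>y\<in>L. x \<oplus> y \<in> L)
    \<and> (\<forall>a\<in>carrier R. \<forall>x\<in>L. a \<otimes> x \<in> L)"
  have "?lid L" if "maximal_left_ideal L R" for L
    using that left_ideal_iff[of L] unfolding maximal_left_ideal_def by (elim conjE) (rule iffD1)
  then have "?lid (carrier R \<inter> \<Inter> {L. maximal_left_ideal L R})"
    by (intro conjI ballI subsetI) auto
  then show ?thesis unfolding left_ideal_iff jacobson_radical_def .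
qed

lemma (in ring) jacobson_radical_closed: "x \<in> jacobson_radical R \<Longrightarrow> x \<in> carrier R"
  by (simp add: jacobson_radical_def)

lemma (in ring) radical_square_subset: "radical_square R \<subseteq> jacobson_radical R"
proof
  fix x assume "x \<in> radical_square R"
  then have "x \<in> ideal_prod R (jacobson_radical R) (jacobson_radical R)"
    by (simp add: radical_square_def)
  then show "x \<in> jacobson_radical R"
    using jacobson_radical_left_ideal[unfolded left_ideal_iff]
    by induction (auto dest: jacobson_radical_closed)
qed

text \<open>The annihilator of a nonzero \<open>s\<close> is a maximal left ideal, because every
  nonzero submodule of \<open>S\<close> is all of \<open>S\<close>; radical elements therefore lie
  in it.\<close>

lemma jacobson_radical_annihilates_simple:
  assumes S: "simple_module A S" and r: "r \<in> jacobson_radical A" and s: "s \<in> carrier S"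
  shows "r \<odot>\<^bsub>S\<^esub> s = \<zero>\<^bsub>S\<^esub>"
proof (cases "s = \<zero>\<^bsub>S\<^esub>")
  case True
  interpret left_module A S using S by (simp add: simple_module_def)
  show ?thesis using True r lsmult_zero_right A.jacobson_radical_closed by simp
next
  case False
  interpret left_module A S using S by (simp add: simple_module_def)
  let ?ann = "{a \<in> carrier A. a \<odot>\<^bsub>S\<^esub> s = \<zero>\<^bsub>S\<^esub>}"
  have sub: "Module.submodule ?ann A (regular_module A)"
    using s by (auto simp: A.left_ideal_iff lsmult_zero_left lsmult_zero_right lsmult_l_distr lsmult_assoc)
  have "\<one>\<^bsub>A\<^esub> \<notin> ?ann" using s False by (simp add: lsmult_one)
  then have proper: "?ann \<noteq> carrier A" by blast
  have "J = carrier A"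
    if J: "Module.submodule J A (regular_module A)" "?ann \<subseteq> J" "J \<noteq> ?ann" for J
  proof -
    note J' = J(1)[unfolded A.left_ideal_iff]
    \<comment> \<open>As \<open>J\<close> is strictly larger than the annihilator,
      \<open>J s\<close> is a nonzero submodule, hence equal to \<open>S\<close>.\<close>
    let ?H = "(\<lambda>a. a \<odot>\<^bsub>S\<^esub> s) ` J"
    have "Module.submodule ?H A S"
      unfolding submodule_iff
    proof (intro conjI ballI)
      show "?H \<subseteq> carrier S" using J' s lsmult_closed by auto
      show "\<zero>\<^bsub>S\<^esub> \<in> ?H" using J' s lsmult_zero_left by (metis image_eqI)
    next
      fix x y assume "x \<in> ?H" "y \<in> ?H"
      then obtain a b where ab: "a \<in> J" "x = a \<odot>\<^bsub>S\<^esub> s" "b \<in> J" "y = b \<odot>\<^bsub>S\<^esub> s" by auto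
      then have "x \<oplus>\<^bsub>S\<^esub> y = (a \<oplus>\<^bsub>A\<^esub> b) \<odot>\<^bsub>S\<^esub> s" using J' s lsmult_l_distr by (metis subsetD)
      then show "x \<oplus>\<^bsub>S\<^esub> y \<in> ?H" using J' ab by blast
    next
      fix a x assume a: "a \<in> carrier A" and "x \<in> ?H"
      then obtain b where b: "b \<in> J" "x = b \<odot>\<^bsub>S\<^esub> s" by auto
      then have "a \<odot>\<^bsub>S\<^esub> x = (a \<otimes>\<^bsub>A\<^esub> b) \<odot>\<^bsub>S\<^esub> s" using J' s a lsmult_assoc by (metis subsetD)
      then show "a \<odot>\<^bsub>S\<^esub> x \<in> ?H" using J' a b by blast
    qed
    moreover obtain j where "j \<in> J" "j \<notin> ?ann" using J by blast
    then have "?H \<noteq> {\<zero>\<^bsub>S\<^esub>}" using J' by auto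
    ultimately have H: "?H = carrier S" using S by (auto simp: simple_module_def)
    have "a \<in> J" if a: "a \<in> carrier A" for a
    proof -
      have "a \<odot>\<^bsub>S\<^esub> s \<in> ?H" using a s H lsmult_closed by simp
      then obtain b where b: "b \<in> J" "a \<odot>\<^bsub>S\<^esub> s = b \<odot>\<^bsub>S\<^esub> s" by auto
      then have bA: "b \<in> carrier A" using J' by auto
      \<comment> \<open>The element \<open>b\<close> of \<open>J\<close> acts on \<open>s\<close>
        like \<open>a\<close>, so \<open>a - b\<close> annihilates \<open>s\<close> and belongs to
        \<open>J\<close>; hence so does \<open>a\<close>.\<close>
      have "(a \<ominus>\<^bsub>A\<^esub> b) \<odot>\<^bsub>S\<^esub> s = \<zero>\<^bsub>S\<^esub>"
        using a bA b s by (simp add: a_minus_def lsmult_l_distr lsmult_minus_left lsmult_closed M.r_neg)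
      then have "a \<ominus>\<^bsub>A\<^esub> b \<in> J" using J a bA by auto
      then have "(a \<ominus>\<^bsub>A\<^esub> b) \<oplus>\<^bsub>A\<^esub> b \<in> J" using J' b by blast
      then show ?thesis using a bA by (simp add: a_minus_def A.a_assoc A.l_neg)
    qed
    then show ?thesis using J' by blast
  qed
  with sub proper have "maximal_left_ideal ?ann A" unfolding maximal_left_ideal_def by blast
  then have "r \<in> ?ann" using r by (auto simp: jacobson_radical_def)
  then show ?thesis by simp
qed

section \<open>Common eigenvectors of 0-Hecke generators of type B\<close>

text \<open>The relations are imposed on bare maps of a type, since the combinatorics of coset words
  involves composition alone. \<open>braid\<close> starts at index 1 because the pair 0, 1 obeys the
  four-letter relation instead.\<close>

locale hecke_action =
  fixes n :: nat and T :: "nat \<Rightarrow> 'v \<Rightarrow> 'v"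
  assumes idem: "i < n \<Longrightarrow> T i (T i x) = T i x"
    and braid: "\<lbrakk>1 \<le> i; Suc i < n\<rbrakk> \<Longrightarrow> T i (T (Suc i) (T i x)) = T (Suc i) (T i (T (Suc i) x))"
    and commute: "\<lbrakk>i < n; j < n; i + 2 \<le> j\<rbrakk> \<Longrightarrow> T i (T j x) = T j (T i x)"
    and braid4: "2 \<le> n \<Longrightarrow> T 0 (T 1 (T 0 (T 1 x))) = T 1 (T 0 (T 1 (T 0 x)))"
begin

lemma commute_word:
  assumes "i < n" "\<And>j. j \<in> set w \<Longrightarrow> j < n \<and> (i + 2 \<le> j \<or> j + 2 \<le> i)"
  shows "T i (foldr T w x) = foldr T w (T i x)"
  using assms(2)
proof (induction w)
  case (Cons j w)
  then have "T i (T j y) = T j (T i y)" for y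
    using commute[of i j y] commute[of j i y] assms(1) by force
  then show ?case using Cons by simp
qed simp

text \<open>The letter \<open>Suc j\<close> commutes inwards to the adjacent pair
  \<open>j, Suc j\<close>, the braid relation exchanges it for \<open>j\<close> behind the pair, and
  this commutes with all later letters. The bound \<open>1 \<le> j\<close> keeps the pair away from
  0, 1.\<close>

lemma shift_ascending:
  assumes "l \<le> j" "1 \<le> j" "Suc j < m" "m \<le> n"
  shows "T (Suc j) (foldr T [l..<m] x) = foldr T [l..<m] (T j x)"
proof -
  have split: "[l..<m] = [l..<j] @ j # Suc j # [Suc (Suc j)..<m]"
    using assms by (metis Suc_lessD le_Suc_ex upt_add_eq_append upt_conv_Cons le_eq_less_or_eq)
  have "T (Suc j) (foldr T [l..<m] x)
      = foldr T [l..<j] (T (Suc j) (T j (T (Suc j) (foldr T [Suc (Suc j)..<m] x))))"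
    unfolding split using assms by (simp, subst commute_word) auto
  also have "\<dots> = foldr T [l..<j] (T j (T (Suc j) (T j (foldr T [Suc (Suc j)..<m] x))))"
    using assms by (simp add: braid)
  also have "\<dots> = foldr T [l..<m] (T j x)"
    unfolding split using assms by (simp, subst commute_word) auto
  finally show ?thesis .
qed

text \<open>Mirror image of \<open>shift_ascending\<close>: crossing a descending word raises the
  index by one instead of lowering it.\<close>

lemma shift_descending:
  assumes "1 \<le> j" "j < k" "k < n"
  shows "T j (foldr T (rev [1..<Suc k]) x) = foldr T (rev [1..<Suc k]) (T (Suc j) x)"
proof -
  have "[1..<Suc k] = [1..<j] @ j # Suc j # [Suc (Suc j)..<Suc k]"
    using assms
    by (metis Suc_lessD Suc_less_eq le_Suc_ex upt_add_eq_append upt_conv_Cons le_eq_less_or_eq)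
  then have split: "rev [1..<Suc k] = rev [Suc (Suc j)..<Suc k] @ Suc j # j # rev [1..<j]"
    by simp
  have "T j (foldr T (rev [1..<Suc k]) x)
      = foldr T (rev [Suc (Suc j)..<Suc k]) (T j (T (Suc j) (T j (foldr T (rev [1..<j]) x))))"
    unfolding split using assms by (simp del: upt_Suc, subst commute_word) auto
  also have "\<dots> = foldr T (rev [Suc (Suc j)..<Suc k])
      (T (Suc j) (T j (T (Suc j) (foldr T (rev [1..<j]) x))))"
    using assms by (simp add: braid del: upt_Suc)
  also have "\<dots> = foldr T (rev [1..<Suc k]) (T (Suc j) x)"
    unfolding split using assms by (simp del: upt_Suc, subst commute_word) auto
  finally show ?thesis .
qed

text \<open>Reduced words of the minimal coset representatives of \<open>B\<^sub>m\<close> modulo \<open>B\<^sub>m\<^sub>-\<^sub>1\<close>: these form a chain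
  in the weak order, so a generator fixes a representative, moves it to the next one, or passes
  through it to a generator of \<open>B\<^sub>m\<^sub>-\<^sub>1\<close>.\<close>

definition coset_word :: "nat \<Rightarrow> nat \<Rightarrow> nat list" where
  "coset_word m k = (if k \<le> m then [m - k..<m] else rev [1..<Suc (k - m)] @ [0..<m])"

text \<open>The number \<open>2 * m\<close> is the index of the type B group of rank
  \<open>m - 1\<close> in that of rank \<open>m\<close>. A generator repeats the first letter,
  extends the word on the left, or crosses it by the shift and commutation lemmas;
  \<open>Suc j < m\<close> says that the letter coming out belongs to the previous rank.\<close>

lemma coset_word_cases:
  assumes i: "i < m" and m: "m \<le> n" and k: "k < 2 * m"
  shows "(\<forall>x. T i (foldr T (coset_word m k) x) = foldr T (coset_word m k) x) \<or>
    (Suc k < 2 * m \<and> (\<forall>x. T i (foldr T (coset_word m k) x) = foldr T (coset_word m (Suc k)) x)) \<or>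
    (\<exists>j. Suc j < m \<and> (\<forall>x. T i (foldr T (coset_word m k) x) = foldr T (coset_word m k) (T j x)))"
    (is "?fix \<or> ?next \<or> ?pass")
proof (cases "k \<le> m")
  case True
  define l where "l = m - k"
  have c: "coset_word m k = [l..<m]" using True by (simp add: coset_word_def l_def)
  consider "i = l" "l < m" | "Suc i = l" | "Suc i < l" | "l < i" "2 \<le> i" | "l = 0" "i = 1"
    using i by linarith
  then show ?thesis
  proof cases
    case 1
    then show ?thesis using i m by (simp add: c upt_conv_Cons[of l] idem)
  next
    case 2
    then have "coset_word m (Suc k) = i # [l..<m]"
      using True i by (auto simp: coset_word_def l_def upt_conv_Cons Suc_diff_Suc)
    moreover have "Suc k < 2 * m" using 2 True k by (simp add: l_def)
    ultimately show ?thesis by (simp add: c)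
  next
    case 3
    then have "T i (foldr T [l..<m] x) = foldr T [l..<m] (T i x)" for x
      using i m by (intro commute_word) auto
    moreover have "Suc i < m" using 3 by (simp add: l_def)
    ultimately show ?thesis unfolding c by blast
  next
    case 4
    then have "T i (foldr T [l..<m] x) = foldr T [l..<m] (T (i - 1) x)" for x
      using shift_ascending[of l "i - 1" m x] i m by simp
    moreover have "Suc (i - 1) < m" using 4 i by simp
    ultimately show ?thesis unfolding c by blast
  next
    case 5
    then have "k = m" using True i by (simp add: l_def)
    \<comment> \<open>Turning point of the chain: once the word starts with 0, it is extended on the
      left by 1, 2 and so on.\<close>
    then have "coset_word m (Suc k) = 1 # [l..<m]" "Suc k < 2 * m"
      using 5 i by (auto simp: coset_word_def)
    then show ?thesis using 5 by (simp add: c)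
  qed
next
  case False
  define l where "l = k - m"
  have l: "1 \<le> l" "l < m" using False k by (auto simp: l_def)
  have c: "coset_word m k = rev [1..<Suc l] @ [0..<m]" using False by (simp add: coset_word_def l_def)
  have c': "rev [1..<Suc l] = l # rev [1..<l]" using l by (simp add: upt_Suc)
  consider "i = l" | "i = Suc l" | "Suc l < i" | "1 \<le> i" "i < l" | "i = 0" by linarith
  then show ?thesis
  proof cases
    case 1
    then show ?thesis using l m unfolding c c' by (simp add: idem)
  next
    case 2
    then have "coset_word m (Suc k) = i # rev [1..<Suc l] @ [0..<m]"
      using False by (auto simp: coset_word_def l_def Suc_diff_le)
    moreover have "Suc k < 2 * m" using 2 i by (simp add: l_def)
    ultimately show ?thesis by (simp add: c)
  next
    case 3
    \<comment> \<open>The letter exceeds the descending part by at least two and commutes past it;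
      the ascending part then lowers it by one.\<close>
    have "T i (foldr T (coset_word m k) x) = foldr T (coset_word m k) (T (i - 1) x)" for x
    proof -
      have "T i (foldr T (rev [1..<Suc l] @ [0..<m]) x)
          = foldr T (rev [1..<Suc l]) (T i (foldr T [0..<m] x))"
        using 3 l i m by (simp only: foldr_append comp_def, intro commute_word) auto
      also have "\<dots> = foldr T (rev [1..<Suc l]) (foldr T [0..<m] (T (i - 1) x))"
        using shift_ascending[of 0 "i - 1" m x] 3 l i m by simp
      finally show ?thesis by (simp add: c)
    qed
    moreover have "Suc (i - 1) < m" using 3 i by simp
    ultimately show ?thesis by blast
  next
    case 4
    \<comment> \<open>The descending part raises the index by one and the ascending part lowers it
      again.\<close>
    have "T i (foldr T (coset_word m k) x) = foldr T (coset_word m k) (T i x)" for x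
    proof -
      have "T i (foldr T (rev [1..<Suc l] @ [0..<m]) x)
          = foldr T (rev [1..<Suc l]) (T (Suc i) (foldr T [0..<m] x))"
        using shift_descending[of i l] 4 l m by (simp only: foldr_append comp_def)
      also have "\<dots> = foldr T (rev [1..<Suc l]) (foldr T [0..<m] (T i x))"
        using shift_ascending[of 0 i m x] 4 l m by simp
      finally show ?thesis by (simp add: c)
    qed
    moreover have "Suc i < m" using 4 l by simp
    ultimately show ?thesis by blast
  next
    case 5
    \<comment> \<open>The case that rests on \<open>braid4\<close>: 0 passes
      \<open>l, ..., 2\<close> and meets \<open>1, 0, 1\<close>; after \<open>0, 1, 0, 1\<close> is
      rewritten to \<open>1, 0, 1, 0\<close>, the last 0 commutes past
      \<open>2, ..., m - 1\<close>.\<close>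
    have "T 0 (foldr T (coset_word m k) x) = foldr T (coset_word m k) (T 0 x)" for x
    proof -
      have u: "[0..<m] = 0 # 1 # [2..<m]" using l by (simp add: upt_conv_Cons numeral_2_eq_2)
      have d: "rev [1..<Suc l] = rev [2..<Suc l] @ [1]"
        using l by (simp add: upt_conv_Cons numeral_2_eq_2)
      have "T 0 (foldr T (rev [1..<Suc l] @ [0..<m]) x)
          = foldr T (rev [2..<Suc l]) (T 0 (T 1 (T 0 (T 1 (foldr T [2..<m] x)))))"
        unfolding u d using l m by (simp del: upt_Suc, subst commute_word) auto
      also have "\<dots> = foldr T (rev [2..<Suc l]) (T 1 (T 0 (T 1 (T 0 (foldr T [2..<m] x)))))"
        using l m by (simp add: braid4[simplified] del: upt_Suc)
      also have "T 0 (foldr T [2..<m] x) = foldr T [2..<m] (T 0 x)"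
        using l m by (intro commute_word) auto
      finally show ?thesis unfolding c u d by (simp del: upt_Suc)
    qed
    moreover have "Suc 0 < m" using l by simp
    ultimately show ?thesis using 5 by blast
  qed
qed

end

section \<open>Eigenvectors modulo a left ideal\<close>

locale hecke_generators = ring A for A :: "('a, 'e) ring_scheme" (structure) +
  fixes n :: nat and p :: "nat \<Rightarrow> 'a"
  assumes gen_closed: "i < n \<Longrightarrow> p i \<in> carrier A"
    and gen_idem: "i < n \<Longrightarrow> p i \<otimes> p i = p i"
    and gen_braid: "\<lbrakk>1 \<le> i; Suc i < n\<rbrakk>
      \<Longrightarrow> p i \<otimes> (p (Suc i) \<otimes> p i) = p (Suc i) \<otimes> (p i \<otimes> p (Suc i))"
    and gen_commute: "\<lbrakk>i < n; j < n; i + 2 \<le> j\<rbrakk> \<Longrightarrow> p i \<otimes> p j = p j \<otimes> p i"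
    and gen_braid4: "2 \<le> n \<Longrightarrow> p 0 \<otimes> (p 1 \<otimes> (p 0 \<otimes> p 1)) = p 1 \<otimes> (p 0 \<otimes> (p 1 \<otimes> p 0))"
begin

text \<open>Outside the carrier the action is made trivial, so that the relations hold for all arguments.\<close>

definition act :: "nat \<Rightarrow> 'a \<Rightarrow> 'a" where
  "act i x = (if i < n \<and> x \<in> carrier A then p i \<otimes> x else x)"

lemma act_closed: "x \<in> carrier A \<Longrightarrow> act i x \<in> carrier A"
  by (simp add: act_def gen_closed)

lemma hecke_action_act: "hecke_action n act"
proof (unfold_locales, goal_cases)
  case (1 i x)
  then show ?case using gen_idem[of i] by (simp add: act_def gen_closed m_assoc[symmetric])
next
  case (2 i x)
  then show ?case using gen_braid[of i] by (simp add: act_def gen_closed m_assoc[symmetric])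
next
  case (3 i j x)
  then show ?case using gen_commute[of i j] by (simp add: act_def gen_closed m_assoc[symmetric])
next
  case (4 x)
  then show ?case using gen_braid4 by (simp add: act_def gen_closed m_assoc[symmetric])
qed

interpretation hecke_action n act by (rule hecke_action_act)

lemma act_word_closed: "x \<in> carrier A \<Longrightarrow> foldr act w x \<in> carrier A"
  by (induction w) (auto intro: act_closed)

lemma act_word_minus:
  assumes "x \<in> carrier A" "y \<in> carrier A"
  shows "foldr act w (x \<ominus> y) = foldr act w x \<ominus> foldr act w y"
proof (induction w)
  case (Cons i w)
  have "act i (u \<ominus> v) = act i u \<ominus> act i v" if "u \<in> carrier A" "v \<in> carrier A" for u v
    using that by (simp add: act_def gen_closed a_minus_def r_distr r_minus)
  then show ?case
    using Cons act_word_closed[OF assms(1), of w] act_word_closed[OF assms(2), of w] by simp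
qed simp

lemma act_word_left_ideal:
  assumes "Module.submodule L A (regular_module A)" "x \<in> L"
  shows "foldr act w x \<in> L"
  using assms by (induction w) (auto simp: left_ideal_iff act_def gen_closed)

text \<open>The induction starts from the unit, which is outside \<open>L\<close>. In the step, a
  generator applied to the last surviving translate of \<open>v\<close> fixes it, moves it to a
  translate inside \<open>L\<close>, or reaches \<open>v\<close> as an earlier generator, which acts
  there as 0 or 1.\<close>

lemma common_eigenvector:
  assumes L: "Module.submodule L A (regular_module A)" and one: "\<one> \<notin> L" and m: "m \<le> n"
  shows "\<exists>v\<in>carrier A - L. \<forall>i<m. p i \<otimes> v \<in> L \<or> p i \<otimes> v \<ominus> v \<in> L"
  using m
proof (induction m)
  case 0
  then show ?case using one by (intro bexI[of _ \<one>]) auto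
next
  case (Suc m)
  then obtain v where v: "v \<in> carrier A" "v \<notin> L"
    and eig: "\<And>i. i < m \<Longrightarrow> p i \<otimes> v \<in> L \<or> p i \<otimes> v \<ominus> v \<in> L"
    using Suc_leD by (metis DiffE)
  define P where "P k \<longleftrightarrow> k < 2 * Suc m \<and> foldr act (coset_word (Suc m) k) v \<notin> L" for k
  have "P 0" using v by (simp add: P_def coset_word_def)
  \<comment> \<open>Maximality of \<open>k\<close> is what puts the next translate, if there is one,
    into \<open>L\<close>.\<close>
  then obtain k where k: "P k" "\<And>j. P j \<Longrightarrow> j \<le> k"
    using GreatestI_nat[of P 0 "2 * Suc m"] Greatest_le_nat[of P _ "2 * Suc m"]
    by (metis P_def less_imp_le_nat)
  let ?C = "foldr act (coset_word (Suc m) k)"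
  have C: "?C v \<in> carrier A" using v by (simp add: act_word_closed)
  have "p i \<otimes> ?C v \<in> L \<or> p i \<otimes> ?C v \<ominus> ?C v \<in> L" if i: "i < Suc m" for i
  proof -
    have "act i (?C v) = p i \<otimes> ?C v" using C i Suc.prems by (simp add: act_def)
    moreover consider "act i (?C v) = ?C v"
      | "Suc k < 2 * Suc m" "act i (?C v) = foldr act (coset_word (Suc m) (Suc k)) v"
      | j where "j < m" "act i (?C v) = ?C (act j v)"
      using coset_word_cases[OF i Suc.prems, of k] k(1) unfolding P_def by auto
    then have "act i (?C v) \<in> L \<or> act i (?C v) \<ominus> ?C v \<in> L"
    proof cases
      case 1
      then show ?thesis using C L by (simp add: a_minus_def r_neg left_ideal_iff)
    next
      case 2
      then show ?thesis using k(2)[of "Suc k"] by (auto simp: P_def)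
    next
      case 3
      then have j: "act j v = p j \<otimes> v" "act j v \<in> carrier A"
        using Suc.prems v by (auto simp: act_def gen_closed)
      \<comment> \<open>The map \<open>?C\<close> preserves \<open>L\<close> and differences, so the
        eigenvalue of \<open>p j\<close> on \<open>v\<close> becomes the eigenvalue of
        \<open>p i\<close> on \<open>?C v\<close>.\<close>
      show ?thesis
        using eig[OF 3(1)] act_word_left_ideal[OF L, of _ "coset_word (Suc m) k"] 3(2)
          act_word_minus[OF j(2) v(1), of "coset_word (Suc m) k"] j(1) by metis
    qed
    ultimately show ?thesis by simp
  qed
  then show ?case using C k(1) unfolding P_def by blast
qed

end

section \<open>Algebras of presented monoids\<close>

locale presentation =
  fixes n :: nat and R :: "(nat list \<times> nat list) set"
  assumes rels_words: "R \<subseteq> lists {..<n} \<times> lists {..<n}"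
begin

abbreviation "cong_class w \<equiv> pres_cong n R `` {w}"
abbreviation "alg \<equiv> monoid_algebra (pres_monoid n R)"

lemma pres_cong_words: "(u, v) \<in> pres_cong n R \<Longrightarrow> u \<in> lists {..<n} \<and> v \<in> lists {..<n}"
  by (induction rule: pres_cong.induct) (use rels_words in auto)

lemma equiv_pres_cong: "equiv (lists {..<n}) (pres_cong n R)"
  using pres_cong_words
  by (intro equivI refl_onI symI transI) (auto intro: pres_cong.refl pres_cong.sym pres_cong.trans)

lemma pres_cong_context:
  "\<lbrakk>(u, v) \<in> pres_cong n R; a \<in> lists {..<n}; b \<in> lists {..<n}\<rbrakk>
    \<Longrightarrow> (a @ u @ b, a @ v @ b) \<in> pres_cong n R"
proof (induction rule: pres_cong.induct)
  case (rel u v c d)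
  then show ?case
    using pres_cong.rel[of u v R "a @ c" n "d @ b"] by simp
qed (auto intro!: pres_cong.refl intro: pres_cong.sym pres_cong.trans)

lemma pres_cong_append:
  assumes "(u, u') \<in> pres_cong n R" "(v, v') \<in> pres_cong n R"
  shows "(u @ v, u' @ v') \<in> pres_cong n R"
  using pres_cong_context[OF assms(1), of "[]" v] pres_cong_context[OF assms(2), of u' "[]"]
    pres_cong_words[OF assms(1)] pres_cong_words[OF assms(2)]
  by (auto intro: pres_cong.trans)

lemma cong_class_eq_iff:
  "\<lbrakk>u \<in> lists {..<n}; v \<in> lists {..<n}\<rbrakk> \<Longrightarrow> cong_class u = cong_class v \<longleftrightarrow> (u, v) \<in> pres_cong n R"
  using eq_equiv_class_iff[OF equiv_pres_cong] by blast

lemma carrier_pres_monoid: "carrier (pres_monoid n R) = cong_class ` lists {..<n}"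
  by (auto simp: pres_monoid_def quotient_def)

lemma pres_monoid_mult:
  assumes "u \<in> lists {..<n}" "v \<in> lists {..<n}"
  shows "cong_class u \<otimes>\<^bsub>pres_monoid n R\<^esub> cong_class v = cong_class (u @ v)"
proof -
  have "congruent2 (pres_cong n R) (pres_cong n R) (\<lambda>u v. cong_class (u @ v))"
    by (intro congruent2I'[OF equiv_class_eq[OF equiv_pres_cong]] pres_cong_append)
  then show ?thesis
    using UN_equiv_class2[OF equiv_pres_cong equiv_pres_cong _ assms] by (simp add: pres_monoid_def)
qed

lemma monoid_pres_monoid: "monoid (pres_monoid n R)"
proof -
  have one: "\<one>\<^bsub>pres_monoid n R\<^esub> = cong_class []" by (simp add: pres_monoid_def)
  have nil: "[] \<in> lists {..<n}" by simp
  show ?thesis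
    by (rule monoidI; (unfold carrier_pres_monoid one)?; (elim imageE)?)
       (simp_all add: pres_monoid_mult image_eqI[OF HOL.refl] nil del: in_lists_conv_set)
qed

sublocale complex_algebra alg
  by (rule complex_algebra_monoid_algebra[OF monoid_pres_monoid])

definition word :: "nat list \<Rightarrow> nat list set \<Rightarrow> complex" where
  "word w = monoid_basis (cong_class w)"

lemma word_closed: "w \<in> lists {..<n} \<Longrightarrow> word w \<in> carrier alg"
  unfolding word_def by (rule monoid_basis_closed) (unfold carrier_pres_monoid, rule imageI)

lemma word_append:
  "\<lbrakk>u \<in> lists {..<n}; v \<in> lists {..<n}\<rbrakk> \<Longrightarrow> word u \<otimes>\<^bsub>alg\<^esub> word v = word (u @ v)"
  by (simp add: word_def monoid_basis_mult pres_monoid_mult)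

lemma word_Nil: "word [] = \<one>\<^bsub>alg\<^esub>"
  by (simp add: word_def monoid_algebra_sel) (simp add: pres_monoid_def)

lemma word_singleton: "word [i] = monoid_basis (pres_gen n R i)"
  by (simp add: word_def pres_gen_def)

lemma word_eqI: "(u, v) \<in> pres_cong n R \<Longrightarrow> word u = word v"
  using equiv_class_eq[OF equiv_pres_cong] by (simp add: word_def)

lemma word_Cons: "\<lbrakk>i < n; w \<in> lists {..<n}\<rbrakk> \<Longrightarrow> word (i # w) = word [i] \<otimes>\<^bsub>alg\<^esub> word w"
  by (subst word_append) auto

lemma alg_induct [consumes 1, case_names word scale add]:
  assumes f: "f \<in> carrier alg"
    and word: "\<And>w. w \<in> lists {..<n} \<Longrightarrow> P (word w)"
    and scale: "\<And>c f. \<lbrakk>f \<in> carrier alg; P f\<rbrakk> \<Longrightarrow> P (c \<odot>\<^bsub>alg\<^esub> f)"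
    and add: "\<And>f g. \<lbrakk>f \<in> carrier alg; g \<in> carrier alg; P f; P g\<rbrakk> \<Longrightarrow> P (f \<oplus>\<^bsub>alg\<^esub> g)"
  shows "P f"
  using f monoid_pres_monoid
proof (induction rule: monoid_algebra_induct)
  case (basis x)
  then show ?case using word by (auto simp: carrier_pres_monoid word_def)
next
  case (scale c f)
  then show ?case using assms(3) by (simp add: monoid_algebra_sel)
next
  case (add f g)
  then show ?case using assms(4) by (simp add: monoid_algebra_sel)
qed

end

lemma H0_B_rels_words: "H0_B_rels n \<subseteq> lists {..<n} \<times> lists {..<n}"
  by (auto simp: H0_B_rels_def common_rels_def split: if_splits)

lemma R0_rels_words: "R0_rels n \<subseteq> lists {..<n} \<times> lists {..<n}"
  by (auto simp: R0_rels_def common_rels_def split: if_splits)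

lemma H0_A_rels_words: "H0_A_rels n \<subseteq> lists {..<n} \<times> lists {..<n}"
  by (auto simp: H0_A_rels_def common_rels_def split: if_splits)

text \<open>Treats \<open>H0_B\<close> and \<open>R0\<close> together: the type B relations hold in
  both, and both are the domain of a morphism whose kernel is to be bounded.\<close>

locale hecke_quotient = presentation +
  assumes H0_B_cong: "H0_B_rels n \<subseteq> pres_cong n R"
begin

lemma word_rel: "(u, v) \<in> H0_B_rels n \<Longrightarrow> word u = word v"
  using H0_B_cong word_eqI by blast

sublocale hecke: hecke_generators alg n "\<lambda>i. word [i]"
proof (unfold_locales, goal_cases)
  case (1 i)
  then show ?case by (simp add: word_closed)
next
  case (2 i)
  then have "word [i, i] = word [i]"
    by (intro word_rel) (auto simp: H0_B_rels_def common_rels_def)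
  with 2 show ?case by (simp add: word_append)
next
  case (3 i)
  then have "word [i, i + 1, i] = word [i + 1, i, i + 1]"
    by (intro word_rel) (auto simp: H0_B_rels_def common_rels_def)
  with 3 show ?case by (simp add: word_append)
next
  case (4 i j)
  then have "word [i, j] = word [j, i]"
    by (intro word_rel) (auto simp: H0_B_rels_def common_rels_def)
  with 4 show ?case by (simp add: word_append)
next
  case 5
  then have "word [0, 1, 0, 1] = word [1, 0, 1, 0]"
    by (intro word_rel) (auto simp: H0_B_rels_def)
  with 5 show ?case by (simp add: word_append)
qed

section \<open>Action of the algebra on an eigenvector modulo a left ideal\<close>

context
  fixes L v
  assumes L: "Module.submodule L alg (regular_module alg)" and v: "v \<in> carrier alg"
    and eig: "\<And>i. i < n \<Longrightarrow> word [i] \<otimes>\<^bsub>alg\<^esub> v \<in> L \<or> word [i] \<otimes>\<^bsub>alg\<^esub> v \<ominus>\<^bsub>alg\<^esub> v \<in> L"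
begin

lemma left_ideal_add: "\<lbrakk>x \<in> L; y \<in> L\<rbrakk> \<Longrightarrow> x \<oplus>\<^bsub>alg\<^esub> y \<in> L"
  and left_ideal_mult: "\<lbrakk>a \<in> carrier alg; x \<in> L\<rbrakk> \<Longrightarrow> a \<otimes>\<^bsub>alg\<^esub> x \<in> L"
  and left_ideal_zero: "\<zero>\<^bsub>alg\<^esub> \<in> L"
  and left_ideal_closed: "x \<in> L \<Longrightarrow> x \<in> carrier alg"
  using L[unfolded left_ideal_iff] by auto

text \<open>Modulo \<open>L\<close> a word multiplies \<open>v\<close> by the product of the
  eigenvalues of its letters, each 0 or 1. The result depends only on the set of letters, which is
  the source of all radical elements used later.\<close>

lemma word_eigenvector:
  assumes "w \<in> lists {..<n}"
  shows "if \<exists>i\<in>set w. word [i] \<otimes>\<^bsub>alg\<^esub> v \<in> L then word w \<otimes>\<^bsub>alg\<^esub> v \<in> L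
    else word w \<otimes>\<^bsub>alg\<^esub> v \<ominus>\<^bsub>alg\<^esub> v \<in> L"
  using assms
proof (induction w)
  case Nil
  then show ?case using v left_ideal_zero by (simp add: word_Nil a_minus_def r_neg)
next
  case (Cons i w)
  then have w: "w \<in> lists {..<n}" and i: "i < n" by auto
  have e: "word (i # w) \<otimes>\<^bsub>alg\<^esub> v = word [i] \<otimes>\<^bsub>alg\<^esub> (word w \<otimes>\<^bsub>alg\<^esub> v)"
    using w i v by (simp add: word_Cons[OF i w] word_closed m_assoc)
  note cl = word_closed[OF w] hecke.gen_closed[OF i]
  show ?case
  proof (cases "\<exists>j\<in>set w. word [j] \<otimes>\<^bsub>alg\<^esub> v \<in> L")
    case True
    then show ?thesis using Cons w cl by (simp add: e left_ideal_mult)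
  next
    case False
    then have "word w \<otimes>\<^bsub>alg\<^esub> v \<ominus>\<^bsub>alg\<^esub> v \<in> L" using Cons w by simp
    then have d: "word [i] \<otimes>\<^bsub>alg\<^esub> (word w \<otimes>\<^bsub>alg\<^esub> v \<ominus>\<^bsub>alg\<^esub> v) \<in> L" using cl by (intro left_ideal_mult)
    have eq: "word [i] \<otimes>\<^bsub>alg\<^esub> (word w \<otimes>\<^bsub>alg\<^esub> v \<ominus>\<^bsub>alg\<^esub> v) \<oplus>\<^bsub>alg\<^esub> word [i] \<otimes>\<^bsub>alg\<^esub> v = word (i # w) \<otimes>\<^bsub>alg\<^esub> v"
      using cl v by (simp add: e a_minus_def r_distr r_minus a_assoc l_neg)
    show ?thesis
    proof (cases "word [i] \<otimes>\<^bsub>alg\<^esub> v \<in> L")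
      case True
      then show ?thesis using left_ideal_add[OF d True] eq by simp
    next
      case i': False
      then have "word [i] \<otimes>\<^bsub>alg\<^esub> v \<ominus>\<^bsub>alg\<^esub> v \<in> L" using eig[OF i] by simp
      from left_ideal_add[OF d this] have "word (i # w) \<otimes>\<^bsub>alg\<^esub> v \<ominus>\<^bsub>alg\<^esub> v \<in> L"
        using cl v left_ideal_closed[OF d] by (simp add: eq[symmetric] a_minus_def a_assoc)
      then show ?thesis using False i' by simp
    qed
  qed
qed

text \<open>Linear extension of \<open>word_eigenvector\<close>: modulo \<open>L\<close>, the left
  ideal generated by \<open>v\<close> is the line spanned by \<open>v\<close>.\<close>

lemma eigenvector_multiple:
  assumes "f \<in> carrier alg"
  shows "\<exists>c. f \<otimes>\<^bsub>alg\<^esub> v \<ominus>\<^bsub>alg\<^esub> (c \<odot>\<^bsub>alg\<^esub> v) \<in> L"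
  using assms
proof (induction rule: alg_induct)
  case (word w)
  show ?case
  proof (cases "\<exists>i\<in>set w. word [i] \<otimes>\<^bsub>alg\<^esub> v \<in> L")
    case True
    then have "word w \<otimes>\<^bsub>alg\<^esub> v \<in> L" using word_eigenvector[OF word] by simp
    then show ?thesis
      using v left_ideal_closed by (intro exI[of _ 0]) (simp add: scale_zero_left a_minus_def)
  next
    case False
    then have "word w \<otimes>\<^bsub>alg\<^esub> v \<ominus>\<^bsub>alg\<^esub> v \<in> L" using word_eigenvector[OF word] by simp
    then show ?thesis using v by (intro exI[of _ 1]) (simp add: scale_one)
  qed
next
  case (scale c f)
  then obtain d where d: "f \<otimes>\<^bsub>alg\<^esub> v \<ominus>\<^bsub>alg\<^esub> (d \<odot>\<^bsub>alg\<^esub> v) \<in> L" by blast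
  have "(c \<odot>\<^bsub>alg\<^esub> \<one>\<^bsub>alg\<^esub>) \<otimes>\<^bsub>alg\<^esub> (f \<otimes>\<^bsub>alg\<^esub> v \<ominus>\<^bsub>alg\<^esub> (d \<odot>\<^bsub>alg\<^esub> v)) \<in> L"
    using d by (intro left_ideal_mult scale_closed) auto
  then have "(c \<odot>\<^bsub>alg\<^esub> f) \<otimes>\<^bsub>alg\<^esub> v \<ominus>\<^bsub>alg\<^esub> ((c * d) \<odot>\<^bsub>alg\<^esub> v) \<in> L"
    using scale(1) v
    by (simp add: a_minus_def r_distr r_minus scale_closed scale_mult_left scale_assoc)
  then show ?case by blast
next
  case (add f g)
  then obtain c d where c: "f \<otimes>\<^bsub>alg\<^esub> v \<ominus>\<^bsub>alg\<^esub> (c \<odot>\<^bsub>alg\<^esub> v) \<in> L" and d: "g \<otimes>\<^bsub>alg\<^esub> v \<ominus>\<^bsub>alg\<^esub> (d \<odot>\<^bsub>alg\<^esub> v) \<in> L"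
    by blast
  have "(f \<oplus>\<^bsub>alg\<^esub> g) \<otimes>\<^bsub>alg\<^esub> v \<ominus>\<^bsub>alg\<^esub> ((c + d) \<odot>\<^bsub>alg\<^esub> v)
      = (f \<otimes>\<^bsub>alg\<^esub> v \<ominus>\<^bsub>alg\<^esub> (c \<odot>\<^bsub>alg\<^esub> v)) \<oplus>\<^bsub>alg\<^esub> (g \<otimes>\<^bsub>alg\<^esub> v \<ominus>\<^bsub>alg\<^esub> (d \<odot>\<^bsub>alg\<^esub> v))"
    using add(1,2) v
    by (simp add: a_minus_def l_distr scale_l_distr scale_closed minus_add a_ac)
  then show ?case using left_ideal_add[OF c d] by metis
qed

lemma same_letters_annihilate_eigenvector:
  assumes u: "u \<in> lists {..<n}" and w: "w \<in> lists {..<n}" and set: "set u = set w"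
  shows "(word u \<ominus>\<^bsub>alg\<^esub> word w) \<otimes>\<^bsub>alg\<^esub> v \<in> L"
proof -
  note cl = word_closed[OF u] word_closed[OF w] v
  have "word u \<otimes>\<^bsub>alg\<^esub> v \<ominus>\<^bsub>alg\<^esub> word w \<otimes>\<^bsub>alg\<^esub> v \<in> L"
  proof (cases "\<exists>i\<in>set u. word [i] \<otimes>\<^bsub>alg\<^esub> v \<in> L")
    case True
    then show ?thesis
      using word_eigenvector[OF u] word_eigenvector[OF w] set left_ideal_minus_closed[OF L] by simp
  next
    case False
    then have "(word u \<otimes>\<^bsub>alg\<^esub> v \<ominus>\<^bsub>alg\<^esub> v) \<ominus>\<^bsub>alg\<^esub> (word w \<otimes>\<^bsub>alg\<^esub> v \<ominus>\<^bsub>alg\<^esub> v) \<in> L"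
      using word_eigenvector[OF u] word_eigenvector[OF w] set left_ideal_minus_closed[OF L] by simp
    moreover have "(word u \<otimes>\<^bsub>alg\<^esub> v \<ominus>\<^bsub>alg\<^esub> v) \<ominus>\<^bsub>alg\<^esub> (word w \<otimes>\<^bsub>alg\<^esub> v \<ominus>\<^bsub>alg\<^esub> v)
        = word u \<otimes>\<^bsub>alg\<^esub> v \<ominus>\<^bsub>alg\<^esub> word w \<otimes>\<^bsub>alg\<^esub> v"
      using cl by (simp add: a_minus_def minus_add a_assoc r_neg2 a_lcomm l_neg r_neg1)
        (simp add: a_comm)
    ultimately show ?thesis by simp
  qed
  then show ?thesis using cl by (simp add: a_minus_def l_distr l_minus)
qed

end

text \<open>For a maximal left ideal \<open>L\<close> and an eigenvector \<open>v\<close> outside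
  it, \<open>L + A v\<close> is the whole algebra, so \<open>y\<close> is congruent to a multiple of
  \<open>v\<close>. The difference of the words maps \<open>L\<close> into \<open>L\<close> and
  \<open>v\<close> into \<open>L\<close>. The factor \<open>y\<close> makes up for right
  multiplication, as the radical is treated as a left ideal.\<close>

lemma same_letters_mult_radical:
  assumes u: "u \<in> lists {..<n}" and w: "w \<in> lists {..<n}" and set: "set u = set w"
    and y: "y \<in> carrier alg"
  shows "(word u \<ominus>\<^bsub>alg\<^esub> word w) \<otimes>\<^bsub>alg\<^esub> y \<in> jacobson_radical alg"
proof -
  let ?d = "word u \<ominus>\<^bsub>alg\<^esub> word w"
  have d: "?d \<in> carrier alg" using u w by (simp add: word_closed)
  have "?d \<otimes>\<^bsub>alg\<^esub> y \<in> L" if max: "maximal_left_ideal L alg" for L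
  proof -
    have L: "Module.submodule L alg (regular_module alg)" and proper: "L \<noteq> carrier alg"
      using max by (auto simp: maximal_left_ideal_def)
    note L' = L[unfolded left_ideal_iff]
    have "\<one>\<^bsub>alg\<^esub> \<notin> L"
    proof
      assume "\<one>\<^bsub>alg\<^esub> \<in> L"
      then have "x \<in> L" if "x \<in> carrier alg" for x using L' that r_one by metis
      then show False using proper L' by blast
    qed
    then obtain v where v: "v \<in> carrier alg" "v \<notin> L"
      and eig: "\<And>i. i < n \<Longrightarrow> word [i] \<otimes>\<^bsub>alg\<^esub> v \<in> L \<or> word [i] \<otimes>\<^bsub>alg\<^esub> v \<ominus>\<^bsub>alg\<^esub> v \<in> L"
      using hecke.common_eigenvector[OF L _ order_refl] by blast
    \<comment> \<open>The left ideal \<open>L + A v\<close>; it contains \<open>v\<close>, so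
      maximality of \<open>L\<close> forces it to be everything.\<close>
    define J where "J = {l \<oplus>\<^bsub>alg\<^esub> a \<otimes>\<^bsub>alg\<^esub> v | l a. l \<in> L \<and> a \<in> carrier alg}"
    have J: "Module.submodule J alg (regular_module alg)"
      unfolding left_ideal_iff
    proof (intro conjI ballI)
      show "J \<subseteq> carrier alg" unfolding J_def using L' v by auto
      have "\<zero>\<^bsub>alg\<^esub> = \<zero>\<^bsub>alg\<^esub> \<oplus>\<^bsub>alg\<^esub> \<zero>\<^bsub>alg\<^esub> \<otimes>\<^bsub>alg\<^esub> v" using v by simp
      then show "\<zero>\<^bsub>alg\<^esub> \<in> J" unfolding J_def using L' zero_closed by blast
    next
      fix x x' assume "x \<in> J" "x' \<in> J"
      then obtain l a l' a' where x: "x = l \<oplus>\<^bsub>alg\<^esub> a \<otimes>\<^bsub>alg\<^esub> v" "l \<in> L" "a \<in> carrier alg"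
        "x' = l' \<oplus>\<^bsub>alg\<^esub> a' \<otimes>\<^bsub>alg\<^esub> v" "l' \<in> L" "a' \<in> carrier alg" unfolding J_def by blast
      then have "l \<in> carrier alg" "l' \<in> carrier alg" using L' by auto
      with x v have "x \<oplus>\<^bsub>alg\<^esub> x' = (l \<oplus>\<^bsub>alg\<^esub> l') \<oplus>\<^bsub>alg\<^esub> (a \<oplus>\<^bsub>alg\<^esub> a') \<otimes>\<^bsub>alg\<^esub> v"
        by (simp add: l_distr a_ac)
      moreover have "l \<oplus>\<^bsub>alg\<^esub> l' \<in> L" "a \<oplus>\<^bsub>alg\<^esub> a' \<in> carrier alg" using x L' by auto
      ultimately show "x \<oplus>\<^bsub>alg\<^esub> x' \<in> J" unfolding J_def by blast
    next
      fix b x assume b: "b \<in> carrier alg" and "x \<in> J"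
      then obtain l a where x: "x = l \<oplus>\<^bsub>alg\<^esub> a \<otimes>\<^bsub>alg\<^esub> v" "l \<in> L" "a \<in> carrier alg"
        unfolding J_def by blast
      then have "l \<in> carrier alg" using L' by auto
      with x v b have "b \<otimes>\<^bsub>alg\<^esub> x = (b \<otimes>\<^bsub>alg\<^esub> l) \<oplus>\<^bsub>alg\<^esub> (b \<otimes>\<^bsub>alg\<^esub> a) \<otimes>\<^bsub>alg\<^esub> v"
        by (simp add: r_distr m_assoc)
      moreover have "b \<otimes>\<^bsub>alg\<^esub> l \<in> L" "b \<otimes>\<^bsub>alg\<^esub> a \<in> carrier alg" using x b L' by auto
      ultimately show "b \<otimes>\<^bsub>alg\<^esub> x \<in> J" unfolding J_def by blast
    qed
    have LJ: "L \<subseteq> J"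
    proof
      fix l assume l: "l \<in> L"
      then have "l = l \<oplus>\<^bsub>alg\<^esub> \<zero>\<^bsub>alg\<^esub> \<otimes>\<^bsub>alg\<^esub> v" using v L' by auto
      then show "l \<in> J" unfolding J_def using l zero_closed by blast
    qed
    have "v \<in> J"
    proof -
      have "v = \<zero>\<^bsub>alg\<^esub> \<oplus>\<^bsub>alg\<^esub> \<one>\<^bsub>alg\<^esub> \<otimes>\<^bsub>alg\<^esub> v" using v by simp
      then show ?thesis unfolding J_def using L' one_closed by blast
    qed
    then have "J \<noteq> L" using v(2) by blast
    then have "J = carrier alg" 
      using max[unfolded maximal_left_ideal_def, THEN conjunct2, THEN conjunct2, rule_format,
          OF conjI[OF J LJ]] by blast
    then obtain l a where la: "y = l \<oplus>\<^bsub>alg\<^esub> a \<otimes>\<^bsub>alg\<^esub> v" "l \<in> L" "a \<in> carrier alg" using y unfolding J_def by blast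
    then have l: "l \<in> carrier alg" using L' by auto
    obtain c where c: "a \<otimes>\<^bsub>alg\<^esub> v \<ominus>\<^bsub>alg\<^esub> (c \<odot>\<^bsub>alg\<^esub> v) \<in> L"
      using eigenvector_multiple[OF L v(1) eig la(3)] by blast
    let ?m = "a \<otimes>\<^bsub>alg\<^esub> v \<ominus>\<^bsub>alg\<^esub> (c \<odot>\<^bsub>alg\<^esub> v)"
    have m: "?m \<in> carrier alg" using la v by (simp add: scale_closed)
    have "y = (l \<oplus>\<^bsub>alg\<^esub> ?m) \<oplus>\<^bsub>alg\<^esub> c \<odot>\<^bsub>alg\<^esub> v"
      using la v l by (simp add: a_minus_def a_assoc l_neg scale_closed)
    then have "?d \<otimes>\<^bsub>alg\<^esub> y = ?d \<otimes>\<^bsub>alg\<^esub> (l \<oplus>\<^bsub>alg\<^esub> ?m) \<oplus>\<^bsub>alg\<^esub> (c \<odot>\<^bsub>alg\<^esub> \<one>\<^bsub>alg\<^esub>) \<otimes>\<^bsub>alg\<^esub> (?d \<otimes>\<^bsub>alg\<^esub> v)"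
      using d l m v by (simp add: r_distr scale_closed scale_mult_left scale_mult_right)
    moreover have "?d \<otimes>\<^bsub>alg\<^esub> (l \<oplus>\<^bsub>alg\<^esub> ?m) \<in> L" using L' c la d by blast
    moreover have "(c \<odot>\<^bsub>alg\<^esub> \<one>\<^bsub>alg\<^esub>) \<otimes>\<^bsub>alg\<^esub> (?d \<otimes>\<^bsub>alg\<^esub> v) \<in> L"
      using L' same_letters_annihilate_eigenvector[OF L v(1) eig u w set] scale_closed[OF one_closed]
      by blast
    ultimately show ?thesis using L' by simp
  qed
  then show ?thesis using d y by (simp add: jacobson_radical_def)
qed

end

section \<open>The kernels lie in the square of the radical\<close>

text \<open>A factor on the left is absorbed by the first radical factor of each product.\<close>

lemma (in ring) radical_square_left_ideal:
  "Module.submodule (radical_square R) R (regular_module R)"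
proof -
  note J = jacobson_radical_left_ideal[unfolded left_ideal_iff]
  have "\<zero> \<otimes> \<zero> \<in> radical_square R"
    unfolding radical_square_def using J by (intro ideal_prod.prod) auto
  moreover have "a \<otimes> x \<in> radical_square R" if a: "a \<in> carrier R" and "x \<in> radical_square R" for a x
    using that(2) unfolding radical_square_def
  proof induction
    case (prod i j)
    then have "a \<otimes> (i \<otimes> j) = (a \<otimes> i) \<otimes> j" using a jacobson_radical_closed by (simp add: m_assoc)
    then show ?case using prod a J ideal_prod.prod by metis
  next
    case (sum x y)
    then have "x \<in> carrier R" "y \<in> carrier R"
      using radical_square_subset jacobson_radical_closed by (auto simp: radical_square_def)
    then show ?case using sum a by (simp add: r_distr ideal_prod.sum)
  qed
  moreover have "radical_square R \<subseteq> carrier R"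
    using radical_square_subset jacobson_radical_closed by blast
  moreover have "x \<oplus> y \<in> radical_square R" if "x \<in> radical_square R" "y \<in> radical_square R" for x y
    using that unfolding radical_square_def by (rule ideal_prod.sum)
  ultimately show ?thesis unfolding left_ideal_iff by simp
qed

text \<open>Both mixed terms and \<open>z \<otimes> z\<close> equal \<open>z\<close>; they enter
  with two minus signs and one plus sign, which leaves a single \<open>z\<close> to
  subtract.\<close>

lemma (in ring) absorbing_product:
  assumes "x \<in> carrier R" "y \<in> carrier R" "z \<in> carrier R"
    and "x \<otimes> z = z" "z \<otimes> y = z" "z \<otimes> z = z"
  shows "(x \<ominus> z) \<otimes> (y \<ominus> z) = x \<otimes> y \<ominus> z"
  using assms
  by (simp add: a_minus_def l_distr r_distr l_minus r_minus a_assoc l_neg r_neg minus_add)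

text \<open>Since \<open>z\<close> has exactly the letters \<open>i\<close> and \<open>j\<close>,
  both \<open>i j - z\<close> and \<open>j i - z\<close> are radical, and their product is
  \<open>i j i - z\<close> because \<open>j\<close> is idempotent. The context is divided between
  the factors: \<open>a\<close> is multiplied to the first from the left and \<open>b\<close> to the
  second from the right.\<close>

lemma (in hecke_quotient) absorbing_radical_square:
  assumes ij: "i < n" "j < n" and z: "z \<in> lists {..<n}" "set z = {i, j}"
    and absorb: "word (i # z) = word z" "word (j # z) = word z"
      "word (z @ [i]) = word z" "word (z @ [j]) = word z"
    and a: "a \<in> lists {..<n}" and b: "b \<in> lists {..<n}"
  shows "word (a @ [i, j, i] @ b) \<ominus>\<^bsub>alg\<^esub> word (a @ z @ b) \<in> radical_square alg"
proof -
  note cl = word_closed[OF a] word_closed[OF b] word_closed[OF z(1)]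
  \<comment> \<open>Applied to \<open>z\<close> itself, this shows that \<open>z\<close> is
    idempotent.\<close>
  have zw: "word (u @ z) = word z" if "set u \<subseteq> {i, j}" for u
    using that
  proof (induction u)
    case (Cons k u)
    then have "u @ z \<in> lists {..<n}" "k < n" using z ij by auto
    then have "word ((k # u) @ z) = word [k] \<otimes>\<^bsub>alg\<^esub> word (u @ z)" by (simp add: word_Cons[of k "u @ z"])
    also have "\<dots> = word (k # z)" using Cons \<open>k < n\<close> z by (simp add: word_Cons[of k z])
    finally show ?case using Cons absorb by auto
  qed simp
  have "word (z @ [j, i]) = word (z @ [j]) \<otimes>\<^bsub>alg\<^esub> word [i]"
    using z ij word_append[of "z @ [j]" "[i]"] by simp
  also have "\<dots> = word (z @ [i])" using z ij absorb word_append[of z "[i]"] by simp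
  finally have zji: "word (z @ [j, i]) = word z" using absorb by simp
  let ?x = "word [i, j] \<ominus>\<^bsub>alg\<^esub> word z" and ?y = "word [j, i] \<ominus>\<^bsub>alg\<^esub> word z"
  have xy: "word [i, j] \<in> carrier alg" "word [j, i] \<in> carrier alg"
    using ij by (auto intro: word_closed)
  have "?x \<otimes>\<^bsub>alg\<^esub> ?y = word [i, j] \<otimes>\<^bsub>alg\<^esub> word [j, i] \<ominus>\<^bsub>alg\<^esub> word z"
    using ij z xy cl zw[of "[i, j]"] zw[of z] zji
    by (intro absorbing_product) (simp_all add: word_append)
  also have "word [i, j] \<otimes>\<^bsub>alg\<^esub> word [j, i] = word [i, j, i]"
  proof -
    have "word [i, j] \<otimes>\<^bsub>alg\<^esub> word [j, i]
        = word [i] \<otimes>\<^bsub>alg\<^esub> ((word [j] \<otimes>\<^bsub>alg\<^esub> word [j]) \<otimes>\<^bsub>alg\<^esub> word [i])"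
      using ij by (simp add: word_append)
    also have "\<dots> = word [i, j, i]" using ij hecke.gen_idem by (simp add: word_append)
    finally show ?thesis .
  qed
  finally have xy_eq: "?x \<otimes>\<^bsub>alg\<^esub> ?y = word [i, j, i] \<ominus>\<^bsub>alg\<^esub> word z" .
  have x: "word a \<otimes>\<^bsub>alg\<^esub> ?x \<in> jacobson_radical alg"
  proof -
    have "?x \<otimes>\<^bsub>alg\<^esub> \<one>\<^bsub>alg\<^esub> \<in> jacobson_radical alg"
      using ij z by (intro same_letters_mult_radical) auto
    then have "?x \<in> jacobson_radical alg" using xy cl by simp
    then show ?thesis using cl jacobson_radical_left_ideal[unfolded left_ideal_iff] by blast
  qed
  have y: "?y \<otimes>\<^bsub>alg\<^esub> word b \<in> jacobson_radical alg"
    using ij z cl by (intro same_letters_mult_radical) auto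
  have iji: "word [i, j, i] \<in> carrier alg" using ij by (auto intro: word_closed)
  have "word (a @ [i, j, i] @ b) \<ominus>\<^bsub>alg\<^esub> word (a @ z @ b)
      = word a \<otimes>\<^bsub>alg\<^esub> (word [i, j, i] \<otimes>\<^bsub>alg\<^esub> word b) \<ominus>\<^bsub>alg\<^esub> word a \<otimes>\<^bsub>alg\<^esub> (word z \<otimes>\<^bsub>alg\<^esub> word b)"
    using a b z ij by (simp add: word_append)
  also have "\<dots> = word a \<otimes>\<^bsub>alg\<^esub> ((word [i, j, i] \<ominus>\<^bsub>alg\<^esub> word z) \<otimes>\<^bsub>alg\<^esub> word b)"
    using cl iji by (simp add: a_minus_def l_distr r_distr l_minus r_minus)
  also have "\<dots> = (word a \<otimes>\<^bsub>alg\<^esub> ?x) \<otimes>\<^bsub>alg\<^esub> (?y \<otimes>\<^bsub>alg\<^esub> word b)"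
    unfolding xy_eq[symmetric] using cl xy by (simp add: m_assoc)
  finally show ?thesis using ideal_prod.prod[OF x y, of alg] by (simp add: radical_square_def)
qed

section \<open>Congruence of words modulo the square of the radical\<close>

context presentation
begin

text \<open>The contexts \<open>a\<close> and \<open>b\<close> are built in so that the relation is
  visibly compatible with concatenation on both sides, although \<open>radical_square\<close> is
  known here only as a left ideal.\<close>

definition rad_cong :: "(nat list \<times> nat list) set" where
  "rad_cong = {(u, v). u \<in> lists {..<n} \<and> v \<in> lists {..<n} \<and>
    (\<forall>a\<in>lists {..<n}. \<forall>b\<in>lists {..<n}.
      word (a @ u @ b) \<ominus>\<^bsub>alg\<^esub> word (a @ v @ b) \<in> radical_square alg)}"

lemma rad_cong_pres_cong: "(u, v) \<in> pres_cong n R \<Longrightarrow> (u, v) \<in> rad_cong"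
  using pres_cong_words[of u v] word_eqI[OF pres_cong_context, of u v]
    radical_square_left_ideal[unfolded left_ideal_iff]
  by (auto simp: rad_cong_def word_closed a_minus_def r_neg)

lemma rad_cong_sym: "(u, v) \<in> rad_cong \<Longrightarrow> (v, u) \<in> rad_cong"
proof -
  assume uv: "(u, v) \<in> rad_cong"
  have "word (a @ v @ b) \<ominus>\<^bsub>alg\<^esub> word (a @ u @ b) \<in> radical_square alg"
    if ab: "a \<in> lists {..<n}" "b \<in> lists {..<n}" for a b
  proof -
    have "\<zero>\<^bsub>alg\<^esub> \<ominus>\<^bsub>alg\<^esub> (word (a @ u @ b) \<ominus>\<^bsub>alg\<^esub> word (a @ v @ b)) \<in> radical_square alg"
      using uv ab radical_square_left_ideal[unfolded left_ideal_iff]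
      by (rule_tac left_ideal_minus_closed[OF radical_square_left_ideal]) (auto simp: rad_cong_def)
    moreover have "\<zero>\<^bsub>alg\<^esub> \<ominus>\<^bsub>alg\<^esub> (x \<ominus>\<^bsub>alg\<^esub> y) = y \<ominus>\<^bsub>alg\<^esub> x"
      if "x \<in> carrier alg" "y \<in> carrier alg" for x y
      using that by (simp add: a_minus_def minus_add a_comm)
    ultimately show ?thesis using uv ab by (simp add: rad_cong_def word_closed)
  qed
  then show ?thesis using uv by (auto simp: rad_cong_def)
qed

lemma rad_cong_trans: "\<lbrakk>(u, v) \<in> rad_cong; (v, w) \<in> rad_cong\<rbrakk> \<Longrightarrow> (u, w) \<in> rad_cong"
proof -
  assume uv: "(u, v) \<in> rad_cong" and vw: "(v, w) \<in> rad_cong"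
  have "word (a @ u @ b) \<ominus>\<^bsub>alg\<^esub> word (a @ w @ b) \<in> radical_square alg"
    if ab: "a \<in> lists {..<n}" "b \<in> lists {..<n}" for a b
  proof -
    have "(word (a @ u @ b) \<ominus>\<^bsub>alg\<^esub> word (a @ v @ b)) \<oplus>\<^bsub>alg\<^esub> (word (a @ v @ b) \<ominus>\<^bsub>alg\<^esub> word (a @ w @ b))
        \<in> radical_square alg"
      using uv vw ab radical_square_left_ideal[unfolded left_ideal_iff] by (auto simp: rad_cong_def)
    moreover have "(x \<ominus>\<^bsub>alg\<^esub> y) \<oplus>\<^bsub>alg\<^esub> (y \<ominus>\<^bsub>alg\<^esub> z) = x \<ominus>\<^bsub>alg\<^esub> z"
      if "x \<in> carrier alg" "y \<in> carrier alg" "z \<in> carrier alg" for x y z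
      using that by (simp add: a_minus_def a_assoc r_neg1)
    ultimately show ?thesis using uv vw ab by (simp add: rad_cong_def word_closed)
  qed
  then show ?thesis using uv vw by (auto simp: rad_cong_def)
qed

text \<open>\<open>pres_cong n S\<close> is the least congruence containing \<open>S\<close> and
  \<open>rad_cong\<close> is a congruence, so checking the defining relations of the quotient is
  enough.\<close>

lemma pres_cong_subset_rad_cong:
  assumes S: "S \<subseteq> rad_cong" and uv: "(u, v) \<in> pres_cong n S"
  shows "(u, v) \<in> rad_cong"
  using uv
proof (induction rule: pres_cong.induct)
  case (rel u v a b)
  then have uv: "(u, v) \<in> rad_cong" using S by blast
  have "word (c @ (a @ u @ b) @ d) \<ominus>\<^bsub>alg\<^esub> word (c @ (a @ v @ b) @ d) \<in> radical_square alg"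
    if "c \<in> lists {..<n}" "d \<in> lists {..<n}" for c d
  proof -
    have "c @ a \<in> lists {..<n}" "b @ d \<in> lists {..<n}" using rel that by auto
    then have "word ((c @ a) @ u @ (b @ d)) \<ominus>\<^bsub>alg\<^esub> word ((c @ a) @ v @ (b @ d)) \<in> radical_square alg"
      using uv unfolding rad_cong_def by blast
    then show ?thesis by simp
  qed
  then show ?case using uv rel by (simp add: rad_cong_def)
next
  case (refl w)
  then show ?case by (intro rad_cong_pres_cong pres_cong.refl)
qed (auto intro: rad_cong_sym rad_cong_trans)

end

section \<open>The morphism between two presented algebras and its kernel\<close>

locale presentation_quotient = A: presentation n R + B: presentation n S
  for n :: nat and R S :: "(nat list \<times> nat list) set" +
  assumes rels_cong: "R \<subseteq> pres_cong n S"
begin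

lemma pres_cong_mono: "(u, v) \<in> pres_cong n R \<Longrightarrow> (u, v) \<in> pres_cong n S"
proof (induction rule: pres_cong.induct)
  case (rel u v a b)
  then show ?case using rels_cong by (intro B.pres_cong_context) auto
qed (auto intro!: pres_cong.refl intro: pres_cong.sym pres_cong.trans)

text \<open>In general the union of the \<open>S\<close>-classes that meet \<open>X\<close>. Applied
  to an \<open>R\<close>-class this is a single \<open>S\<close>-class, so no representative has to
  be chosen.\<close>

definition proj :: "nat list set \<Rightarrow> nat list set" where
  "proj X = pres_cong n S `` X"

lemma proj_cong_class:
  assumes "w \<in> lists {..<n}"
  shows "proj (A.cong_class w) = B.cong_class w"
  unfolding proj_def
  using pres_cong_mono pres_cong.refl[OF assms, of R] by (auto intro: pres_cong.trans)

lemma proj_hom: "proj \<in> hom (pres_monoid n R) (pres_monoid n S)"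
  and proj_one: "proj \<one>\<^bsub>pres_monoid n R\<^esub> = \<one>\<^bsub>pres_monoid n S\<^esub>"
proof -
  show "proj \<in> hom (pres_monoid n R) (pres_monoid n S)"
  proof (rule homI)
    fix x assume "x \<in> carrier (pres_monoid n R)"
    then obtain u where u: "u \<in> lists {..<n}" "x = A.cong_class u"
      by (auto simp: A.carrier_pres_monoid)
    then show "proj x \<in> carrier (pres_monoid n S)"
      by (simp only: proj_cong_class B.carrier_pres_monoid) (rule imageI)
    fix y assume "y \<in> carrier (pres_monoid n R)"
    then obtain v where v: "v \<in> lists {..<n}" "y = A.cong_class v"
      by (auto simp: A.carrier_pres_monoid)
    have "u @ v \<in> lists {..<n}" using u v by simp
    then show "proj (x \<otimes>\<^bsub>pres_monoid n R\<^esub> y) = proj x \<otimes>\<^bsub>pres_monoid n S\<^esub> proj y"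
      using u v by (simp add: proj_cong_class A.pres_monoid_mult B.pres_monoid_mult)
  qed
  show "proj \<one>\<^bsub>pres_monoid n R\<^esub> = \<one>\<^bsub>pres_monoid n S\<^esub>"
    using proj_cong_class[of "[]"] by (simp add: pres_monoid_def)
qed

lemma generator_morphism_proj: "generator_morphism n R S (monoid_algebra_map proj)"
  unfolding generator_morphism_def
  using monoid_algebra_map_alg_hom[OF A.monoid_pres_monoid B.monoid_pres_monoid proj_hom proj_one]
  by (auto simp: monoid_algebra_map_basis pres_gen_def proj_cong_class)

definition rep :: "nat list set \<Rightarrow> nat list" where
  "rep X = (SOME w. w \<in> lists {..<n} \<and> B.cong_class w = X)"

text \<open>A linear section of the morphism: each basis element goes to a chosen preimage.\<close>

definition lift :: "(nat list set \<Rightarrow> complex) \<Rightarrow> nat list set \<Rightarrow> complex" where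
  "lift g = (\<lambda>x. if x \<in> carrier (pres_monoid n R) \<and> A.cong_class (rep (proj x)) = x
    then g (proj x) else 0)"

lemma rep:
  assumes "w \<in> lists {..<n}"
  shows "rep (B.cong_class w) \<in> lists {..<n}" "(w, rep (B.cong_class w)) \<in> pres_cong n S"
proof -
  have *: "rep (B.cong_class w) \<in> lists {..<n} \<and> B.cong_class (rep (B.cong_class w)) = B.cong_class w"
    unfolding rep_def by (rule someI) (use assms in auto)
  then show "rep (B.cong_class w) \<in> lists {..<n}" by blast
  then show "(w, rep (B.cong_class w)) \<in> pres_cong n S"
    using * B.cong_class_eq_iff[OF assms] by blast
qed

text \<open>In the fibre of \<open>proj\<close> over a class, only the class of the chosen
  representative passes the test in \<open>lift\<close>.\<close>

lemma lift_word:
  assumes w: "w \<in> lists {..<n}"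
  shows "lift (B.word w) = A.word (rep (B.cong_class w))"
proof
  fix x
  let ?r = "rep (B.cong_class w)"
  have r: "?r \<in> lists {..<n}" "B.cong_class ?r = B.cong_class w"
    using rep[OF w] B.cong_class_eq_iff[OF w, of ?r] by auto
  have "proj (A.cong_class ?r) = B.cong_class w" using r proj_cong_class by simp
  moreover have "A.cong_class ?r \<in> carrier (pres_monoid n R)"
    unfolding A.carrier_pres_monoid using r by (rule_tac imageI)
  ultimately show "lift (B.word w) x = A.word ?r x"
    by (auto simp: lift_def A.word_def B.word_def monoid_basis_def)
qed

context
  fixes \<phi> assumes \<phi>: "generator_morphism n R S \<phi>"
begin

lemma morphism_ring_hom: "\<phi> \<in> Ring.ring_hom A.alg B.alg"
  and morphism_scale: "f \<in> carrier A.alg \<Longrightarrow> \<phi> (c \<odot>\<^bsub>A.alg\<^esub> f) = c \<odot>\<^bsub>B.alg\<^esub> \<phi> f"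
  using \<phi> by (auto simp: generator_morphism_def alg_hom_def)

lemma morphism_word: "w \<in> lists {..<n} \<Longrightarrow> \<phi> (A.word w) = B.word w"
proof (induction w)
  case Nil
  then show ?case using ring_hom_one[OF morphism_ring_hom] by (simp add: A.word_Nil B.word_Nil)
next
  case (Cons i w)
  then have i: "i < n" and w: "w \<in> lists {..<n}" by auto
  have "\<phi> (A.word [i]) = B.word [i]"
    using \<phi> i by (simp add: generator_morphism_def A.word_singleton B.word_singleton)
  then show ?case
    using i w Cons ring_hom_mult[OF morphism_ring_hom A.word_closed A.word_closed, of "[i]" w]
    by (simp add: A.word_Cons[OF i w] B.word_Cons[OF i w])
qed

lemma morphism_surj: "\<phi> ` carrier A.alg = carrier B.alg"
proof
  show "\<phi> ` carrier A.alg \<subseteq> carrier B.alg" using ring_hom_closed[OF morphism_ring_hom] by blast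
  show "carrier B.alg \<subseteq> \<phi> ` carrier A.alg"
  proof
    fix f assume "f \<in> carrier B.alg"
    then show "f \<in> \<phi> ` carrier A.alg"
    proof (induction rule: B.alg_induct)
      case (word w)
      then show ?case using morphism_word A.word_closed by (metis image_eqI)
    next
      case (scale c f)
      then obtain g where "g \<in> carrier A.alg" "f = \<phi> g" by blast
      then show ?case using morphism_scale[of g c] A.scale_closed[of g c] by (metis image_eqI)
    next
      case (add f g)
      then obtain f' g' where "f' \<in> carrier A.alg" "f = \<phi> f'" "g' \<in> carrier A.alg" "g = \<phi> g'" by blast
      then show ?case using ring_hom_add[OF morphism_ring_hom, of f' g'] A.add.m_closed[of f' g']
        by (metis image_eqI)
    qed
  qed
qed

text \<open>For every \<open>f\<close> the difference of \<open>f\<close> and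
  \<open>lift (\<phi> f)\<close> lies in the square of the radical: on a word it compares the word
  with the representative of its \<open>S\<close>-class, and it is linear in \<open>f\<close>. On
  the kernel \<open>lift (\<phi> f)\<close> vanishes.\<close>

lemma kernel_subset_radical_square:
  assumes S: "S \<subseteq> A.rad_cong"
  shows "a_kernel A.alg B.alg \<phi> \<subseteq> radical_square A.alg"
proof
  note I = A.radical_square_left_ideal[unfolded A.left_ideal_iff]
  fix f assume f: "f \<in> a_kernel A.alg B.alg \<phi>"
  have "lift (\<phi> f) \<in> carrier A.alg \<and> f \<ominus>\<^bsub>A.alg\<^esub> lift (\<phi> f) \<in> radical_square A.alg"
    if "f \<in> carrier A.alg" for f
    using that
  proof (induction rule: A.alg_induct)
    case (word w)
    let ?r = "rep (B.cong_class w)"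
    have "(w, ?r) \<in> A.rad_cong" using A.pres_cong_subset_rad_cong[OF S] rep[OF word] by blast
    then have "A.word ([] @ w @ []) \<ominus>\<^bsub>A.alg\<^esub> A.word ([] @ ?r @ []) \<in> radical_square A.alg"
      unfolding A.rad_cong_def by blast
    then show ?case using word rep[OF word] by (simp add: morphism_word lift_word A.word_closed)
  next
    case (scale c f)
    \<comment> \<open>\<open>lift\<close> is defined by a pointwise case distinction that does not
      involve the values of its argument, hence it is linear.\<close>
    have e: "lift (\<phi> (c \<odot>\<^bsub>A.alg\<^esub> f)) = c \<odot>\<^bsub>A.alg\<^esub> lift (\<phi> f)"
      using scale(1) by (simp add: morphism_scale) (auto simp: lift_def monoid_algebra_sel)
    have "(c \<odot>\<^bsub>A.alg\<^esub> \<one>\<^bsub>A.alg\<^esub>) \<otimes>\<^bsub>A.alg\<^esub> (f \<ominus>\<^bsub>A.alg\<^esub> lift (\<phi> f)) \<in> radical_square A.alg"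
      using scale I A.scale_closed[OF A.one_closed] by blast
    then show ?case
      using scale unfolding e
      by (simp add: A.scale_closed a_minus_def A.r_distr A.r_minus A.scale_mult_left)
  next
    case (add f g)
    have e: "lift (\<phi> (f \<oplus>\<^bsub>A.alg\<^esub> g)) = lift (\<phi> f) \<oplus>\<^bsub>A.alg\<^esub> lift (\<phi> g)"
      using add(1,2) by (simp add: ring_hom_add[OF morphism_ring_hom]) (auto simp: lift_def monoid_algebra_sel)
    have "(f \<ominus>\<^bsub>A.alg\<^esub> lift (\<phi> f)) \<oplus>\<^bsub>A.alg\<^esub> (g \<ominus>\<^bsub>A.alg\<^esub> lift (\<phi> g)) \<in> radical_square A.alg"
      using add I by blast
    then show ?case
      using add unfolding e by (simp add: a_minus_def A.minus_add A.a_ac)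
  qed
  moreover have "f \<in> carrier A.alg" "\<phi> f = \<zero>\<^bsub>B.alg\<^esub>"
    using f by (auto simp: a_kernel_def kernel_def)
  moreover have "lift \<zero>\<^bsub>B.alg\<^esub> = \<zero>\<^bsub>A.alg\<^esub>" by (auto simp: lift_def monoid_algebra_sel)
  ultimately have "f \<ominus>\<^bsub>A.alg\<^esub> \<zero>\<^bsub>A.alg\<^esub> \<in> radical_square A.alg" "f \<in> carrier A.alg" by metis+
  then show "f \<in> radical_square A.alg" by (simp add: a_minus_def)
qed

end

end

section \<open>The two quotient steps, from \<open>H0_B\<close> to \<open>R0\<close> and from
  \<open>R0\<close> to \<open>H0_A\<close>\<close>

lemma hecke_quotient_H0_B: "hecke_quotient n (H0_B_rels n)"
proof -
  interpret presentation n "H0_B_rels n" by unfold_locales (rule H0_B_rels_words)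
  show ?thesis
    by unfold_locales (use pres_cong.rel[of _ _ "H0_B_rels n" "[]" n "[]"] in auto)
qed

lemma H0_B_rels_subset_R0: "H0_B_rels n \<subseteq> pres_cong n (R0_rels n)"
proof
  fix r assume r: "r \<in> H0_B_rels n"
  have rel: "q \<in> pres_cong n (R0_rels n)" if "q \<in> R0_rels n" for q
    using that pres_cong.rel[of "fst q" "snd q" "R0_rels n" "[]" n "[]"] by simp
  show "r \<in> pres_cong n (R0_rels n)"
  proof (cases "r \<in> common_rels n")
    case True
    then show ?thesis by (intro rel) (simp add: R0_rels_def)
  next
    case False
    then have n: "2 \<le> n" and r': "r = ([0,1,0,1], [1,0,1,0])"
      using r by (auto simp: H0_B_rels_def split: if_splits)
    have "([1,0,1,0], [0,1,0]) \<in> pres_cong n (R0_rels n)" "([0,1,0], [0,1,0,1]) \<in> pres_cong n (R0_rels n)"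
      by (rule rel, simp add: R0_rels_def n)+
    then show ?thesis unfolding r' by (blast intro: pres_cong.sym pres_cong.trans)
  qed
qed

lemma hecke_quotient_R0: "hecke_quotient n (R0_rels n)"
  by (intro hecke_quotient.intro presentation.intro hecke_quotient_axioms.intro
      R0_rels_words H0_B_rels_subset_R0)

text \<open>With the type A braid relation and idempotence, \<open>[1,0,1,0]\<close> and
  \<open>[0,1,0,1]\<close> both collapse to \<open>[1,0,1]\<close>, hence to
  \<open>[0,1,0]\<close>.\<close>

lemma R0_rels_subset_H0_A: "R0_rels n \<subseteq> pres_cong n (H0_A_rels n)"
proof
  fix r assume r: "r \<in> R0_rels n"
  have rel: "(a @ u @ b, a @ v @ b) \<in> pres_cong n (H0_A_rels n)"
    if "(u, v) \<in> H0_A_rels n" "a \<in> lists {..<n}" "b \<in> lists {..<n}" for u v a b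
    using that by (rule pres_cong.rel)
  show "r \<in> pres_cong n (H0_A_rels n)"
  proof (cases "r \<in> common_rels n")
    case True
    then show ?thesis using rel[of "fst r" "snd r" "[]" "[]"] by (simp add: H0_A_rels_def)
  next
    case False
    then have n: "2 \<le> n" and r': "r = ([1,0,1,0], [0,1,0]) \<or> r = ([0,1,0], [0,1,0,1])"
      using r by (auto simp: R0_rels_def split: if_splits)
    have braid: "([0,1,0], [1,0,1]) \<in> H0_A_rels n" using n by (simp add: H0_A_rels_def)
    have idem: "([1,1], [1]) \<in> H0_A_rels n"
      using n by (auto simp: H0_A_rels_def common_rels_def)
    have 1: "([0,1,0], [1,0,1]) \<in> pres_cong n (H0_A_rels n)"
      using rel[OF braid, of "[]" "[]"] by simp
    have 2: "([1,0,1,0], [1,1,0,1]) \<in> pres_cong n (H0_A_rels n)"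
      using rel[OF braid, of "[1]" "[]"] n by simp
    have 3: "([1,1,0,1], [1,0,1]) \<in> pres_cong n (H0_A_rels n)"
      using rel[OF idem, of "[]" "[0,1]"] n by simp
    have 4: "([0,1,0,1], [1,0,1,1]) \<in> pres_cong n (H0_A_rels n)"
      using rel[OF braid, of "[]" "[1]"] n by simp
    have 5: "([1,0,1,1], [1,0,1]) \<in> pres_cong n (H0_A_rels n)"
      using rel[OF idem, of "[1,0]" "[]"] n by simp
    show ?thesis
      using r' pres_cong.trans[OF pres_cong.trans[OF 2 3] pres_cong.sym[OF 1]]
        pres_cong.trans[OF 1 pres_cong.sym[OF pres_cong.trans[OF 4 5]]] by blast
  qed
qed

text \<open>The absorbing word is \<open>[0,1,0,1]\<close>, the longest element of the rank two
  part, with \<open>i = 0\<close> and \<open>j = 1\<close>. This settles \<open>[0,1,0]\<close>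
  against \<open>[0,1,0,1]\<close>; the other relation follows because \<open>[0,1,0,1]\<close> and
  \<open>[1,0,1,0]\<close> already agree in \<open>H0_B\<close>.\<close>

lemma R0_rels_rad_cong: "R0_rels n \<subseteq> presentation.rad_cong n (H0_B_rels n)"
proof
  interpret hecke_quotient n "H0_B_rels n" by (rule hecke_quotient_H0_B)
  fix r assume r: "r \<in> R0_rels n"
  have rel: "(a @ u @ b, a @ v @ b) \<in> pres_cong n (H0_B_rels n)"
    if "(u, v) \<in> H0_B_rels n" "a \<in> lists {..<n}" "b \<in> lists {..<n}" for u v a b
    using that by (rule pres_cong.rel)
  show "r \<in> rad_cong"
  proof (cases "r \<in> common_rels n")
    case True
    then have "r \<in> H0_B_rels n" by (simp add: H0_B_rels_def)
    then show ?thesis using rel[of "fst r" "snd r" "[]" "[]"]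
      by (cases r) (auto intro: rad_cong_pres_cong)
  next
    case False
    then have n: "2 \<le> n" and r': "r = ([1,0,1,0], [0,1,0]) \<or> r = ([0,1,0], [0,1,0,1])"
      using r by (auto simp: R0_rels_def split: if_splits)
    have braid: "([0,1,0,1], [1,0,1,0]) \<in> H0_B_rels n" using n by (simp add: H0_B_rels_def)
    have idem: "([i,i], [i]) \<in> H0_B_rels n" if "i < 2" for i
      using n that by (auto simp: H0_B_rels_def common_rels_def)
    have z: "([0,1,0,1], [1,0,1,0]) \<in> pres_cong n (H0_B_rels n)"
      using rel[OF braid, of "[]" "[]"] by simp
    \<comment> \<open>Facts 1 to 4: the word absorbs both generators on both sides, directly by
      idempotence where equal letters meet, and after rewriting to \<open>[1,0,1,0]\<close>
      otherwise.\<close>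
    have 1: "([0,0,1,0,1], [0,1,0,1]) \<in> pres_cong n (H0_B_rels n)"
      using rel[OF idem[of 0], of "[]" "[1,0,1]"] n by simp
    have 2: "([0,1,0,1,1], [0,1,0,1]) \<in> pres_cong n (H0_B_rels n)"
      using rel[OF idem[of 1], of "[0,1,0]" "[]"] n by simp
    have "([1,0,1,0,1], [1,1,0,1,0]) \<in> pres_cong n (H0_B_rels n)"
      "([1,1,0,1,0], [1,0,1,0]) \<in> pres_cong n (H0_B_rels n)"
      using rel[OF braid, of "[1]" "[]"] rel[OF idem[of 1], of "[]" "[0,1,0]"] n by simp_all
    then have 3: "([1,0,1,0,1], [0,1,0,1]) \<in> pres_cong n (H0_B_rels n)"
      by (rule pres_cong.trans[OF pres_cong.trans pres_cong.sym[OF z]])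
    have "([0,1,0,1,0], [1,0,1,0,0]) \<in> pres_cong n (H0_B_rels n)"
      "([1,0,1,0,0], [1,0,1,0]) \<in> pres_cong n (H0_B_rels n)"
      using rel[OF braid, of "[]" "[0]"] rel[OF idem[of 0], of "[1,0,1]" "[]"] n by simp_all
    then have 4: "([0,1,0,1,0], [0,1,0,1]) \<in> pres_cong n (H0_B_rels n)"
      by (rule pres_cong.trans[OF pres_cong.trans pres_cong.sym[OF z]])
    have "word (a @ [0,1,0] @ b) \<ominus>\<^bsub>alg\<^esub> word (a @ [0,1,0,1] @ b) \<in> radical_square alg"
      if "a \<in> lists {..<n}" "b \<in> lists {..<n}" for a b
      using n that word_eqI[OF 1] word_eqI[OF 2] word_eqI[OF 3] word_eqI[OF 4]
      by (intro absorbing_radical_square) auto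
    then have "([0,1,0], [0,1,0,1]) \<in> rad_cong" using n by (simp add: rad_cong_def)
    then show ?thesis using r' z by (blast intro: rad_cong_sym rad_cong_trans rad_cong_pres_cong)
  qed
qed

text \<open>The roles are exchanged: \<open>i = 1\<close> and \<open>j = 0\<close>, with
  \<open>[0,1,0]\<close> as the absorbing word, which the relations of \<open>R0\<close> make a zero
  of the rank two part.\<close>

lemma H0_A_rels_rad_cong: "H0_A_rels n \<subseteq> presentation.rad_cong n (R0_rels n)"
proof
  interpret hecke_quotient n "R0_rels n" by (rule hecke_quotient_R0)
  fix r assume r: "r \<in> H0_A_rels n"
  have rel: "(a @ u @ b, a @ v @ b) \<in> pres_cong n (R0_rels n)"
    if "(u, v) \<in> R0_rels n" "a \<in> lists {..<n}" "b \<in> lists {..<n}" for u v a b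
    using that by (rule pres_cong.rel)
  show "r \<in> rad_cong"
  proof (cases "r \<in> common_rels n")
    case True
    then have "r \<in> R0_rels n" by (simp add: R0_rels_def)
    then show ?thesis using rel[of "fst r" "snd r" "[]" "[]"]
      by (cases r) (auto intro: rad_cong_pres_cong)
  next
    case False
    then have n: "2 \<le> n" and r': "r = ([0,1,0], [1,0,1])"
      using r by (auto simp: H0_A_rels_def split: if_splits)
    have idem: "([0,0], [0]) \<in> R0_rels n"
      using n by (auto simp: R0_rels_def common_rels_def)
    have 1: "([0,0,1,0], [0,1,0]) \<in> pres_cong n (R0_rels n)"
      using rel[OF idem, of "[]" "[1,0]"] n by simp
    have 2: "([0,1,0,0], [0,1,0]) \<in> pres_cong n (R0_rels n)"
      using rel[OF idem, of "[0,1]" "[]"] n by simp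
    have 3: "([1,0,1,0], [0,1,0]) \<in> pres_cong n (R0_rels n)"
      using rel[of "[1,0,1,0]" "[0,1,0]" "[]" "[]"] n by (simp add: R0_rels_def)
    have 4: "([0,1,0], [0,1,0,1]) \<in> pres_cong n (R0_rels n)"
      using rel[of "[0,1,0]" "[0,1,0,1]" "[]" "[]"] n by (simp add: R0_rels_def)
    have "word (a @ [1,0,1] @ b) \<ominus>\<^bsub>alg\<^esub> word (a @ [0,1,0] @ b) \<in> radical_square alg"
      if "a \<in> lists {..<n}" "b \<in> lists {..<n}" for a b
      using n that word_eqI[OF 1] word_eqI[OF 2] word_eqI[OF 3] word_eqI[OF 4]
      by (intro absorbing_radical_square) auto
    then have "([1,0,1], [0,1,0]) \<in> rad_cong" using n by (simp add: rad_cong_def)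
    then show ?thesis unfolding r' by (rule rad_cong_sym)
  qed
qed

lemma presentation_quotient_H0_B_R0: "presentation_quotient n (H0_B_rels n) (R0_rels n)"
  by (intro presentation_quotient.intro presentation.intro presentation_quotient_axioms.intro
      H0_B_rels_words R0_rels_words H0_B_rels_subset_R0)

lemma presentation_quotient_R0_H0_A: "presentation_quotient n (R0_rels n) (H0_A_rels n)"
  by (intro presentation_quotient.intro presentation.intro presentation_quotient_axioms.intro
      R0_rels_words H0_A_rels_words R0_rels_subset_H0_A)

section \<open>Quotients of vector spaces\<close>

lemma linear_mapI:
  assumes "vectorspace K V" "vectorspace K W" "T \<in> LinearCombinations.module_hom K V W"
  shows "linear_map K V W T"
  using assms
  by (intro linear_map.intro mod_hom.intro mod_hom_axioms.intro) (auto simp: vectorspace_def)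

text \<open>Without finite generating sets, both dimensions are the same \<open>LEAST\<close> of an empty set.\<close>

lemma linear_bij_dim_eq:
  assumes V: "vectorspace K V" and W: "vectorspace K W"
    and T: "T \<in> LinearCombinations.module_hom K V W" and bij: "bij_betw T (carrier V) (carrier W)"
  shows "vectorspace.dim K V = vectorspace.dim K W"
proof -
  interpret T: linear_map K V W T using V W T by (rule linear_mapI)
  let ?S = "inv_into (carrier V) T"
  have S_closed: "?S y \<in> carrier V" if "y \<in> carrier W" for y
    using that bij by (metis bij_betw_imp_surj_on inv_into_into)
  have TS: "T (?S y) = y" if "y \<in> carrier W" for y
    using that bij by (metis bij_betw_imp_surj_on f_inv_into_f)
  have ST: "?S (T x) = x" if "x \<in> carrier V" for x
    using that bij by (metis bij_betw_imp_inj_on inv_into_f_f)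
  have "?S \<in> LinearCombinations.module_hom K W V"
    unfolding LinearCombinations.module_hom_def
  proof (intro CollectI conjI allI impI funcsetI)
    fix x y assume xy: "x \<in> carrier W \<and> y \<in> carrier W"
    then have "T (?S x \<oplus>\<^bsub>V\<^esub> ?S y) = x \<oplus>\<^bsub>W\<^esub> y" using S_closed TS by simp
    then show "?S (x \<oplus>\<^bsub>W\<^esub> y) = ?S x \<oplus>\<^bsub>V\<^esub> ?S y"
      using xy S_closed ST[of "?S x \<oplus>\<^bsub>V\<^esub> ?S y"] by simp
  next
    fix c x assume cx: "c \<in> carrier K \<and> x \<in> carrier W"
    then have "T (c \<odot>\<^bsub>V\<^esub> ?S x) = c \<odot>\<^bsub>W\<^esub> x" using S_closed TS by simp
    then show "?S (c \<odot>\<^bsub>W\<^esub> x) = c \<odot>\<^bsub>V\<^esub> ?S x"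
      using cx S_closed ST[of "c \<odot>\<^bsub>V\<^esub> ?S x"] by simp
  qed (rule S_closed)
  then interpret S: linear_map K W V ?S using V W by (intro linear_mapI)
  have S_surj: "?S ` carrier W = carrier V"
    using bij bij_betw_inv_into bij_betw_imp_surj_on by metis
  have inj: "inj_on T (carrier V)" and surj: "T ` carrier V = carrier W"
    using bij by (auto simp: bij_betw_def)
  show ?thesis
  proof (cases "T.V.fin_dim")
    case True
    then show ?thesis using inj surj by (rule T.dim_eq)
  next
    case False
    \<comment> \<open>Finite dimension of \<open>W\<close> would pass back to \<open>V\<close> along
      the inverse map \<open>?S\<close>.\<close>
    then have "\<not> T.W.fin_dim" using S.surj_fin_dim[OF _ S_surj] by blast
    then have "(\<lambda>n. \<exists>A. finite A \<and> card A = n \<and> A \<subseteq> carrier V \<and> LinearCombinations.module.span K V A = carrier V)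
        = (\<lambda>n. \<exists>A. finite A \<and> card A = n \<and> A \<subseteq> carrier W \<and> LinearCombinations.module.span K W A = carrier W)"
      using False unfolding T.V.fin_dim_def T.W.fin_dim_def by (intro ext) blast
    then show ?thesis unfolding T.V.dim_def T.W.dim_def by (rule arg_cong)
  qed
qed

locale complex_quotient_space = vectorspace "class_ring :: complex ring" V
  for V :: "(complex, 'v, 'e) module_scheme" (structure) +
  fixes W :: "'v set"
  assumes W: "W \<subseteq> carrier V" "\<zero> \<in> W" "\<And>x y. \<lbrakk>x \<in> W; y \<in> W\<rbrakk> \<Longrightarrow> x \<oplus> y \<in> W"
    "\<And>c x. x \<in> W \<Longrightarrow> c \<odot> x \<in> W"
begin

lemma W_subgroup: "subgroup W (add_monoid V)"
proof (rule subgroup.intro)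
  fix x assume x: "x \<in> W"
  then have "(- 1) \<odot> x = \<ominus> x" using smult_minus_1[of x] W(1) by (auto simp: class_ring_simps)
  then show "inv\<^bsub>add_monoid V\<^esub> x \<in> W" using W(4)[OF x, of "- 1"] by (simp add: a_inv_def)
qed (use W in auto)

lemma abelian_subgroup_W: "abelian_subgroup W V"
  by (rule abelian_subgroupI3) (simp_all add: additive_subgroup_def W_subgroup abelian_group_axioms)

lemma carrier_quotient_space: "carrier (quotient_space V W) = (\<lambda>x. W +> x) ` carrier V"
  by (auto simp: quotient_space_def A_RCOSETS_def')

lemma quotient_space_sel:
  "\<zero>\<^bsub>quotient_space V W\<^esub> = W +> \<zero>"
  "\<lbrakk>x \<in> carrier V; y \<in> carrier V\<rbrakk>
    \<Longrightarrow> (W +> x) \<oplus>\<^bsub>quotient_space V W\<^esub> (W +> y) = W +> (x \<oplus> y)"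
  "x \<in> carrier V \<Longrightarrow> c \<odot>\<^bsub>quotient_space V W\<^esub> (W +> x) = W +> (c \<odot> x)"
proof -
  show "\<zero>\<^bsub>quotient_space V W\<^esub> = W +> \<zero>"
    using W by (simp add: quotient_space_def)
  show "(W +> x) \<oplus>\<^bsub>quotient_space V W\<^esub> (W +> y) = W +> (x \<oplus> y)"
    if "x \<in> carrier V" "y \<in> carrier V"
    using abelian_subgroup.a_rcos_sum[OF abelian_subgroup_W that] by (simp add: quotient_space_def)
  assume x: "x \<in> carrier V"
  \<comment> \<open>All representatives of the coset give the same scaled coset, so the union in the
    scalar multiplication of \<open>quotient_space\<close> collapses.\<close>
  have "W +> (c \<odot> y) = W +> (c \<odot> x)" if y: "y \<in> W +> x" for y
  proof -
    obtain w where w: "w \<in> W" "y = w \<oplus> x" using y by (auto simp: a_r_coset_def')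
    then have "c \<odot> y = c \<odot> w \<oplus> c \<odot> x" using W(1) x by (auto simp: smult_r_distr)
    then have "c \<odot> y \<in> W +> (c \<odot> x)" using W w by (auto simp: a_r_coset_def')
    then show ?thesis using x W_subgroup by (intro a_repr_independence[symmetric]) auto
  qed
  moreover have "x \<in> W +> x" using x by (rule abelian_subgroup.a_rcos_self[OF abelian_subgroup_W])
  ultimately have "(\<Union>y\<in>W +> x. W +> (c \<odot> y)) = W +> (c \<odot> x)" by blast
  then show "c \<odot>\<^bsub>quotient_space V W\<^esub> (W +> x) = W +> (c \<odot> x)"
    by (simp add: quotient_space_def)
qed

lemma quotient_vectorspace: "vectorspace (class_ring :: complex ring) (quotient_space V W)"
proof (rule vs_criteria, goal_cases)
  case 4
  have "(W +> x) \<oplus>\<^bsub>quotient_space V W\<^esub> (W +> (\<ominus> x)) = \<zero>\<^bsub>quotient_space V W\<^esub>"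
    if "x \<in> carrier V" for x
    using that by (simp add: quotient_space_sel r_neg)
  then show ?case by (auto simp: carrier_quotient_space)
qed (use class_field in \<open>auto simp: carrier_quotient_space quotient_space_sel a_ac smult_r_distr
    smult_l_distr[simplified] smult_assoc1[simplified] smult_one[simplified]\<close>)

text \<open>\<open>T\<close> maps each coset of \<open>W\<close> onto a coset of \<open>W'\<close>,
  so the direct image under \<open>T\<close> is itself the induced linear bijection of the
  quotients.\<close>

lemma quotient_space_dim_eq:
  assumes V': "complex_quotient_space V' W'"
    and T: "T \<in> LinearCombinations.module_hom (class_ring :: complex ring) V V'"
    and bij: "bij_betw T (carrier V) (carrier V')" and image: "T ` W = W'"
  shows "vectorspace.dim (class_ring :: complex ring) (quotient_space V W)
    = vectorspace.dim (class_ring :: complex ring) (quotient_space V' W')"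
proof (rule linear_bij_dim_eq)
  interpret V': complex_quotient_space V' W' by (rule V')
  show "vectorspace (class_ring :: complex ring) (quotient_space V W)"
    by (rule quotient_vectorspace)
  show "vectorspace (class_ring :: complex ring) (quotient_space V' W')"
    by (rule V'.quotient_vectorspace)
  have T_closed: "T x \<in> carrier V'" if "x \<in> carrier V" for x
    using that bij by (auto simp: bij_betw_def)
  have T_add: "T (x \<oplus>\<^bsub>V\<^esub> y) = T x \<oplus>\<^bsub>V'\<^esub> T y" if "x \<in> carrier V" "y \<in> carrier V" for x y
    using that T by (auto simp: LinearCombinations.module_hom_def)
  have T_smult: "T (c \<odot>\<^bsub>V\<^esub> x) = c \<odot>\<^bsub>V'\<^esub> T x" if "x \<in> carrier V" for x c
    using that T by (auto simp: LinearCombinations.module_hom_def)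
  have coset: "T ` (W +>\<^bsub>V\<^esub> x) = W' +>\<^bsub>V'\<^esub> T x" if x: "x \<in> carrier V" for x
  proof -
    have "T ` (W +>\<^bsub>V\<^esub> x) = (\<Union>w\<in>W. {T (w \<oplus>\<^bsub>V\<^esub> x)})"
      by (simp add: a_r_coset_def' image_UN)
    also have "\<dots> = (\<Union>w\<in>W. {T w \<oplus>\<^bsub>V'\<^esub> T x})"
      using T_add[OF subsetD[OF W(1)] x] by (intro SUP_cong) auto
    also have "\<dots> = W' +>\<^bsub>V'\<^esub> T x"
      unfolding image[symmetric] by (simp add: a_r_coset_def')
    finally show ?thesis .
  qed
  show "(`) T \<in> LinearCombinations.module_hom (class_ring :: complex ring)
      (quotient_space V W) (quotient_space V' W')"
    unfolding LinearCombinations.module_hom_def carrier_quotient_space V'.carrier_quotient_space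
  proof (intro CollectI conjI allI impI funcsetI; (elim conjE)?; elim imageE; hypsubst)
    show "T ` (W +>\<^bsub>V\<^esub> x) \<in> (\<lambda>y. W' +>\<^bsub>V'\<^esub> y) ` carrier V'" if "x \<in> carrier V" for x
      using that T_closed by (simp add: coset)
    show "T ` ((W +>\<^bsub>V\<^esub> x) \<oplus>\<^bsub>quotient_space V W\<^esub> (W +>\<^bsub>V\<^esub> y))
        = T ` (W +>\<^bsub>V\<^esub> x) \<oplus>\<^bsub>quotient_space V' W'\<^esub> T ` (W +>\<^bsub>V\<^esub> y)"
      if "x \<in> carrier V" "y \<in> carrier V" for x y
      using that by (simp add: quotient_space_sel V'.quotient_space_sel coset T_closed T_add)
    show "T ` (c \<odot>\<^bsub>quotient_space V W\<^esub> (W +>\<^bsub>V\<^esub> x)) = c \<odot>\<^bsub>quotient_space V' W'\<^esub> T ` (W +>\<^bsub>V\<^esub> x)"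
      if "x \<in> carrier V" for c x
      using that by (simp add: quotient_space_sel V'.quotient_space_sel coset T_closed T_smult)
  qed
  have "inj_on ((`) T) (carrier (quotient_space V W))"
  proof (rule inj_onI)
    fix X Y assume XY: "X \<in> carrier (quotient_space V W)" "Y \<in> carrier (quotient_space V W)"
      and eq: "T ` X = T ` Y"
    have "X \<subseteq> carrier V" "Y \<subseteq> carrier V"
      using XY W(1) by (auto simp: carrier_quotient_space a_r_coset_def')
    then show "X = Y" using eq bij by (metis bij_betw_imp_inj_on inj_on_image_eq_iff)
  qed
  moreover have "(`) T ` carrier (quotient_space V W) = carrier (quotient_space V' W')"
  proof -
    have "(`) T ` carrier (quotient_space V W) = (\<lambda>x. W' +>\<^bsub>V'\<^esub> T x) ` carrier V"
      unfolding carrier_quotient_space image_image by (intro image_cong) (simp_all add: coset)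
    also have "\<dots> = (\<lambda>x. W' +>\<^bsub>V'\<^esub> x) ` T ` carrier V" by (simp add: image_image)
    also have "T ` carrier V = carrier V'" using bij by (simp add: bij_betw_def)
    finally show ?thesis by (simp add: V'.carrier_quotient_space)
  qed
  ultimately show "bij_betw ((`) T) (carrier (quotient_space V W)) (carrier (quotient_space V' W'))"
    by (simp add: bij_betw_def)
qed

end

section \<open>Spaces of module homomorphisms\<close>

text \<open>The elements \<open>c \<odot> 1\<close> are central in \<open>A\<close>, so composing
  with their action keeps a map linear over \<open>A\<close>. The assumptions on \<open>N\<close>
  are closure properties, to fit a free module whose carrier is replaced by the syzygies.\<close>

lemma hom_space_vectorspace:
  assumes A: "complex_algebra A" and T: "left_module A T"
    and N: "\<And>x y. \<lbrakk>x \<in> carrier N; y \<in> carrier N\<rbrakk> \<Longrightarrow> x \<oplus>\<^bsub>N\<^esub> y \<in> carrier N"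
      "\<And>a x. \<lbrakk>a \<in> carrier A; x \<in> carrier N\<rbrakk> \<Longrightarrow> a \<odot>\<^bsub>N\<^esub> x \<in> carrier N"
  shows "vectorspace (class_ring :: complex ring) (hom_space A N T)"
proof -
  interpret complex_algebra A by (rule A)
  interpret T: left_module A T by (rule T)
  define e where "e c = c \<odot>\<^bsub>A\<^esub> \<one>\<^bsub>A\<^esub>" for c
  have e: "e c \<in> carrier A" "e (c + d) = e c \<oplus>\<^bsub>A\<^esub> e d" "e (c * d) = e c \<otimes>\<^bsub>A\<^esub> e d"
    "e 1 = \<one>\<^bsub>A\<^esub>" for c d
    by (simp_all add: e_def scale_closed scale_l_distr scale_assoc scale_one scale_mult_left)
  have central: "e c \<otimes>\<^bsub>A\<^esub> a = a \<otimes>\<^bsub>A\<^esub> e c" if "a \<in> carrier A" for c a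
    using that by (simp add: e_def scale_mult_left scale_mult_right)
  have swap: "a \<odot>\<^bsub>T\<^esub> (e c \<odot>\<^bsub>T\<^esub> x) = e c \<odot>\<^bsub>T\<^esub> (a \<odot>\<^bsub>T\<^esub> x)"
    if "a \<in> carrier A" "x \<in> carrier T" for a c x
    using that central by (simp add: T.lsmult_assoc[symmetric] e)
  let ?H = "hom_space A N T"
  have mem: "f \<in> carrier ?H \<longleftrightarrow> (\<forall>x\<in>carrier N. f x \<in> carrier T) \<and>
      (\<forall>x\<in>carrier N. \<forall>y\<in>carrier N. f (x \<oplus>\<^bsub>N\<^esub> y) = f x \<oplus>\<^bsub>T\<^esub> f y) \<and>
      (\<forall>a\<in>carrier A. \<forall>x\<in>carrier N. f (a \<odot>\<^bsub>N\<^esub> x) = a \<odot>\<^bsub>T\<^esub> f x) \<and> f \<in> extensional (carrier N)" for f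
    by (auto simp: hom_space_def LinearCombinations.module_hom_def)
  have sel: "\<zero>\<^bsub>?H\<^esub> = (\<lambda>x\<in>carrier N. \<zero>\<^bsub>T\<^esub>)" "f \<oplus>\<^bsub>?H\<^esub> g = (\<lambda>x\<in>carrier N. f x \<oplus>\<^bsub>T\<^esub> g x)"
    "c \<odot>\<^bsub>?H\<^esub> f = (\<lambda>x\<in>carrier N. e c \<odot>\<^bsub>T\<^esub> f x)" for f g c
    by (simp_all add: hom_space_def e_def)
  note T_simps = T.lsmult_closed T.lsmult_l_distr T.lsmult_r_distr T.lsmult_assoc T.lsmult_one
    T.lsmult_zero_left T.lsmult_zero_right
  have smult_mem: "(\<lambda>x\<in>carrier N. e c \<odot>\<^bsub>T\<^esub> f x) \<in> carrier ?H" if "f \<in> carrier ?H" for c f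
    using that N by (auto simp: mem T_simps swap e)
  show ?thesis
  proof (rule vs_criteria, goal_cases)
    case 1
    show ?case by (rule class_field)
  next
    case 2
    then show ?case using N by (auto simp: mem sel T_simps)
  next
    case 3
    then show ?case using N by (auto simp: mem sel T_simps T.M.a_ac)
  next
    case 4
    show ?case
    proof
      fix f assume f: "f \<in> carrier ?H"
      have "f x \<oplus>\<^bsub>T\<^esub> e (- 1) \<odot>\<^bsub>T\<^esub> f x = \<zero>\<^bsub>T\<^esub>" if "x \<in> carrier N" for x
      proof -
        have "e 1 \<odot>\<^bsub>T\<^esub> f x \<oplus>\<^bsub>T\<^esub> e (- 1) \<odot>\<^bsub>T\<^esub> f x = e (1 + - 1) \<odot>\<^bsub>T\<^esub> f x"
          using f that unfolding e(2) by (simp add: mem T_simps e(1))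
        moreover have "e 0 = \<zero>\<^bsub>A\<^esub>" by (simp add: e_def scale_zero_left)
        ultimately show ?thesis using f that by (simp add: mem T_simps e(4))
      qed
      then show "\<exists>g\<in>carrier ?H. f \<oplus>\<^bsub>?H\<^esub> g = \<zero>\<^bsub>?H\<^esub>"
        using smult_mem[OF f, of "- 1"]
        by (intro bexI[of _ "\<lambda>x\<in>carrier N. e (- 1) \<odot>\<^bsub>T\<^esub> f x"]) (auto simp: sel intro!: restrict_ext)
    qed
  next
    case 5
    then show ?case by (simp add: sel smult_mem)
  next
    case 6
    then show ?case by (auto simp: mem sel T.M.a_ac intro!: restrict_ext)
  next
    case 7
    then show ?case by (auto simp: mem sel T.M.a_ac intro!: restrict_ext)
  next
    case 8
    then show ?case by (auto simp: mem sel intro!: extensionalityI[of _ "carrier N"])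
  next
    case 9
    then show ?case by (auto simp: mem sel e T_simps intro!: restrict_ext)
  next
    case 10
    then show ?case by (auto simp: mem sel e T_simps intro!: extensionalityI[of _ "carrier N"])
  next
    case 11
    then show ?case by (auto simp: mem sel e T_simps intro!: restrict_ext)
  next
    case 12
    then show ?case by (auto simp: mem sel e T_simps intro!: restrict_ext)
  qed
qed

section \<open>Comparison of Ext spaces\<close>

lemma free_module_carrier:
  "f \<in> carrier (free_module A X) \<longleftrightarrow>
    (\<forall>x. f x \<in> carrier A) \<and> finite {x. f x \<noteq> \<zero>\<^bsub>A\<^esub>} \<and> {x. f x \<noteq> \<zero>\<^bsub>A\<^esub>} \<subseteq> X"
  by (auto simp: free_module_def)

lemma free_module_sel:
  "f \<oplus>\<^bsub>free_module A X\<^esub> g = (\<lambda>x. f x \<oplus>\<^bsub>A\<^esub> g x)"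
  "a \<odot>\<^bsub>free_module A X\<^esub> f = (\<lambda>x. a \<otimes>\<^bsub>A\<^esub> f x)"
  "(free_module A X)\<lparr>carrier := carrier (free_module A X)\<rparr> = free_module A X"
  by (simp_all add: free_module_def)

context ring
begin

lemma free_module_add_closed:
  assumes "f \<in> carrier (free_module R X)" "g \<in> carrier (free_module R X)"
  shows "(\<lambda>x. f x \<oplus> g x) \<in> carrier (free_module R X)"
proof -
  have "{x. f x \<oplus> g x \<noteq> \<zero>} \<subseteq> {x. f x \<noteq> \<zero>} \<union> {x. g x \<noteq> \<zero>}" by auto
  moreover have "finite ({x. f x \<noteq> \<zero>} \<union> {x. g x \<noteq> \<zero>})" "{x. f x \<noteq> \<zero>} \<union> {x. g x \<noteq> \<zero>} \<subseteq> X"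
    using assms by (auto simp: free_module_carrier)
  ultimately have "finite {x. f x \<oplus> g x \<noteq> \<zero>}" "{x. f x \<oplus> g x \<noteq> \<zero>} \<subseteq> X"
    using finite_subset by (blast, blast)
  then show ?thesis using assms by (simp add: free_module_carrier)
qed

lemma free_module_smult_closed:
  assumes "a \<in> carrier R" "f \<in> carrier (free_module R X)"
  shows "(\<lambda>x. a \<otimes> f x) \<in> carrier (free_module R X)"
proof -
  have "{x. a \<otimes> f x \<noteq> \<zero>} \<subseteq> {x. f x \<noteq> \<zero>}" using assms by auto
  moreover have "finite {x. f x \<noteq> \<zero>}" "{x. f x \<noteq> \<zero>} \<subseteq> X"
    using assms by (auto simp: free_module_carrier)
  ultimately have "finite {x. a \<otimes> f x \<noteq> \<zero>}" "{x. a \<otimes> f x \<noteq> \<zero>} \<subseteq> X"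
    using finite_subset by (blast, blast)
  then show ?thesis using assms by (simp add: free_module_carrier)
qed

end

section \<open>The canonical surjection from the free module and its kernel\<close>

definition evaluation :: "('a, 'e) ring_scheme \<Rightarrow> ('a, 's, 'f) module_scheme \<Rightarrow> ('s \<Rightarrow> 'a) \<Rightarrow> 's" where
  "evaluation A S f = (\<Oplus>\<^bsub>S\<^esub>s\<in>{s. f s \<noteq> \<zero>\<^bsub>A\<^esub>}. f s \<odot>\<^bsub>S\<^esub> s)"

lemma syzygies_iff:
  "f \<in> syzygies A S \<longleftrightarrow> f \<in> carrier (free_module A (carrier S)) \<and> evaluation A S f = \<zero>\<^bsub>S\<^esub>"
  by (simp add: syzygies_def evaluation_def)

context left_module
begin

text \<open>Any finite set containing the support may index the sum, so that two functions can be
  evaluated over the union of their supports.\<close>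

lemma evaluation_eq:
  assumes "\<And>x. f x \<in> carrier A" "finite X" "{x. f x \<noteq> \<zero>\<^bsub>A\<^esub>} \<subseteq> X" "X \<subseteq> carrier M"
  shows "evaluation A M f = (\<Oplus>\<^bsub>M\<^esub>s\<in>X. f s \<odot>\<^bsub>M\<^esub> s)"
  unfolding evaluation_def
proof (rule M.add.finprod_mono_neutral_cong_left)
  show "finite X" "{x. f x \<noteq> \<zero>\<^bsub>A\<^esub>} \<subseteq> X" by fact+
  fix s assume "s \<in> X - {x. f x \<noteq> \<zero>\<^bsub>A\<^esub>}"
  then show "f s \<odot>\<^bsub>M\<^esub> s = \<zero>\<^bsub>M\<^esub>" using assms(4) by (auto simp: lsmult_zero_left)
qed (use assms in \<open>auto intro: lsmult_closed\<close>)

lemma evaluation_single: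
  assumes "r \<in> carrier A" "s \<in> carrier M"
  shows "evaluation A M (\<lambda>x. if x = s then r else \<zero>\<^bsub>A\<^esub>) = r \<odot>\<^bsub>M\<^esub> s"
  using assms by (subst evaluation_eq[where X = "{s}"]) (auto simp: lsmult_closed)

lemma evaluation_add:
  assumes f: "f \<in> carrier (free_module A (carrier M))" and g: "g \<in> carrier (free_module A (carrier M))"
  shows "evaluation A M (\<lambda>x. f x \<oplus>\<^bsub>A\<^esub> g x) = evaluation A M f \<oplus>\<^bsub>M\<^esub> evaluation A M g"
proof -
  let ?X = "{x. f x \<noteq> \<zero>\<^bsub>A\<^esub>} \<union> {x. g x \<noteq> \<zero>\<^bsub>A\<^esub>}"
  have X: "finite ?X" "?X \<subseteq> carrier M" using f g by (auto simp: free_module_carrier)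
  have cl: "f x \<in> carrier A" "g x \<in> carrier A" for x using f g by (auto simp: free_module_carrier)
  have "evaluation A M (\<lambda>x. f x \<oplus>\<^bsub>A\<^esub> g x) = (\<Oplus>\<^bsub>M\<^esub>s\<in>?X. (f s \<oplus>\<^bsub>A\<^esub> g s) \<odot>\<^bsub>M\<^esub> s)"
    using cl X by (intro evaluation_eq) auto
  also have "\<dots> = (\<Oplus>\<^bsub>M\<^esub>s\<in>?X. f s \<odot>\<^bsub>M\<^esub> s \<oplus>\<^bsub>M\<^esub> g s \<odot>\<^bsub>M\<^esub> s)"
    using cl X by (intro M.finsum_cong') (auto simp: lsmult_l_distr lsmult_closed)
  also have "\<dots> = (\<Oplus>\<^bsub>M\<^esub>s\<in>?X. f s \<odot>\<^bsub>M\<^esub> s) \<oplus>\<^bsub>M\<^esub> (\<Oplus>\<^bsub>M\<^esub>s\<in>?X. g s \<odot>\<^bsub>M\<^esub> s)"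
    using cl X by (intro M.finsum_addf) (auto simp: lsmult_closed)
  also have "(\<Oplus>\<^bsub>M\<^esub>s\<in>?X. f s \<odot>\<^bsub>M\<^esub> s) = evaluation A M f"
    using cl X by (intro evaluation_eq[symmetric]) auto
  also have "(\<Oplus>\<^bsub>M\<^esub>s\<in>?X. g s \<odot>\<^bsub>M\<^esub> s) = evaluation A M g"
    using cl X by (intro evaluation_eq[symmetric]) auto
  finally show ?thesis .
qed

lemma lsmult_finsum:
  assumes a: "a \<in> carrier A" and "finite X" and "h \<in> X \<rightarrow> carrier M"
  shows "a \<odot>\<^bsub>M\<^esub> (\<Oplus>\<^bsub>M\<^esub>s\<in>X. h s) = (\<Oplus>\<^bsub>M\<^esub>s\<in>X. a \<odot>\<^bsub>M\<^esub> h s)"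
  using assms(2,3)
proof (induction X)
  case (insert x X)
  then have "h \<in> X \<rightarrow> carrier M" "h x \<in> carrier M" "(\<lambda>s. a \<odot>\<^bsub>M\<^esub> h s) \<in> X \<rightarrow> carrier M"
    using a by (auto intro: lsmult_closed)
  then show ?case using insert a by (simp add: lsmult_r_distr lsmult_closed)
qed (simp add: a lsmult_zero_right)

lemma evaluation_smult:
  assumes a: "a \<in> carrier A" and f: "f \<in> carrier (free_module A (carrier M))"
  shows "evaluation A M (\<lambda>x. a \<otimes>\<^bsub>A\<^esub> f x) = a \<odot>\<^bsub>M\<^esub> evaluation A M f"
proof -
  let ?X = "{x. f x \<noteq> \<zero>\<^bsub>A\<^esub>}"
  have X: "finite ?X" "?X \<subseteq> carrier M" and cl: "f x \<in> carrier A" for x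
    using f by (auto simp: free_module_carrier)
  have "evaluation A M (\<lambda>x. a \<otimes>\<^bsub>A\<^esub> f x) = (\<Oplus>\<^bsub>M\<^esub>s\<in>?X. (a \<otimes>\<^bsub>A\<^esub> f s) \<odot>\<^bsub>M\<^esub> s)"
    using cl X a by (intro evaluation_eq) auto
  also have "\<dots> = (\<Oplus>\<^bsub>M\<^esub>s\<in>?X. a \<odot>\<^bsub>M\<^esub> (f s \<odot>\<^bsub>M\<^esub> s))"
    using cl X a by (intro M.finsum_cong') (auto simp: lsmult_assoc lsmult_closed)
  also have "\<dots> = a \<odot>\<^bsub>M\<^esub> (\<Oplus>\<^bsub>M\<^esub>s\<in>?X. f s \<odot>\<^bsub>M\<^esub> s)"
    using cl X a by (intro lsmult_finsum[symmetric]) (auto simp: lsmult_closed)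
  finally show ?thesis by (simp add: evaluation_def)
qed

lemma evaluation_closed:
  assumes f: "f \<in> carrier (free_module A (carrier M))"
  shows "evaluation A M f \<in> carrier M"
  unfolding evaluation_def using f
  by (intro M.finsum_closed) (auto simp: free_module_carrier intro: lsmult_closed)

lemma syzygies_add_closed:
  "\<lbrakk>f \<in> syzygies A M; g \<in> syzygies A M\<rbrakk> \<Longrightarrow> (\<lambda>x. f x \<oplus>\<^bsub>A\<^esub> g x) \<in> syzygies A M"
  by (simp add: syzygies_iff evaluation_add A.free_module_add_closed)

lemma syzygies_smult_closed:
  "\<lbrakk>a \<in> carrier A; f \<in> syzygies A M\<rbrakk> \<Longrightarrow> (\<lambda>x. a \<otimes>\<^bsub>A\<^esub> f x) \<in> syzygies A M"
  by (simp add: syzygies_iff evaluation_smult A.free_module_smult_closed lsmult_zero_right)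

end

text \<open>One notation for both Hom spaces of the free presentation: \<open>U\<close> will be the
  whole free module or the syzygies, and statements about \<open>U\<close> serve for both.\<close>

definition "free_hom_space A X U T = hom_space A ((free_module A X)\<lparr>carrier := U\<rparr>) T"

lemma free_hom_space_carrier:
  "g \<in> carrier (free_hom_space A X U T) \<longleftrightarrow> (\<forall>f\<in>U. g f \<in> carrier T) \<and>
    (\<forall>f\<in>U. \<forall>h\<in>U. g (\<lambda>x. f x \<oplus>\<^bsub>A\<^esub> h x) = g f \<oplus>\<^bsub>T\<^esub> g h) \<and>
    (\<forall>a\<in>carrier A. \<forall>f\<in>U. g (\<lambda>x. a \<otimes>\<^bsub>A\<^esub> f x) = a \<odot>\<^bsub>T\<^esub> g f) \<and> g \<in> extensional U"
  by (auto simp: free_hom_space_def hom_space_def LinearCombinations.module_hom_def free_module_def)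

lemma free_hom_space_sel:
  "\<zero>\<^bsub>free_hom_space A X U T\<^esub> = (\<lambda>f\<in>U. \<zero>\<^bsub>T\<^esub>)"
  "g \<oplus>\<^bsub>free_hom_space A X U T\<^esub> h = (\<lambda>f\<in>U. g f \<oplus>\<^bsub>T\<^esub> h f)"
  "c \<odot>\<^bsub>free_hom_space A X U T\<^esub> g = (\<lambda>f\<in>U. (c \<odot>\<^bsub>A\<^esub> \<one>\<^bsub>A\<^esub>) \<odot>\<^bsub>T\<^esub> g f)"
  by (simp_all add: free_hom_space_def hom_space_def)

text \<open>Image of the restriction map, whose cokernel is \<open>Ext1\<close>.\<close>

definition boundaries ::
  "(complex, 'a, 'e) module_scheme \<Rightarrow> ('a, 's, 'f) module_scheme \<Rightarrow> ('a, 't, 'g) module_scheme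
    \<Rightarrow> (('s \<Rightarrow> 'a) \<Rightarrow> 't) set" where
  "boundaries A S T = (\<lambda>g. restrict g (syzygies A S)) `
    carrier (free_hom_space A (carrier S) (carrier (free_module A (carrier S))) T)"

lemma Ext1_eq:
  "Ext1 A S T = quotient_space (free_hom_space A (carrier S) (syzygies A S) T) (boundaries A S T)"
  by (simp add: Ext1_def boundaries_def Let_def free_hom_space_def free_module_sel)

lemma free_hom_vectorspace:
  assumes "complex_algebra A" "left_module A T"
    and "\<And>f g. \<lbrakk>f \<in> U; g \<in> U\<rbrakk> \<Longrightarrow> (\<lambda>x. f x \<oplus>\<^bsub>A\<^esub> g x) \<in> U"
    and "\<And>a f. \<lbrakk>a \<in> carrier A; f \<in> U\<rbrakk> \<Longrightarrow> (\<lambda>x. a \<otimes>\<^bsub>A\<^esub> f x) \<in> U"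
  shows "vectorspace (class_ring :: complex ring) (free_hom_space A X U T)"
  unfolding free_hom_space_def
  using assms by (intro hom_space_vectorspace) (auto simp: free_module_sel free_module_def)

lemma Ext1_quotient_space:
  assumes A: "complex_algebra A" and S: "left_module A S" and T: "left_module A T"
  shows "complex_quotient_space (free_hom_space A (carrier S) (syzygies A S) T) (boundaries A S T)"
proof -
  interpret A: complex_algebra A by (rule A)
  interpret S: left_module A S by (rule S)
  interpret T: left_module A T by (rule T)
  let ?F = "carrier (free_module A (carrier S))"
  let ?H = "free_hom_space A (carrier S) ?F T" and ?H' = "free_hom_space A (carrier S) (syzygies A S) T"
  interpret H: vectorspace "class_ring :: complex ring" ?H
    using A T by (intro free_hom_vectorspace) (auto intro: A.free_module_add_closed A.free_module_smult_closed)
  interpret H': vectorspace "class_ring :: complex ring" ?H'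
    using A T by (intro free_hom_vectorspace) (auto intro: S.syzygies_add_closed S.syzygies_smult_closed)
  have sub: "syzygies A S \<subseteq> ?F" by (auto simp: syzygies_iff)
  let ?r = "\<lambda>g. restrict g (syzygies A S)"
  show ?thesis
  proof (unfold_locales)
    show "boundaries A S T \<subseteq> carrier ?H'"
      using sub S.syzygies_add_closed S.syzygies_smult_closed
      unfolding boundaries_def by (auto simp: free_hom_space_carrier subset_iff)
    have "?r \<zero>\<^bsub>?H\<^esub> = \<zero>\<^bsub>?H'\<^esub>"
      using sub by (auto simp: free_hom_space_sel fun_eq_iff)
    then show "\<zero>\<^bsub>?H'\<^esub> \<in> boundaries A S T"
      unfolding boundaries_def by (intro image_eqI[OF _ H.zero_closed]) simp
  next
    fix x y assume "x \<in> boundaries A S T" "y \<in> boundaries A S T"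
    then obtain g h where gh: "g \<in> carrier ?H" "x = ?r g" "h \<in> carrier ?H" "y = ?r h"
      unfolding boundaries_def by blast
    have "?r (g \<oplus>\<^bsub>?H\<^esub> h) = x \<oplus>\<^bsub>?H'\<^esub> y"
      using gh sub by (auto simp: free_hom_space_sel fun_eq_iff)
    then show "x \<oplus>\<^bsub>?H'\<^esub> y \<in> boundaries A S T"
      unfolding boundaries_def by (intro image_eqI[OF _ H.a_closed[OF gh(1,3)]]) simp
  next
    fix c x assume "x \<in> boundaries A S T"
    then obtain g where g: "g \<in> carrier ?H" "x = ?r g"
      unfolding boundaries_def by blast
    have "?r (c \<odot>\<^bsub>?H\<^esub> g) = c \<odot>\<^bsub>?H'\<^esub> x"
      using g sub by (auto simp: free_hom_space_sel fun_eq_iff)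
    moreover have "c \<odot>\<^bsub>?H\<^esub> g \<in> carrier ?H" using g by (intro H.smult_closed) auto
    ultimately show "c \<odot>\<^bsub>?H'\<^esub> x \<in> boundaries A S T"
      unfolding boundaries_def by (intro image_eqI[where x = "c \<odot>\<^bsub>?H\<^esub> g"]) simp_all
  qed
qed

lemma free_hom_closed: "\<lbrakk>g \<in> carrier (free_hom_space A X U T); f \<in> U\<rbrakk> \<Longrightarrow> g f \<in> carrier T"
  and free_hom_add: "\<lbrakk>g \<in> carrier (free_hom_space A X U T); f \<in> U; h \<in> U\<rbrakk>
    \<Longrightarrow> g (\<lambda>x. f x \<oplus>\<^bsub>A\<^esub> h x) = g f \<oplus>\<^bsub>T\<^esub> g h"
  and free_hom_smult: "\<lbrakk>g \<in> carrier (free_hom_space A X U T); a \<in> carrier A; f \<in> U\<rbrakk>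
    \<Longrightarrow> g (\<lambda>x. a \<otimes>\<^bsub>A\<^esub> f x) = a \<odot>\<^bsub>T\<^esub> g f"
  and free_hom_extensional: "g \<in> carrier (free_hom_space A X U T) \<Longrightarrow> g \<in> extensional U"
  by (auto simp: free_hom_space_carrier)

text \<open>An isomorphism over \<open>A\<close> from the \<open>B\<close>-module \<open>N\<close>,
  with scalars restricted along \<open>\<phi>\<close>, to \<open>M\<close>. Thus
  \<open>\<sigma>\<close> goes from \<open>N\<close> to \<open>M\<close>, against the direction of
  \<open>\<phi>\<close>.\<close>

definition semilinear_iso ::
  "('a, 'e) ring_scheme \<Rightarrow> ('a \<Rightarrow> 'b) \<Rightarrow> ('a, 'm, 'f) module_scheme \<Rightarrow> ('b, 'n, 'g) module_scheme
    \<Rightarrow> ('n \<Rightarrow> 'm) \<Rightarrow> bool" where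
  "semilinear_iso A \<phi> M N \<sigma> \<longleftrightarrow> bij_betw \<sigma> (carrier N) (carrier M) \<and>
    (\<forall>x\<in>carrier N. \<forall>y\<in>carrier N. \<sigma> (x \<oplus>\<^bsub>N\<^esub> y) = \<sigma> x \<oplus>\<^bsub>M\<^esub> \<sigma> y) \<and>
    (\<forall>a\<in>carrier A. \<forall>x\<in>carrier N. \<sigma> (\<phi> a \<odot>\<^bsub>N\<^esub> x) = a \<odot>\<^bsub>M\<^esub> \<sigma> x)"

section \<open>Free modules and syzygies along a semilinear isomorphism\<close>

locale semilinear_modules =
  A?: complex_algebra A + B?: complex_algebra B + S: left_module A S + S': left_module B S'
  for A :: "(complex, 'a, 'e) module_scheme" and B :: "(complex, 'b, 'f) module_scheme"
    and S :: "('a, 's, 'g) module_scheme" and S' :: "('b, 's1, 'h) module_scheme" +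
  fixes \<phi> :: "'a \<Rightarrow> 'b" and \<sigma> :: "'s1 \<Rightarrow> 's"
  assumes alg_hom: "\<phi> \<in> alg_hom A B" and surj: "\<phi> ` carrier A = carrier B"
    and \<sigma>: "semilinear_iso A \<phi> S S' \<sigma>"
begin

lemma hom_simps:
  "a \<in> carrier A \<Longrightarrow> \<phi> a \<in> carrier B"
  "\<lbrakk>a \<in> carrier A; b \<in> carrier A\<rbrakk> \<Longrightarrow> \<phi> (a \<oplus>\<^bsub>A\<^esub> b) = \<phi> a \<oplus>\<^bsub>B\<^esub> \<phi> b"
  "\<lbrakk>a \<in> carrier A; b \<in> carrier A\<rbrakk> \<Longrightarrow> \<phi> (a \<otimes>\<^bsub>A\<^esub> b) = \<phi> a \<otimes>\<^bsub>B\<^esub> \<phi> b"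
  "\<phi> \<one>\<^bsub>A\<^esub> = \<one>\<^bsub>B\<^esub>"
  "a \<in> carrier A \<Longrightarrow> \<phi> (c \<odot>\<^bsub>A\<^esub> a) = c \<odot>\<^bsub>B\<^esub> \<phi> a"
  "\<phi> \<zero>\<^bsub>A\<^esub> = \<zero>\<^bsub>B\<^esub>"
proof -
  have h: "\<phi> \<in> Ring.ring_hom A B" and "a \<in> carrier A \<Longrightarrow> \<phi> (c \<odot>\<^bsub>A\<^esub> a) = c \<odot>\<^bsub>B\<^esub> \<phi> a" for a c
    using alg_hom by (auto simp: alg_hom_def)
  then show "a \<in> carrier A \<Longrightarrow> \<phi> (c \<odot>\<^bsub>A\<^esub> a) = c \<odot>\<^bsub>B\<^esub> \<phi> a" by blast
  show "\<phi> \<zero>\<^bsub>A\<^esub> = \<zero>\<^bsub>B\<^esub>" using ring_hom_zero[OF h A.ring_axioms B.ring_axioms] .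
qed (use alg_hom in \<open>auto simp: alg_hom_def ring_hom_closed ring_hom_add ring_hom_mult ring_hom_one\<close>)

lemma iso_simps:
  "x \<in> carrier S' \<Longrightarrow> \<sigma> x \<in> carrier S"
  "\<lbrakk>x \<in> carrier S'; y \<in> carrier S'\<rbrakk> \<Longrightarrow> \<sigma> (x \<oplus>\<^bsub>S'\<^esub> y) = \<sigma> x \<oplus>\<^bsub>S\<^esub> \<sigma> y"
  "\<lbrakk>a \<in> carrier A; x \<in> carrier S'\<rbrakk> \<Longrightarrow> \<sigma> (\<phi> a \<odot>\<^bsub>S'\<^esub> x) = a \<odot>\<^bsub>S\<^esub> \<sigma> x"
  using \<sigma> by (auto simp: semilinear_iso_def bij_betw_def)

lemma iso_bij: "inj_on \<sigma> (carrier S')" "\<sigma> ` carrier S' = carrier S"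
  using \<sigma> by (auto simp: semilinear_iso_def bij_betw_def)

lemma iso_zero: "\<sigma> \<zero>\<^bsub>S'\<^esub> = \<zero>\<^bsub>S\<^esub>"
  using iso_simps(2)[of "\<zero>\<^bsub>S'\<^esub>" "\<zero>\<^bsub>S'\<^esub>"] iso_simps(1)[of "\<zero>\<^bsub>S'\<^esub>"]
  by (simp add: S.M.add.r_cancel_one)

lemma iso_finsum:
  assumes "finite X" "h \<in> X \<rightarrow> carrier S'"
  shows "\<sigma> (\<Oplus>\<^bsub>S'\<^esub>x\<in>X. h x) = (\<Oplus>\<^bsub>S\<^esub>x\<in>X. \<sigma> (h x))"
  using assms
proof (induction X)
  case (insert x X)
  then have "h \<in> X \<rightarrow> carrier S'" "h x \<in> carrier S'" "(\<lambda>x. \<sigma> (h x)) \<in> X \<rightarrow> carrier S"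
    by (auto intro: iso_simps)
  then show ?case using insert by (simp add: iso_simps)
qed (simp add: iso_zero)

text \<open>Changes coefficients along \<open>\<phi>\<close> and relabels the basis by
  \<open>\<sigma>\<close>: the map of free modules that covers the inverse of
  \<open>\<sigma>\<close> on the modules themselves.\<close>

definition push :: "('s \<Rightarrow> 'a) \<Rightarrow> 's1 \<Rightarrow> 'b" where
  "push f = (\<lambda>x. if x \<in> carrier S' then \<phi> (f (\<sigma> x)) else \<zero>\<^bsub>B\<^esub>)"

abbreviation "F \<equiv> carrier (free_module A (carrier S))"
abbreviation "F' \<equiv> carrier (free_module B (carrier S'))"

lemma push_support:
  assumes "f \<in> F"
  shows "{x. push f x \<noteq> \<zero>\<^bsub>B\<^esub>} \<subseteq> {x \<in> carrier S'. f (\<sigma> x) \<noteq> \<zero>\<^bsub>A\<^esub>}"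
    and "finite {x \<in> carrier S'. f (\<sigma> x) \<noteq> \<zero>\<^bsub>A\<^esub>}"
    and "\<sigma> ` {x \<in> carrier S'. f (\<sigma> x) \<noteq> \<zero>\<^bsub>A\<^esub>} = {s. f s \<noteq> \<zero>\<^bsub>A\<^esub>}"
proof -
  show "{x. push f x \<noteq> \<zero>\<^bsub>B\<^esub>} \<subseteq> {x \<in> carrier S'. f (\<sigma> x) \<noteq> \<zero>\<^bsub>A\<^esub>}"
    by (auto simp: push_def hom_simps split: if_splits)
  show *: "\<sigma> ` {x \<in> carrier S'. f (\<sigma> x) \<noteq> \<zero>\<^bsub>A\<^esub>} = {s. f s \<noteq> \<zero>\<^bsub>A\<^esub>}"
    using assms iso_bij(2) by (auto simp: free_module_carrier)
  have "inj_on \<sigma> {x \<in> carrier S'. f (\<sigma> x) \<noteq> \<zero>\<^bsub>A\<^esub>}"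
    using iso_bij(1) by (rule inj_on_subset) auto
  moreover have "finite {s. f s \<noteq> \<zero>\<^bsub>A\<^esub>}" using assms by (simp add: free_module_carrier)
  ultimately show "finite {x \<in> carrier S'. f (\<sigma> x) \<noteq> \<zero>\<^bsub>A\<^esub>}"
    using * by (intro finite_imageD[of \<sigma>]) simp_all
qed

lemma push_closed: "f \<in> F \<Longrightarrow> push f \<in> F'"
  using push_support[of f] finite_subset[of "{x. push f x \<noteq> \<zero>\<^bsub>B\<^esub>}"]
  unfolding free_module_carrier by (auto simp: push_def hom_simps)

lemma push_add: "\<lbrakk>f \<in> F; g \<in> F\<rbrakk> \<Longrightarrow> push (\<lambda>x. f x \<oplus>\<^bsub>A\<^esub> g x) = (\<lambda>x. push f x \<oplus>\<^bsub>B\<^esub> push g x)"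
  by (auto simp: push_def fun_eq_iff hom_simps free_module_carrier)

lemma push_smult:
  "\<lbrakk>a \<in> carrier A; f \<in> F\<rbrakk> \<Longrightarrow> push (\<lambda>x. a \<otimes>\<^bsub>A\<^esub> f x) = (\<lambda>x. \<phi> a \<otimes>\<^bsub>B\<^esub> push f x)"
  by (auto simp: push_def fun_eq_iff hom_simps free_module_carrier)

lemma push_surj:
  assumes g: "g \<in> F'"
  shows "\<exists>f\<in>F. push f = g"
proof -
  let ?\<sigma>' = "inv_into (carrier S') \<sigma>"
  \<comment> \<open>Zero is lifted to zero on purpose: this keeps the support of the preimage
    finite.\<close>
  have "\<exists>a\<in>carrier A. \<phi> a = g x \<and> (g x = \<zero>\<^bsub>B\<^esub> \<longrightarrow> a = \<zero>\<^bsub>A\<^esub>)" for x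
  proof (cases "g x = \<zero>\<^bsub>B\<^esub>")
    case True
    then show ?thesis by (intro bexI[of _ "\<zero>\<^bsub>A\<^esub>"]) (auto simp: hom_simps)
  next
    case False
    have "g x \<in> \<phi> ` carrier A" using g surj by (simp add: free_module_carrier)
    then show ?thesis using False by auto
  qed
  then obtain l where l: "\<And>x. l x \<in> carrier A" "\<And>x. \<phi> (l x) = g x" "\<And>x. g x = \<zero>\<^bsub>B\<^esub> \<Longrightarrow> l x = \<zero>\<^bsub>A\<^esub>"
    by metis
  define f where "f = (\<lambda>s. if s \<in> carrier S then l (?\<sigma>' s) else \<zero>\<^bsub>A\<^esub>)"
  have "{s. f s \<noteq> \<zero>\<^bsub>A\<^esub>} \<subseteq> \<sigma> ` {x. g x \<noteq> \<zero>\<^bsub>B\<^esub>}"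
  proof
    fix s assume "s \<in> {s. f s \<noteq> \<zero>\<^bsub>A\<^esub>}"
    then have "s \<in> carrier S" "g (?\<sigma>' s) \<noteq> \<zero>\<^bsub>B\<^esub>" using l(3) by (auto simp: f_def split: if_splits)
    then show "s \<in> \<sigma> ` {x. g x \<noteq> \<zero>\<^bsub>B\<^esub>}"
      using iso_bij(2) by (intro image_eqI[of _ _ "?\<sigma>' s"]) (auto simp: f_inv_into_f)
  qed
  then have "finite {s. f s \<noteq> \<zero>\<^bsub>A\<^esub>}"
    using g finite_subset by (auto simp: free_module_carrier)
  moreover have "{s. f s \<noteq> \<zero>\<^bsub>A\<^esub>} \<subseteq> carrier S" by (auto simp: f_def)
  ultimately have "f \<in> F" using l(1) by (simp add: free_module_carrier f_def)
  moreover have "push f = g"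
  proof
    fix x
    have "g x = \<zero>\<^bsub>B\<^esub>" if "x \<notin> carrier S'" using that g by (auto simp: free_module_carrier)
    then show "push f x = g x"
      using l(2) iso_bij(1) by (auto simp: push_def f_def iso_simps)
  qed
  ultimately show ?thesis by blast
qed

lemma evaluation_push:
  assumes f: "f \<in> F"
  shows "\<sigma> (evaluation B S' (push f)) = evaluation A S f"
proof -
  \<comment> \<open>The support of \<open>f\<close> is pulled back instead of taking the support of
    \<open>push f\<close>, which may be smaller because \<open>\<phi>\<close> can kill
    coefficients.\<close>
  let ?X = "{x \<in> carrier S'. f (\<sigma> x) \<noteq> \<zero>\<^bsub>A\<^esub>}"
  have cl: "f s \<in> carrier A" for s using f by (simp add: free_module_carrier)
  have "evaluation B S' (push f) = (\<Oplus>\<^bsub>S'\<^esub>x\<in>?X. push f x \<odot>\<^bsub>S'\<^esub> x)"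
    using push_closed[OF f] push_support[OF f]
    by (intro S'.evaluation_eq) (auto simp: free_module_carrier)
  also have "\<sigma> \<dots> = (\<Oplus>\<^bsub>S\<^esub>x\<in>?X. \<sigma> (push f x \<odot>\<^bsub>S'\<^esub> x))"
    using push_closed[OF f] push_support[OF f]
    by (intro iso_finsum) (auto simp: free_module_carrier intro: S'.lsmult_closed)
  also have "\<dots> = (\<Oplus>\<^bsub>S\<^esub>x\<in>?X. f (\<sigma> x) \<odot>\<^bsub>S\<^esub> \<sigma> x)"
    using cl by (intro S.M.finsum_cong') (auto simp: push_def iso_simps intro: S.lsmult_closed)
  also have "\<dots> = (\<Oplus>\<^bsub>S\<^esub>s\<in>\<sigma> ` ?X. f s \<odot>\<^bsub>S\<^esub> s)"
    using cl iso_bij(1)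
    by (intro S.M.finsum_reindex[symmetric]) (auto simp: iso_simps intro: S.lsmult_closed inj_on_subset)
  finally show ?thesis unfolding push_support(3)[OF f] by (simp add: evaluation_def)
qed

text \<open>The evaluations correspond under the injective map \<open>\<sigma>\<close>, so they
  vanish together.\<close>

lemma push_syzygies:
  assumes f: "f \<in> F"
  shows "push f \<in> syzygies B S' \<longleftrightarrow> f \<in> syzygies A S"
proof -
  have ev: "evaluation B S' (push f) \<in> carrier S'"
    using push_closed[OF f] by (rule S'.evaluation_closed)
  have "evaluation B S' (push f) = \<zero>\<^bsub>S'\<^esub> \<longleftrightarrow> \<sigma> (evaluation B S' (push f)) = \<sigma> \<zero>\<^bsub>S'\<^esub>"
    using ev iso_bij(1) by (metis S'.M.zero_closed inj_on_eq_iff)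
  then show ?thesis using f push_closed[OF f] by (simp add: syzygies_iff evaluation_push iso_zero)
qed

end

section \<open>Comparison of homomorphisms over the two algebras\<close>

locale ext_comparison =
  S: semilinear_modules A B S S' \<phi> \<sigma> + T: semilinear_modules A B T T' \<phi> \<tau>
  for A :: "(complex, 'a, 'e) module_scheme" and B :: "(complex, 'b, 'f) module_scheme"
    and S :: "('a, 's, 'g) module_scheme" and S' :: "('b, 's1, 'h) module_scheme"
    and T :: "('a, 't, 'i) module_scheme" and T' :: "('b, 't1, 'j) module_scheme"
    and \<phi> \<sigma> \<tau> +
  assumes simple: "simple_module A S" "simple_module A T"
    and kernel: "a_kernel A B \<phi> \<subseteq> radical_square A"
begin

text \<open>The key point: an element \<open>r r'\<close> of the square of the radical, placed at a basis element
  \<open>s\<close>, is \<open>r\<close> times a syzygy, and \<open>r\<close> annihilates \<open>T\<close>.\<close>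

lemma hom_radical_square_single:
  assumes g: "g \<in> carrier (free_hom_space A (carrier S) U T)" and U: "syzygies A S \<subseteq> U"
    and s: "s \<in> carrier S" and r: "r \<in> radical_square A"
  shows "(\<lambda>x. if x = s then r else \<zero>\<^bsub>A\<^esub>) \<in> syzygies A S" (is "?single r \<in> _")
    and "g (\<lambda>x. if x = s then r else \<zero>\<^bsub>A\<^esub>) = \<zero>\<^bsub>T\<^esub>"
proof -
  have syz: "(\<lambda>x. if x = s then j else \<zero>\<^bsub>A\<^esub>) \<in> syzygies A S" if "j \<in> jacobson_radical A" for j
  proof -
    note j = S.A.jacobson_radical_closed[OF that]
    then have "(\<lambda>x. if x = s then j else \<zero>\<^bsub>A\<^esub>) \<in> S.F"
      using s by (auto simp: free_module_carrier)
    then show ?thesis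
      using jacobson_radical_annihilates_simple[OF simple(1) that s] j s
      by (simp add: syzygies_iff S.S.evaluation_single)
  qed
  then show "?single r \<in> syzygies A S" using r S.A.radical_square_subset by blast
  \<comment> \<open>Membership in the radical is carried through the induction, since in the case of
    a sum it puts the functions supported at \<open>s\<close> into the syzygies, hence into
    \<open>U\<close>, where \<open>g\<close> is additive.\<close>
  have "r \<in> jacobson_radical A \<and> g (?single r) = \<zero>\<^bsub>T\<^esub>"
    using r unfolding radical_square_def
  proof (induction rule: ideal_prod.induct)
    case (prod i j)
    have ij: "i \<in> carrier A" "j \<in> carrier A" using prod by (auto intro: S.A.jacobson_radical_closed)
    have "?single (i \<otimes>\<^bsub>A\<^esub> j) = (\<lambda>x. i \<otimes>\<^bsub>A\<^esub> ?single j x)" using ij by auto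
    moreover have "?single j \<in> U" using syz[OF prod(2)] U by blast
    ultimately have "g (?single (i \<otimes>\<^bsub>A\<^esub> j)) = i \<odot>\<^bsub>T\<^esub> g (?single j)" "g (?single j) \<in> carrier T"
      using g ij by (auto simp: free_hom_space_carrier)
    then have "g (?single (i \<otimes>\<^bsub>A\<^esub> j)) = \<zero>\<^bsub>T\<^esub>"
      using jacobson_radical_annihilates_simple[OF simple(2) prod(1)] by simp
    moreover have "i \<otimes>\<^bsub>A\<^esub> j \<in> radical_square A"
      unfolding radical_square_def using prod by (rule ideal_prod.prod)
    ultimately show ?case using S.A.radical_square_subset by blast
  next
    case (sum x y)
    then have "x \<in> carrier A" "y \<in> carrier A" by (auto intro: S.A.jacobson_radical_closed)
    then have "?single (x \<oplus>\<^bsub>A\<^esub> y) = (\<lambda>z. ?single x z \<oplus>\<^bsub>A\<^esub> ?single y z)" by auto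
    moreover have "?single x \<in> U" "?single y \<in> U" using syz sum U by blast+
    ultimately have "g (?single (x \<oplus>\<^bsub>A\<^esub> y)) = g (?single x) \<oplus>\<^bsub>T\<^esub> g (?single y)"
      using g by (simp add: free_hom_space_carrier)
    moreover have "x \<oplus>\<^bsub>A\<^esub> y \<in> radical_square A"
      unfolding radical_square_def using sum by (intro ideal_prod.sum)
    ultimately show ?case using sum S.A.radical_square_subset by auto
  qed
  then show "g (?single r) = \<zero>\<^bsub>T\<^esub>" by simp
qed

text \<open>One basis element is split off at a time. Membership in the syzygies is proved along the
  way, because additivity of \<open>g\<close> can be applied only inside \<open>U\<close>.\<close>

lemma hom_radical_square:
  assumes g: "g \<in> carrier (free_hom_space A (carrier S) U T)" and U: "syzygies A S \<subseteq> U"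
    and f: "f \<in> S.F" "\<And>x. f x \<in> radical_square A"
  shows "g f = \<zero>\<^bsub>T\<^esub>"
proof -
  have "f \<in> syzygies A S \<and> g f = \<zero>\<^bsub>T\<^esub>"
    if "finite X" "X \<subseteq> carrier S" "{x. f x \<noteq> \<zero>\<^bsub>A\<^esub>} \<subseteq> X" "\<And>x. f x \<in> radical_square A" for X f
    using that
  proof (induction X arbitrary: f)
    case empty
    then have f: "f = (\<lambda>x. \<zero>\<^bsub>A\<^esub>)" by auto
    have z: "(\<lambda>x. \<zero>\<^bsub>A\<^esub>) \<in> syzygies A S"
      by (simp add: syzygies_iff free_module_carrier evaluation_def)
    then have "g (\<lambda>x. \<zero>\<^bsub>A\<^esub>) = \<zero>\<^bsub>T\<^esub>"
      using free_hom_smult[OF g S.A.zero_closed subsetD[OF U z]] free_hom_closed[OF g subsetD[OF U z]]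
      by (simp add: T.S.lsmult_zero_left)
    then show ?case using z by (simp add: f)
  next
    case (insert s X)
    let ?f1 = "\<lambda>x. if x = s then f s else \<zero>\<^bsub>A\<^esub>" and ?f2 = "\<lambda>x. if x = s then \<zero>\<^bsub>A\<^esub> else f x"
    have cl: "f x \<in> carrier A" for x
      using insert.prems(3) S.A.radical_square_subset S.A.jacobson_radical_closed by blast
    have "\<zero>\<^bsub>A\<^esub> \<in> radical_square A" using S.A.radical_square_left_ideal[unfolded S.A.left_ideal_iff] by blast
    then have 2: "?f2 \<in> syzygies A S \<and> g ?f2 = \<zero>\<^bsub>T\<^esub>"
      using insert.prems by (intro insert.IH) auto
    have 1: "?f1 \<in> syzygies A S" "g ?f1 = \<zero>\<^bsub>T\<^esub>"
      using insert.prems by (auto intro!: hom_radical_square_single[OF g U])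
    have eq: "f = (\<lambda>x. ?f1 x \<oplus>\<^bsub>A\<^esub> ?f2 x)" using cl by auto
    have "(\<lambda>x. ?f1 x \<oplus>\<^bsub>A\<^esub> ?f2 x) \<in> syzygies A S" using 1 2 by (intro S.S.syzygies_add_closed) auto
    moreover have "g (\<lambda>x. ?f1 x \<oplus>\<^bsub>A\<^esub> ?f2 x) = g ?f1 \<oplus>\<^bsub>T\<^esub> g ?f2"
      using 1 2 U by (intro free_hom_add[OF g]) auto
    ultimately show ?case using 1 2 eq by simp
  qed
  from this[of "{x. f x \<noteq> \<zero>\<^bsub>A\<^esub>}" f] show ?thesis using f by (auto simp: free_module_carrier)
qed

text \<open>The values of \<open>f - h\<close> lie in the kernel of \<open>\<phi>\<close>, hence in
  the square of the radical, so \<open>g\<close> annihilates the difference. This is what lets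
  \<open>g\<close> descend along \<open>push\<close>.\<close>

lemma push_eq_imp_hom_eq:
  assumes g: "g \<in> carrier (free_hom_space A (carrier S) U T)" and U: "syzygies A S \<subseteq> U" "U \<subseteq> S.F"
    and U_closed: "\<And>f h. \<lbrakk>f \<in> U; h \<in> U\<rbrakk> \<Longrightarrow> (\<lambda>x. f x \<oplus>\<^bsub>A\<^esub> h x) \<in> U"
      "\<And>a f. \<lbrakk>a \<in> carrier A; f \<in> U\<rbrakk> \<Longrightarrow> (\<lambda>x. a \<otimes>\<^bsub>A\<^esub> f x) \<in> U"
    and fh: "f \<in> U" "h \<in> U" "S.push f = S.push h"
  shows "g f = g h"
proof -
  \<comment> \<open>Subtraction is expressed with the scalar -1, because \<open>U\<close> is given
    as closed under addition and multiplication by ring elements.\<close>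
  let ?m = "\<ominus>\<^bsub>A\<^esub> \<one>\<^bsub>A\<^esub>"
  let ?mh = "\<lambda>x. ?m \<otimes>\<^bsub>A\<^esub> h x"
  let ?d = "\<lambda>x. f x \<oplus>\<^bsub>A\<^esub> ?mh x"
  have mh: "?mh \<in> U" using fh U_closed(2) by simp
  have d: "?d \<in> U" using U_closed(1)[OF fh(1) mh] .
  have cl: "f x \<in> carrier A" "h x \<in> carrier A" for x
    using fh U by (auto simp: free_module_carrier)
  have "?d x \<in> radical_square A" for x
  proof (cases "x \<in> carrier S")
    case True
    then obtain y where y: "y \<in> carrier S'" "x = \<sigma> y" using S.iso_bij(2) by blast
    then have eq: "\<phi> (f x) = \<phi> (h x)" using fh(3) by (metis S.push_def)
    have "\<phi> (?d x) = \<phi> (f x) \<oplus>\<^bsub>B\<^esub> \<phi> ?m \<otimes>\<^bsub>B\<^esub> \<phi> (f x)"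
      using cl by (simp add: S.hom_simps eq)
    also have "\<dots> = (\<phi> \<one>\<^bsub>A\<^esub> \<oplus>\<^bsub>B\<^esub> \<phi> ?m) \<otimes>\<^bsub>B\<^esub> \<phi> (f x)"
      using cl by (simp add: S.hom_simps S.B.l_distr)
    also have "\<phi> \<one>\<^bsub>A\<^esub> \<oplus>\<^bsub>B\<^esub> \<phi> ?m = \<zero>\<^bsub>B\<^esub>"
      by (simp add: S.hom_simps(2)[symmetric] S.A.r_neg S.hom_simps(6))
    finally have "\<phi> (?d x) = \<zero>\<^bsub>B\<^esub>" using cl by (simp add: S.hom_simps)
    then have "?d x \<in> a_kernel A B \<phi>" using cl by (simp add: a_kernel_def kernel_def)
    then show ?thesis using kernel by blast
  next
    case False
    \<comment> \<open>\<open>push\<close> sees the values on \<open>carrier S\<close> only;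
      elsewhere both functions vanish.\<close>
    then have "f x = \<zero>\<^bsub>A\<^esub>" "h x = \<zero>\<^bsub>A\<^esub>"
      using subsetD[OF U(2) fh(1)] subsetD[OF U(2) fh(2)] unfolding free_module_carrier by (blast, blast)
    then show ?thesis
      using S.A.radical_square_left_ideal[unfolded S.A.left_ideal_iff] by simp
  qed
  then have "g ?d = \<zero>\<^bsub>T\<^esub>" using d U by (intro hom_radical_square[OF g U(1)]) auto
  moreover have "g ?d = g f \<oplus>\<^bsub>T\<^esub> ?m \<odot>\<^bsub>T\<^esub> g h"
    using fh mh by (simp add: free_hom_add[OF g] free_hom_smult[OF g])
  moreover have "g f \<in> carrier T" "g h \<in> carrier T" using g fh by (auto simp: free_hom_space_carrier)
  ultimately have "g f \<oplus>\<^bsub>T\<^esub> \<ominus>\<^bsub>T\<^esub> g h = \<zero>\<^bsub>T\<^esub>" and cl: "g f \<in> carrier T" "g h \<in> carrier T"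
    by (simp_all add: T.S.lsmult_minus_left T.S.lsmult_one)
  then have "\<ominus>\<^bsub>T\<^esub> (\<ominus>\<^bsub>T\<^esub> g h) = g f" by (intro T.S.M.minus_equality) simp_all
  then show ?thesis using cl by simp
qed

definition transport :: "('s \<Rightarrow> 'a) set \<Rightarrow> (('s1 \<Rightarrow> 'b) \<Rightarrow> 't1) \<Rightarrow> ('s \<Rightarrow> 'a) \<Rightarrow> 't" where
  "transport U g = (\<lambda>f\<in>U. \<tau> (g (S.push f)))"

text \<open>Injective because \<open>push\<close> maps \<open>U\<close> onto \<open>U'\<close>.
  Surjective because a homomorphism over \<open>A\<close> is constant on the fibres of
  \<open>push\<close>, by \<open>push_eq_imp_hom_eq\<close>, and therefore factors through
  it.\<close>

lemma transport_bij:
  assumes U: "syzygies A S \<subseteq> U" "U \<subseteq> S.F" and U': "U' \<subseteq> S.F'"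
    and UU': "\<And>f. f \<in> S.F \<Longrightarrow> S.push f \<in> U' \<longleftrightarrow> f \<in> U"
    and U_closed: "\<And>f h. \<lbrakk>f \<in> U; h \<in> U\<rbrakk> \<Longrightarrow> (\<lambda>x. f x \<oplus>\<^bsub>A\<^esub> h x) \<in> U"
      "\<And>a f. \<lbrakk>a \<in> carrier A; f \<in> U\<rbrakk> \<Longrightarrow> (\<lambda>x. a \<otimes>\<^bsub>A\<^esub> f x) \<in> U"
  shows "bij_betw (transport U) (carrier (free_hom_space B (carrier S') U' T'))
      (carrier (free_hom_space A (carrier S) U T))" (is "bij_betw _ (carrier ?H') (carrier ?H)")
    and "transport U \<in> LinearCombinations.module_hom (class_ring :: complex ring)
      (free_hom_space B (carrier S') U' T') (free_hom_space A (carrier S) U T)"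
proof -
  have UF: "f \<in> S.F" if "f \<in> U" for f using that U by blast
  have pU: "S.push f \<in> U'" if "f \<in> U" for f using that UU'[OF UF] by blast
  have lift: "\<exists>f\<in>U. S.push f = f'" if "f' \<in> U'" for f'
    using S.push_surj[of f'] that U' UU' by blast
  have closed: "transport U g \<in> carrier ?H" if g: "g \<in> carrier ?H'" for g
    unfolding free_hom_space_carrier
  proof (intro conjI ballI)
    fix f assume f: "f \<in> U"
    show "transport U g f \<in> carrier T"
      using f pU free_hom_closed[OF g] by (simp add: transport_def T.iso_simps)
    fix h assume h: "h \<in> U"
    show "transport U g (\<lambda>x. f x \<oplus>\<^bsub>A\<^esub> h x) = transport U g f \<oplus>\<^bsub>T\<^esub> transport U g h"
      using f h pU free_hom_closed[OF g] free_hom_add[OF g pU[OF f] pU[OF h]]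
      by (simp add: transport_def U_closed S.push_add UF T.iso_simps)
  next
    fix a f assume a: "a \<in> carrier A" and f: "f \<in> U"
    show "transport U g (\<lambda>x. a \<otimes>\<^bsub>A\<^esub> f x) = a \<odot>\<^bsub>T\<^esub> transport U g f"
      using f a pU free_hom_closed[OF g] free_hom_smult[OF g S.hom_simps(1)[OF a] pU[OF f]]
      by (simp add: transport_def U_closed S.push_smult UF T.iso_simps)
  qed (simp add: transport_def)
  show "transport U \<in> LinearCombinations.module_hom (class_ring :: complex ring) ?H' ?H"
    unfolding LinearCombinations.module_hom_def
  proof (intro CollectI conjI allI impI funcsetI; (elim conjE)?)
    show "transport U g \<in> carrier ?H" if "g \<in> carrier ?H'" for g
      using that by (rule closed)
    show "transport U (g \<oplus>\<^bsub>?H'\<^esub> h) = transport U g \<oplus>\<^bsub>?H\<^esub> transport U h"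
      if "g \<in> carrier ?H'" "h \<in> carrier ?H'" for g h
      using pU free_hom_closed[OF that(1)] free_hom_closed[OF that(2)]
      by (auto simp: transport_def free_hom_space_sel T.iso_simps intro!: restrict_ext)
    show "transport U (c \<odot>\<^bsub>?H'\<^esub> g) = c \<odot>\<^bsub>?H\<^esub> transport U g" if g: "g \<in> carrier ?H'" for c g
    proof -
      have "\<tau> ((c \<odot>\<^bsub>B\<^esub> \<one>\<^bsub>B\<^esub>) \<odot>\<^bsub>T'\<^esub> x) = (c \<odot>\<^bsub>A\<^esub> \<one>\<^bsub>A\<^esub>) \<odot>\<^bsub>T\<^esub> \<tau> x" if "x \<in> carrier T'" for x
        using T.iso_simps(3)[OF S.A.scale_closed[OF S.A.one_closed, of c] that] by (simp add: S.hom_simps)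
      then show ?thesis
        using pU free_hom_closed[OF g]
        by (auto simp: transport_def free_hom_space_sel intro!: restrict_ext)
    qed
  qed
  have inj: "inj_on (transport U) (carrier ?H')"
  proof (rule inj_onI)
    fix g h assume g: "g \<in> carrier ?H'" and h: "h \<in> carrier ?H'" and eq: "transport U g = transport U h"
    show "g = h"
    proof (rule extensionalityI[OF free_hom_extensional[OF g] free_hom_extensional[OF h]])
      fix f' assume f': "f' \<in> U'"
      then obtain f where f: "f \<in> U" "S.push f = f'" using lift by blast
      have "\<tau> (g f') = \<tau> (h f')" using fun_cong[OF eq, of f] f by (simp add: transport_def)
      then show "g f' = h f'"
        using T.iso_bij(1) free_hom_closed[OF g f'] free_hom_closed[OF h f'] by (auto dest: inj_onD)
    qed
  qed
  have "carrier ?H \<subseteq> transport U ` carrier ?H'"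
  proof
    fix g assume g: "g \<in> carrier ?H"
    have "\<exists>l. \<forall>f'\<in>U'. l f' \<in> U \<and> S.push (l f') = f'"
      by (rule bchoice) (use lift in blast)
    then obtain l where l: "\<And>f'. f' \<in> U' \<Longrightarrow> l f' \<in> U \<and> S.push (l f') = f'"
      by blast
    have g_eq: "g f = g h" if "f \<in> U" "h \<in> U" "S.push f = S.push h" for f h
    proof (rule push_eq_imp_hom_eq[OF g U])
      show "(\<lambda>x. f x \<oplus>\<^bsub>A\<^esub> h x) \<in> U" if "f \<in> U" "h \<in> U" for f h
        using that by (rule U_closed(1))
      show "(\<lambda>x. a \<otimes>\<^bsub>A\<^esub> f x) \<in> U" if "a \<in> carrier A" "f \<in> U" for a f
        using that by (rule U_closed(2))
    qed fact+
    let ?\<tau>' = "inv_into (carrier T') \<tau>"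
    \<comment> \<open>By \<open>g_eq\<close> the value does not depend on the preimage picked by
      \<open>l\<close>, which makes \<open>g'\<close> additive and linear over
      \<open>B\<close>.\<close>
    define g' where "g' = (\<lambda>f'\<in>U'. ?\<tau>' (g (l f')))"
    have \<tau>': "?\<tau>' y \<in> carrier T'" "\<tau> (?\<tau>' y) = y" if "y \<in> carrier T" for y
      using that T.iso_bij(2) by (auto simp: inv_into_into f_inv_into_f)
    have g': "g' (S.push f) \<in> carrier T'" "\<tau> (g' (S.push f)) = g f" if f: "f \<in> U" for f
    proof -
      have "g (l (S.push f)) = g f" using l[OF pU[OF f]] f by (intro g_eq) auto
      then have "g' (S.push f) = ?\<tau>' (g f)" using pU[OF f] by (simp add: g'_def)
      then show "g' (S.push f) \<in> carrier T'" "\<tau> (g' (S.push f)) = g f"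
        using \<tau>' free_hom_closed[OF g f] by auto
    qed
    have \<tau>_inj: "x = y" if "x \<in> carrier T'" "y \<in> carrier T'" "\<tau> x = \<tau> y" for x y
      using that T.iso_bij(1) by (auto dest: inj_onD)
    have "g' \<in> carrier ?H'"
      unfolding free_hom_space_carrier
    proof (intro conjI ballI)
      fix f' assume "f' \<in> U'"
      then obtain f where f: "f \<in> U" "f' = S.push f" using lift by blast
      show "g' f' \<in> carrier T'" using f g' by simp
      fix h' assume "h' \<in> U'"
      then obtain h where h: "h \<in> U" "h' = S.push h" using lift by blast
      have "\<tau> (g' (S.push (\<lambda>x. f x \<oplus>\<^bsub>A\<^esub> h x))) = \<tau> (g' f' \<oplus>\<^bsub>T'\<^esub> g' h')"
        using f h by (simp add: g' U_closed T.iso_simps free_hom_add[OF g])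
      then have "g' (S.push (\<lambda>x. f x \<oplus>\<^bsub>A\<^esub> h x)) = g' f' \<oplus>\<^bsub>T'\<^esub> g' h'"
        using f h g' U_closed by (intro \<tau>_inj) auto
      then show "g' (\<lambda>x. f' x \<oplus>\<^bsub>B\<^esub> h' x) = g' f' \<oplus>\<^bsub>T'\<^esub> g' h'"
        using f h by (simp add: S.push_add UF)
    next
      fix b f' assume "b \<in> carrier B" "f' \<in> U'"
      then obtain a f where a: "a \<in> carrier A" "b = \<phi> a" and f: "f \<in> U" "f' = S.push f"
        using lift S.surj by blast
      have "\<tau> (g' (S.push (\<lambda>x. a \<otimes>\<^bsub>A\<^esub> f x))) = \<tau> (b \<odot>\<^bsub>T'\<^esub> g' f')"
        using f a by (simp add: g' U_closed T.iso_simps free_hom_smult[OF g])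
      then have "g' (S.push (\<lambda>x. a \<otimes>\<^bsub>A\<^esub> f x)) = b \<odot>\<^bsub>T'\<^esub> g' f'"
        using f a g' U_closed T.S'.lsmult_closed S.hom_simps(1) by (intro \<tau>_inj) auto
      then show "g' (\<lambda>x. b \<otimes>\<^bsub>B\<^esub> f' x) = b \<odot>\<^bsub>T'\<^esub> g' f'"
        using f a by (simp add: S.push_smult UF)
    qed (simp add: g'_def)
    moreover have "transport U g' = g"
      using g' by (intro extensionalityI[OF _ free_hom_extensional[OF g]]) (auto simp: transport_def)
    ultimately show "g \<in> transport U ` carrier ?H'" by blast
  qed
  with inj closed show "bij_betw (transport U) (carrier ?H') (carrier ?H)"
    unfolding bij_betw_def by blast
qed

text \<open>Transport commutes with restriction to the syzygies. Being bijective on the free modules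
  as well, it carries the extendable homomorphisms over \<open>B\<close> onto those over
  \<open>A\<close> and so induces a bijection of the cokernels.\<close>

theorem Ext1_dim_eq: "Ext1_dim A S T = Ext1_dim B S' T'"
proof -
  interpret Q': complex_quotient_space "free_hom_space B (carrier S') (syzygies B S') T'" "boundaries B S' T'"
    by (rule Ext1_quotient_space) unfold_locales
  have Q: "complex_quotient_space (free_hom_space A (carrier S) (syzygies A S) T) (boundaries A S T)"
    by (rule Ext1_quotient_space) unfold_locales
  have sub: "syzygies A S \<subseteq> S.F" "syzygies B S' \<subseteq> S.F'" by (auto simp: syzygies_iff)
  have bij_F: "bij_betw (transport S.F) (carrier (free_hom_space B (carrier S') S.F' T'))
      (carrier (free_hom_space A (carrier S) S.F T))"
    using sub S.push_closed
    by (intro transport_bij) (auto intro: S.A.free_module_add_closed S.A.free_module_smult_closed)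
  have bij: "bij_betw (transport (syzygies A S)) (carrier (free_hom_space B (carrier S') (syzygies B S') T'))
      (carrier (free_hom_space A (carrier S) (syzygies A S) T))"
    and hom: "transport (syzygies A S) \<in> LinearCombinations.module_hom (class_ring :: complex ring)
      (free_hom_space B (carrier S') (syzygies B S') T') (free_hom_space A (carrier S) (syzygies A S) T)"
    using sub S.push_syzygies
    by (intro transport_bij; auto intro: S.S.syzygies_add_closed S.S.syzygies_smult_closed)+
  have "transport (syzygies A S) (restrict g (syzygies B S')) = restrict (transport S.F g) (syzygies A S)" for g
    using sub S.push_syzygies by (auto simp: transport_def fun_eq_iff)
  then have "transport (syzygies A S) ` boundaries B S' T'
      = (\<lambda>g. restrict g (syzygies A S)) ` transport S.F ` carrier (free_hom_space B (carrier S') S.F' T')"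
    unfolding boundaries_def by (simp add: image_image)
  also have "\<dots> = boundaries A S T"
    using bij_F by (simp add: boundaries_def bij_betw_def)
  finally show ?thesis
    using Q'.quotient_space_dim_eq[OF Q hom bij] by (simp add: Ext1_dim_def Ext1_eq)
qed

end

section \<open>Isomorphism of the quivers\<close>

text \<open>Brings isomorphisms over one algebra into the semilinear calculus. The modules change
  order because a \<open>semilinear_iso\<close> maps its second module to its first.\<close>

lemma module_isomorphic_iff: "module_isomorphic A M N \<longleftrightarrow> (\<exists>f. semilinear_iso A (\<lambda>a. a) N M f)"
proof -
  have "f \<in> LinearCombinations.module_hom A M N \<and> bij_betw f (carrier M) (carrier N)
      \<longleftrightarrow> semilinear_iso A (\<lambda>a. a) N M f" for f
    by (auto simp: semilinear_iso_def LinearCombinations.module_hom_def bij_betw_def)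
  then show ?thesis by (simp add: module_isomorphic_def Bex_def)
qed

lemma semilinear_iso_refl: "semilinear_iso A (\<lambda>a. a) M M (\<lambda>x. x)"
  by (simp add: semilinear_iso_def bij_betw_def)

lemma semilinear_iso_comp:
  assumes \<sigma>: "semilinear_iso A \<phi> N M \<sigma>" and \<rho>: "semilinear_iso B \<psi> M L \<rho>"
    and \<phi>: "\<And>a. a \<in> carrier A \<Longrightarrow> \<phi> a \<in> carrier B"
  shows "semilinear_iso A (\<lambda>a. \<psi> (\<phi> a)) N L (\<lambda>x. \<sigma> (\<rho> x))"
proof -
  have "bij_betw (\<lambda>x. \<sigma> (\<rho> x)) (carrier L) (carrier N)"
    using bij_betw_trans[of \<rho> "carrier L" "carrier M" \<sigma> "carrier N"] \<sigma> \<rho>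
    by (simp add: semilinear_iso_def comp_def)
  moreover have "\<rho> x \<in> carrier M" if "x \<in> carrier L" for x
    using \<rho> that bij_betwE unfolding semilinear_iso_def by blast
  ultimately show ?thesis using \<sigma> \<rho> \<phi> unfolding semilinear_iso_def by simp
qed

text \<open>Divides a map over \<open>\<psi>\<close> after \<open>\<phi>\<close> by a map over
  \<open>\<phi>\<close>. Linearity over \<open>B\<close> holds because every scalar of
  \<open>B\<close> comes from \<open>A\<close>.\<close>

lemma semilinear_iso_cancel:
  assumes \<tau>: "semilinear_iso A \<phi> N M \<tau>" and \<rho>: "semilinear_iso A (\<lambda>a. \<psi> (\<phi> a)) N L \<rho>"
    and M: "left_module B M" and \<phi>: "\<phi> ` carrier A = carrier B"
  shows "semilinear_iso B \<psi> M L (\<lambda>x. inv_into (carrier M) \<tau> (\<rho> x))"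
proof -
  interpret M: left_module B M by (rule M)
  let ?\<tau>' = "inv_into (carrier M) \<tau>"
  have bij: "bij_betw \<tau> (carrier M) (carrier N)" "bij_betw \<rho> (carrier L) (carrier N)"
    using \<tau> \<rho> by (auto simp: semilinear_iso_def)
  have inv_eq: "?\<tau>' y = x" if "x \<in> carrier M" "y = \<tau> x" for x y
    using that bij by (simp add: bij_betw_def)
  have \<rho>_closed: "\<rho> x \<in> carrier N" if "x \<in> carrier L" for x using that bij by (auto simp: bij_betw_def)
  have cl: "?\<tau>' (\<rho> x) \<in> carrier M" "\<tau> (?\<tau>' (\<rho> x)) = \<rho> x" if "x \<in> carrier L" for x
    using \<rho>_closed[OF that] bij(1) by (auto simp: bij_betw_def inv_into_into f_inv_into_f)
  show ?thesis
    unfolding semilinear_iso_def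
  proof (intro conjI ballI)
    show "bij_betw (\<lambda>x. ?\<tau>' (\<rho> x)) (carrier L) (carrier M)"
      using bij_betw_trans[OF bij(2) bij_betw_inv_into[OF bij(1)]] by (simp add: comp_def)
  next
    fix x y assume xy: "x \<in> carrier L" "y \<in> carrier L"
    show "?\<tau>' (\<rho> (x \<oplus>\<^bsub>L\<^esub> y)) = ?\<tau>' (\<rho> x) \<oplus>\<^bsub>M\<^esub> ?\<tau>' (\<rho> y)"
      using xy cl \<tau> \<rho> by (intro inv_eq) (simp_all add: semilinear_iso_def)
  next
    fix b x assume b: "b \<in> carrier B" and x: "x \<in> carrier L"
    then obtain a where a: "a \<in> carrier A" "b = \<phi> a" using \<phi> by blast
    show "?\<tau>' (\<rho> (\<psi> b \<odot>\<^bsub>L\<^esub> x)) = b \<odot>\<^bsub>M\<^esub> ?\<tau>' (\<rho> x)"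
      using a x b cl \<tau> \<rho> by (intro inv_eq) (simp_all add: semilinear_iso_def M.lsmult_closed)
  qed
qed

lemma semilinear_iso_inverse:
  assumes f: "semilinear_iso A (\<lambda>a. a) N M f" and M: "left_module A M"
  shows "semilinear_iso A (\<lambda>a. a) M N (inv_into (carrier M) f)"
proof -
  show ?thesis using semilinear_iso_cancel[OF f semilinear_iso_refl M] by simp
qed

lemma equiv_simple_iso:
  fixes A :: "('a, 'e) ring_scheme"
  shows "equiv {M :: ('a, 'c, 'd) module_scheme. simple_module A M}
    {(M, N). simple_module A M \<and> simple_module A N \<and> module_isomorphic A M N}"
proof -
  have 1: "module_isomorphic A M M" for M :: "('a, 'c, 'd) module_scheme"
    unfolding module_isomorphic_iff by (rule exI) (rule semilinear_iso_refl)
  have 2: "module_isomorphic A N M"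
    if M: "simple_module A M" and MN: "module_isomorphic A M N"
    for M N :: "('a, 'c, 'd) module_scheme"
  proof -
    obtain f where f: "semilinear_iso A (\<lambda>a. a) N M f"
      using MN unfolding module_isomorphic_iff by blast
    have "left_module A M" using M by (simp add: simple_module_def)
    from semilinear_iso_inverse[OF f this] show ?thesis
      unfolding module_isomorphic_iff by (intro exI)
  qed
  have 3: "module_isomorphic A M L"
    if MN: "module_isomorphic A M N" and NL: "module_isomorphic A N L"
    for L M N :: "('a, 'c, 'd) module_scheme"
  proof -
    obtain f g where "semilinear_iso A (\<lambda>a. a) N M f" "semilinear_iso A (\<lambda>a. a) L N g"
      using MN NL unfolding module_isomorphic_iff by blast
    then show ?thesis using semilinear_iso_comp[of A "\<lambda>a. a" L N g A "\<lambda>a. a" M f]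
      unfolding module_isomorphic_iff by auto
  qed
  show ?thesis
    by (intro equivI refl_onI symI transI) (blast, use 1 in simp, use 2 in simp, use 3 in blast)
qed

text \<open>A relation in place of a function avoids choosing partners: as \<open>D\<close>
  preserves and reflects the equivalences, it takes the class of \<open>x\<close> to the class of
  any partner of \<open>x\<close>.\<close>

lemma quotient_correspondence:
  assumes E: "equiv X r" "equiv Y s"
    and D: "\<And>x y. (x, y) \<in> D \<Longrightarrow> x \<in> X \<and> y \<in> Y"
    and total: "\<And>x. x \<in> X \<Longrightarrow> \<exists>y. (x, y) \<in> D" and surj: "\<And>y. y \<in> Y \<Longrightarrow> \<exists>x. (x, y) \<in> D"
    and rs: "\<And>x y x' y'. \<lbrakk>(x, y) \<in> D; (x', y') \<in> D\<rbrakk> \<Longrightarrow> (x, x') \<in> r \<longleftrightarrow> (y, y') \<in> s"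
  shows "bij_betw ((``) D) (X // r) (Y // s)"
proof -
  have image: "D `` (r `` {x}) = s `` {y}" if xy: "(x, y) \<in> D" for x y
  proof (intro equalityI subsetI)
    fix y' assume "y' \<in> s `` {y}"
    moreover from this obtain x' where "(x', y') \<in> D"
      using surj E(2) by (metis Image_singleton_iff equiv_class_eq_iff)
    ultimately show "y' \<in> D `` (r `` {x})" using rs[OF xy] by blast
  qed (use rs[OF xy] in blast)
  have "inj_on ((``) D) (X // r)"
  proof (rule inj_onI)
    fix P Q assume "P \<in> X // r" "Q \<in> X // r" and eq: "D `` P = D `` Q"
    then obtain p q where p: "p \<in> X" "P = r `` {p}" and q: "q \<in> X" "Q = r `` {q}"
      by (auto elim!: quotientE)
    obtain p' q' where D': "(p, p') \<in> D" "(q, q') \<in> D" using total p q by blast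
    then have "s `` {p'} = s `` {q'}" using eq p q image by simp
    then have "(p', q') \<in> s" using D[OF D'(2)] by (metis E(2) eq_equiv_class)
    then show "P = Q" using rs[OF D'] p q E(1) by (metis equiv_class_eq)
  qed
  moreover have "(``) D ` (X // r) = Y // s"
  proof (intro equalityI subsetI)
    fix Z assume "Z \<in> (``) D ` (X // r)"
    then obtain x where x: "x \<in> X" "Z = D `` (r `` {x})" by (auto elim!: quotientE)
    then obtain y where "(x, y) \<in> D" using total by blast
    then show "Z \<in> Y // s" using x image D by (metis quotientI)
  next
    fix Z assume "Z \<in> Y // s"
    then obtain y where y: "y \<in> Y" "Z = s `` {y}" by (auto elim!: quotientE)
    then obtain x where xy: "(x, y) \<in> D" using surj by blast
    then have "Z = D `` (r `` {x})" "r `` {x} \<in> X // r" using y image D by (auto intro: quotientI)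
    then show "Z \<in> (``) D ` (X // r)" by blast
  qed
  ultimately show ?thesis by (simp add: bij_betw_def)
qed

lemma abelian_group_smult_update: "abelian_group M \<Longrightarrow> abelian_group (M\<lparr>smult := s\<rparr>)"
  by (simp add: abelian_group_def abelian_monoid_def abelian_group_axioms_def)

section \<open>Matching simple modules and quivers of the two algebras\<close>

locale radical_square_extension = A?: complex_algebra A + B?: complex_algebra B
  for A :: "(complex, 'a, 'e) module_scheme" and B :: "(complex, 'a, 'f) module_scheme" +
  fixes \<phi> :: "'a \<Rightarrow> 'a"
  assumes alg_hom: "\<phi> \<in> alg_hom A B" and surj: "\<phi> ` carrier A = carrier B"
    and kernel: "a_kernel A B \<phi> \<subseteq> radical_square A"
begin

lemma ring_hom: "\<phi> \<in> Ring.ring_hom A B"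
  using alg_hom by (simp add: alg_hom_def)

lemma hom_closed: "a \<in> carrier A \<Longrightarrow> \<phi> a \<in> carrier B"
  using surj by blast

text \<open>The kernel lies in the radical, which annihilates simple modules; so the action of
  \<open>A\<close> on \<open>N\<close> factors through \<open>\<phi>\<close>.\<close>

lemma simple_kernel:
  assumes N: "simple_module A N" and a: "a \<in> carrier A" "a' \<in> carrier A" "\<phi> a = \<phi> a'"
    and x: "x \<in> carrier N"
  shows "a \<odot>\<^bsub>N\<^esub> x = a' \<odot>\<^bsub>N\<^esub> x"
proof -
  interpret N: left_module A N using N by (simp add: simple_module_def)
  have "\<phi> ((a \<ominus>\<^bsub>A\<^esub> a') \<oplus>\<^bsub>A\<^esub> a') = \<phi> (a \<ominus>\<^bsub>A\<^esub> a') \<oplus>\<^bsub>B\<^esub> \<phi> a'"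
    using a by (intro ring_hom_add[OF ring_hom]) auto
  moreover have "(a \<ominus>\<^bsub>A\<^esub> a') \<oplus>\<^bsub>A\<^esub> a' = a"
    using a by (simp add: a_minus_def A.a_assoc A.l_neg)
  ultimately have "\<phi> (a \<ominus>\<^bsub>A\<^esub> a') = \<zero>\<^bsub>B\<^esub>"
    using a hom_closed[of "a \<ominus>\<^bsub>A\<^esub> a'"] hom_closed[OF a(2)] by (simp add: B.add.r_cancel_one)
  then have "a \<ominus>\<^bsub>A\<^esub> a' \<in> jacobson_radical A"
    using kernel A.radical_square_subset a by (auto simp: a_kernel_def kernel_def)
  then have "(a \<ominus>\<^bsub>A\<^esub> a') \<odot>\<^bsub>N\<^esub> x = \<zero>\<^bsub>N\<^esub>"
    using N x by (intro jacobson_radical_annihilates_simple)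
  then have "((a \<ominus>\<^bsub>A\<^esub> a') \<oplus>\<^bsub>A\<^esub> a') \<odot>\<^bsub>N\<^esub> x = a' \<odot>\<^bsub>N\<^esub> x"
    using a x by (simp add: N.lsmult_l_distr N.lsmult_closed)
  then show ?thesis using \<open>(a \<ominus>\<^bsub>A\<^esub> a') \<oplus>\<^bsub>A\<^esub> a' = a\<close> by simp
qed

text \<open>As \<open>\<phi>\<close> is onto, stability under \<open>A\<close> and stability under
  \<open>B\<close> are the same condition on a subset.\<close>

lemma simple_iff_same_action:
  assumes N: "left_module A N" and M: "left_module B M"
    and eq: "carrier M = carrier N" "\<zero>\<^bsub>M\<^esub> = \<zero>\<^bsub>N\<^esub>" "\<And>x y. x \<oplus>\<^bsub>M\<^esub> y = x \<oplus>\<^bsub>N\<^esub> y"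
      "\<And>a x. \<lbrakk>a \<in> carrier A; x \<in> carrier N\<rbrakk> \<Longrightarrow> \<phi> a \<odot>\<^bsub>M\<^esub> x = a \<odot>\<^bsub>N\<^esub> x"
  shows "simple_module A N \<longleftrightarrow> simple_module B M"
proof -
  have "Module.submodule H A N \<longleftrightarrow> Module.submodule H B M" for H
    unfolding left_module.submodule_iff[OF N] left_module.submodule_iff[OF M] surj[symmetric]
    using eq by (auto simp: subset_iff)
  then show ?thesis using N M eq by (simp add: simple_module_def)
qed

definition related :: "(('a, 'a set) module \<times> ('a, 'a set) module) set" where
  "related = {(N, M). simple_module A N \<and> simple_module B M \<and> (\<exists>\<sigma>. semilinear_iso A \<phi> N M \<sigma>)}"

text \<open>\<open>N\<close> keeps its additive group, and \<open>b\<close> acts through an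
  arbitrary preimage \<open>l b\<close>; by \<open>simple_kernel\<close> the action does not depend
  on that preimage, which yields the module axioms over \<open>B\<close>.\<close>

lemma related_total:
  assumes N: "simple_module A N"
  shows "\<exists>M. (N, M) \<in> related"
proof -
  interpret N: left_module A N using N by (simp add: simple_module_def)
  define l where "l b = (SOME a. a \<in> carrier A \<and> \<phi> a = b)" for b
  have l: "l b \<in> carrier A" "\<phi> (l b) = b" if "b \<in> carrier B" for b
  proof -
    have "\<exists>a. a \<in> carrier A \<and> \<phi> a = b" using that unfolding surj[symmetric] by blast
    then have "l b \<in> carrier A \<and> \<phi> (l b) = b" unfolding l_def by (rule someI_ex)
    then show "l b \<in> carrier A" "\<phi> (l b) = b" by auto
  qed
  define M where "M = N\<lparr>smult := \<lambda>b x. l b \<odot>\<^bsub>N\<^esub> x\<rparr>"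
  have M: "carrier M = carrier N" "\<zero>\<^bsub>M\<^esub> = \<zero>\<^bsub>N\<^esub>" "x \<oplus>\<^bsub>M\<^esub> y = x \<oplus>\<^bsub>N\<^esub> y" for x y
    by (simp_all add: M_def)
  have act: "\<phi> a \<odot>\<^bsub>M\<^esub> x = a \<odot>\<^bsub>N\<^esub> x" if "a \<in> carrier A" "x \<in> carrier N" for a x
    using that l[OF hom_closed[OF that(1)]] by (simp add: M_def) (rule simple_kernel[OF N])
  have B_mod: "left_module B M"
  proof (intro left_module.intro B.ring_axioms left_module_axioms.intro)
    show "abelian_group M" unfolding M_def by (intro abelian_group_smult_update N.M.abelian_group_axioms)
  next
    fix a b x y assume ab: "a \<in> carrier B" "b \<in> carrier B" and x: "x \<in> carrier M"
    then obtain a' b' where a': "a' \<in> carrier A" "a = \<phi> a'" "b' \<in> carrier A" "b = \<phi> b'"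
      unfolding surj[symmetric] by blast
    have "\<phi> (a' \<oplus>\<^bsub>A\<^esub> b') = a \<oplus>\<^bsub>B\<^esub> b" "\<phi> (a' \<otimes>\<^bsub>A\<^esub> b') = a \<otimes>\<^bsub>B\<^esub> b"
      using a' ring_hom_add[OF ring_hom] ring_hom_mult[OF ring_hom] by simp_all
    then show "(a \<oplus>\<^bsub>B\<^esub> b) \<odot>\<^bsub>M\<^esub> x = a \<odot>\<^bsub>M\<^esub> x \<oplus>\<^bsub>M\<^esub> b \<odot>\<^bsub>M\<^esub> x"
      "(a \<otimes>\<^bsub>B\<^esub> b) \<odot>\<^bsub>M\<^esub> x = a \<odot>\<^bsub>M\<^esub> (b \<odot>\<^bsub>M\<^esub> x)"
      using act[of "a' \<oplus>\<^bsub>A\<^esub> b'" x] act[of "a' \<otimes>\<^bsub>A\<^esub> b'" x] act[of a' x] act[of b' x]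
        act[of a' "b' \<odot>\<^bsub>N\<^esub> x"] a' x
      by (simp_all add: M N.lsmult_l_distr N.lsmult_assoc N.lsmult_closed)
  next
    fix a x assume a: "a \<in> carrier B" and x: "x \<in> carrier M"
    then obtain a' where a': "a' \<in> carrier A" "a = \<phi> a'" using surj by blast
    show "a \<odot>\<^bsub>M\<^esub> x \<in> carrier M" using a' x act by (simp add: M N.lsmult_closed)
    fix y assume y: "y \<in> carrier M"
    show "a \<odot>\<^bsub>M\<^esub> (x \<oplus>\<^bsub>M\<^esub> y) = a \<odot>\<^bsub>M\<^esub> x \<oplus>\<^bsub>M\<^esub> a \<odot>\<^bsub>M\<^esub> y"
      using a' x y act by (simp add: M N.lsmult_r_distr)
  next
    fix x assume x: "x \<in> carrier M"
    show "\<one>\<^bsub>B\<^esub> \<odot>\<^bsub>M\<^esub> x = x"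
      using act[of "\<one>\<^bsub>A\<^esub>" x] x by (simp add: M ring_hom_one[OF ring_hom] N.lsmult_one)
  qed
  have "simple_module B M"
    using simple_iff_same_action[OF N.left_module_axioms B_mod M act] N by simp
  moreover have "semilinear_iso A \<phi> N M (\<lambda>x. x)"
    unfolding semilinear_iso_def using act by (simp add: M bij_betw_def)
  ultimately show ?thesis using N unfolding related_def by blast
qed

text \<open>Restriction of scalars along \<open>\<phi>\<close> on the same additive group.\<close>

lemma related_surj:
  assumes M: "simple_module B M"
  shows "\<exists>N. (N, M) \<in> related"
proof -
  interpret M: left_module B M using M by (simp add: simple_module_def)
  define N where "N = M\<lparr>smult := \<lambda>a x. \<phi> a \<odot>\<^bsub>M\<^esub> x\<rparr>"
  have N: "carrier M = carrier N" "\<zero>\<^bsub>M\<^esub> = \<zero>\<^bsub>N\<^esub>" "x \<oplus>\<^bsub>M\<^esub> y = x \<oplus>\<^bsub>N\<^esub> y" "\<phi> a \<odot>\<^bsub>M\<^esub> x = a \<odot>\<^bsub>N\<^esub> x"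
    for a x y
    by (simp_all add: N_def)
  have A_mod: "left_module A N"
  proof (intro left_module.intro A.ring_axioms left_module_axioms.intro)
    show "abelian_group N" unfolding N_def by (intro abelian_group_smult_update M.M.abelian_group_axioms)
  qed (simp_all add: N[symmetric] hom_closed ring_hom_add[OF ring_hom] ring_hom_mult[OF ring_hom]
      ring_hom_one[OF ring_hom] M.lsmult_closed M.lsmult_l_distr M.lsmult_r_distr M.lsmult_assoc M.lsmult_one)
  have "simple_module A N"
    using simple_iff_same_action[OF A_mod M.left_module_axioms N] M by simp
  moreover have "semilinear_iso A \<phi> N M (\<lambda>x. x)"
    unfolding semilinear_iso_def by (simp add: N bij_betw_def)
  ultimately show ?thesis using M unfolding related_def by blast
qed

lemma related_isomorphic_iff:
  assumes "(N, M) \<in> related" "(N', M') \<in> related"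
  shows "module_isomorphic A N N' \<longleftrightarrow> module_isomorphic B M M'"
proof -
  obtain \<sigma> \<tau> where \<sigma>: "semilinear_iso A \<phi> N M \<sigma>" and \<tau>: "semilinear_iso A \<phi> N' M' \<tau>"
    using assms unfolding related_def by blast
  interpret N: left_module A N using assms by (simp add: related_def simple_module_def)
  interpret M: left_module B M using assms by (simp add: related_def simple_module_def)
  have M': "left_module B M'" using assms by (simp add: related_def simple_module_def)
  show ?thesis
  proof
    assume "module_isomorphic A N N'"
    then obtain f where "semilinear_iso A (\<lambda>a. a) N' N f" by (auto simp: module_isomorphic_iff)
    then have "semilinear_iso A \<phi> N' M (\<lambda>x. f (\<sigma> x))"
      using semilinear_iso_comp[of A "\<lambda>a. a" N' N f A \<phi> M \<sigma>] \<sigma> by simp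
    then have "semilinear_iso B (\<lambda>b. b) M' M (\<lambda>x. inv_into (carrier M') \<tau> (f (\<sigma> x)))"
      using \<tau> M' surj
      by (intro semilinear_iso_cancel) auto
    then show "module_isomorphic B M M'" unfolding module_isomorphic_iff by blast
  next
    assume "module_isomorphic B M M'"
    then obtain h where "semilinear_iso B (\<lambda>b. b) M' M h" by (auto simp: module_isomorphic_iff)
    then have h: "semilinear_iso A \<phi> N' M (\<lambda>x. \<tau> (h x))"
      using semilinear_iso_comp[of A \<phi> N' M' \<tau> B "\<lambda>b. b" M h] \<tau> hom_closed by simp
    have \<sigma>': "bij_betw \<sigma> (carrier M) (carrier N)" using \<sigma> by (simp add: semilinear_iso_def)
    \<comment> \<open>The inverse of \<open>\<sigma>\<close> goes along \<open>\<phi>\<close> and is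
      not of the form \<open>semilinear_iso\<close>, so its additivity and compatibility with
      scalars are recorded by hand.\<close>
    let ?\<sigma>' = "inv_into (carrier M) \<sigma>"
    have inv: "?\<sigma>' y \<in> carrier M" "\<sigma> (?\<sigma>' y) = y" if "y \<in> carrier N" for y
      using that \<sigma>' by (auto simp: bij_betw_def inv_into_into f_inv_into_f)
    have inv_eq: "?\<sigma>' (\<sigma> x) = x" if "x \<in> carrier M" for x
      using that \<sigma>' by (simp add: bij_betw_def)
    have add: "?\<sigma>' (x \<oplus>\<^bsub>N\<^esub> y) = ?\<sigma>' x \<oplus>\<^bsub>M\<^esub> ?\<sigma>' y" if "x \<in> carrier N" "y \<in> carrier N" for x y
      using that inv inv_eq[of "?\<sigma>' x \<oplus>\<^bsub>M\<^esub> ?\<sigma>' y"] \<sigma> by (simp add: semilinear_iso_def)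
    have act: "?\<sigma>' (a \<odot>\<^bsub>N\<^esub> x) = \<phi> a \<odot>\<^bsub>M\<^esub> ?\<sigma>' x" if "a \<in> carrier A" "x \<in> carrier N" for a x
      using that inv inv_eq[of "\<phi> a \<odot>\<^bsub>M\<^esub> ?\<sigma>' x"] \<sigma> hom_closed
      by (simp add: semilinear_iso_def M.lsmult_closed)
    have "bij_betw (\<lambda>x. \<tau> (h (?\<sigma>' x))) (carrier N) (carrier N')"
      using bij_betw_trans[OF bij_betw_inv_into[OF \<sigma>'], of "\<lambda>x. \<tau> (h x)" "carrier N'"] h
      by (simp add: semilinear_iso_def comp_def)
    then have "semilinear_iso A (\<lambda>a. a) N' N (\<lambda>x. \<tau> (h (?\<sigma>' x)))"
      using h inv add act by (simp add: semilinear_iso_def)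
    then show "module_isomorphic A N N'" unfolding module_isomorphic_iff by blast
  qed
qed

lemma related_class_bij: "bij_betw ((``) related) (simple_classes A) (simple_classes B)"
  unfolding simple_classes_def
proof (rule quotient_correspondence[OF equiv_simple_iso equiv_simple_iso])
  show "\<exists>M. (N, M) \<in> related" if "N \<in> {N. simple_module A N}" for N
    using that related_total by blast
  show "\<exists>N. (N, M) \<in> related" if "M \<in> {M. simple_module B M}" for M
    using that related_surj by blast
  show "((N, N') \<in> {(M, N). simple_module A M \<and> simple_module A N \<and> module_isomorphic A M N}) =
      ((M, M') \<in> {(M, N). simple_module B M \<and> simple_module B N \<and> module_isomorphic B M N})"
    if "(N, M) \<in> related" "(N', M') \<in> related" for N M N' M'
    using that related_isomorphic_iff[OF that] by (auto simp: related_def)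
qed (auto simp: related_def)

lemma simple_classes_SOME:
  assumes "X \<in> simple_classes C"
  shows "(SOME S. S \<in> X) \<in> X"
    and "N \<in> X \<Longrightarrow> N' \<in> X \<Longrightarrow> simple_module C N \<and> simple_module C N' \<and> module_isomorphic C N N'"
proof -
  have "X \<noteq> {}" using assms in_quotient_imp_non_empty[OF equiv_simple_iso]
    by (auto simp: simple_classes_def)
  then show "(SOME S. S \<in> X) \<in> X" by (simp add: some_in_eq)
  assume "N \<in> X" "N' \<in> X"
  then show "simple_module C N \<and> simple_module C N' \<and> module_isomorphic C N N'"
    using quotient_eq_iff[OF equiv_simple_iso assms[unfolded simple_classes_def] assms[unfolded simple_classes_def]]
    by blast
qed

text \<open>The quiver is computed from chosen representatives. The one chosen in the image class is
  a partner of some member of \<open>X\<close>, and this member is isomorphic to the one chosen in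
  \<open>X\<close>.\<close>

lemma related_SOME:
  assumes X: "X \<in> simple_classes A"
  shows "((SOME S. S \<in> X), (SOME S. S \<in> related `` X)) \<in> related"
proof -
  have "related `` X \<in> simple_classes B" using related_class_bij X by (auto simp: bij_betw_def)
  then have "(SOME S. S \<in> related `` X) \<in> related `` X" by (rule simple_classes_SOME)
  then obtain N where N: "N \<in> X" "(N, SOME S. S \<in> related `` X) \<in> related" by blast
  then obtain \<sigma> where \<sigma>: "semilinear_iso A \<phi> N (SOME S. S \<in> related `` X) \<sigma>"
    by (auto simp: related_def)
  have "simple_module A (SOME S. S \<in> X)" "module_isomorphic A N (SOME S. S \<in> X)"
    using simple_classes_SOME[OF X] N(1) by blast+
  then obtain f where "semilinear_iso A (\<lambda>a. a) (SOME S. S \<in> X) N f"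
    by (auto simp: module_isomorphic_iff)
  from semilinear_iso_comp[OF this \<sigma>] have "\<exists>\<rho>. semilinear_iso A \<phi> (SOME S. S \<in> X) (SOME S. S \<in> related `` X) \<rho>"
    by auto
  then show ?thesis using N \<open>simple_module A (SOME S. S \<in> X)\<close> by (auto simp: related_def)
qed

lemma related_Ext1_dim:
  assumes S: "(S, S') \<in> related" and T: "(T, T') \<in> related"
  shows "Ext1_dim A S T = Ext1_dim B S' T'"
proof -
  obtain \<sigma> \<tau> where \<sigma>: "semilinear_iso A \<phi> S S' \<sigma>" and \<tau>: "semilinear_iso A \<phi> T T' \<tau>"
    using assms unfolding related_def by blast
  have "left_module A S" "left_module B S'" "left_module A T" "left_module B T'"
    using assms by (auto simp: related_def simple_module_def)
  then interpret ext_comparison A B S S' T T' \<phi> \<sigma> \<tau>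
    using S T alg_hom surj kernel \<sigma> \<tau>
    by (intro ext_comparison.intro semilinear_modules.intro semilinear_modules_axioms.intro
        ext_comparison_axioms.intro A.complex_algebra_axioms B.complex_algebra_axioms)
       (auto simp: related_def)
  show ?thesis by (rule Ext1_dim_eq)
qed

theorem Ext_quiver_iso: "digraph_iso (Ext_quiver A) (Ext_quiver B)"
proof -
  let ?V = "\<lambda>X. related `` X"
  \<comment> \<open>\<open>iso_head\<close> and \<open>iso_tail\<close> are the end point maps of
    the target quiver, hence again projections; the numbering of parallel arrows is kept.\<close>
  let ?f = "\<lparr>iso_verts = ?V, iso_arcs = \<lambda>(X, Y, k). (?V X, ?V Y, k),
    iso_head = \<lambda>(X, Y, k). Y, iso_tail = \<lambda>(X, Y, k). X\<rparr>"
  have V: "inj_on ?V (simple_classes A)" "?V ` simple_classes A = simple_classes B"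
    using related_class_bij by (auto simp: bij_betw_def)
  have dim: "Ext1_dim A (SOME S. S \<in> X) (SOME T. T \<in> Y)
      = Ext1_dim B (SOME S. S \<in> ?V X) (SOME T. T \<in> ?V Y)"
    if "X \<in> simple_classes A" "Y \<in> simple_classes A" for X Y
    using that by (intro related_Ext1_dim related_SOME)
  have "pre_digraph.digraph_isomorphism (Ext_quiver A) ?f"
    unfolding pre_digraph.digraph_isomorphism_def wf_digraph_def
    using V(1) by (auto simp: Ext_quiver_def inj_on_def)
  moreover have "Ext_quiver B = app_iso ?f (Ext_quiver A)"
  proof -
    have "arcs (Ext_quiver B) \<subseteq> (\<lambda>(X, Y, k). (?V X, ?V Y, k)) ` arcs (Ext_quiver A)"
    proof
      fix e assume "e \<in> arcs (Ext_quiver B)"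
      then obtain X' Y' k where e: "e = (X', Y', k)" "X' \<in> simple_classes B" "Y' \<in> simple_classes B"
        "k < Ext1_dim B (SOME S. S \<in> X') (SOME T. T \<in> Y')"
        by (auto simp: Ext_quiver_def)
      then obtain X Y where XY: "X \<in> simple_classes A" "X' = ?V X" "Y \<in> simple_classes A" "Y' = ?V Y"
        unfolding V(2)[symmetric] by blast
      then have "(X, Y, k) \<in> arcs (Ext_quiver A)"
        using e dim by (simp add: Ext_quiver_def)
      then show "e \<in> (\<lambda>(X, Y, k). (?V X, ?V Y, k)) ` arcs (Ext_quiver A)"
        using e XY by force
    qed
    moreover have "(\<lambda>(X, Y, k). (?V X, ?V Y, k)) ` arcs (Ext_quiver A) \<subseteq> arcs (Ext_quiver B)"
      using V(2) dim by (auto simp: Ext_quiver_def)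
    ultimately show ?thesis
      using V(2) by (simp add: app_iso_def Ext_quiver_def)
  qed
  ultimately show ?thesis unfolding digraph_iso_def by blast
qed

end

section \<open>Application to presented monoids\<close>

context presentation_quotient
begin

text \<open>The kernel statement concerns every morphism that respects the generators; for the
  quivers the one induced by \<open>proj\<close> is taken.\<close>

lemma radical_square_quotient:
  assumes S: "S \<subseteq> A.rad_cong"
  shows "(\<exists>\<phi>. generator_morphism n R S \<phi>) \<and>
      (\<forall>\<phi>. generator_morphism n R S \<phi> \<longrightarrow>
         \<phi> ` carrier A.alg = carrier B.alg \<and> a_kernel A.alg B.alg \<phi> \<subseteq> radical_square A.alg)"
    and "digraph_iso (Ext_quiver A.alg) (Ext_quiver B.alg)"
proof -
  note kernel = kernel_subset_radical_square[OF _ S]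
  then show "(\<exists>\<phi>. generator_morphism n R S \<phi>) \<and>
      (\<forall>\<phi>. generator_morphism n R S \<phi> \<longrightarrow>
         \<phi> ` carrier A.alg = carrier B.alg \<and> a_kernel A.alg B.alg \<phi> \<subseteq> radical_square A.alg)"
    using generator_morphism_proj morphism_surj by blast
  interpret radical_square_extension A.alg B.alg "monoid_algebra_map proj"
    using generator_morphism_proj morphism_surj[OF generator_morphism_proj]
      kernel[OF generator_morphism_proj]
    by unfold_locales (auto simp: generator_morphism_def)
  show "digraph_iso (Ext_quiver A.alg) (Ext_quiver B.alg)" by (rule Ext_quiver_iso)
qed

end

theorem theorem5p19:
  fixes n :: nat
  shows
    "((\<exists>\<phi>. generator_morphism n (H0_B_rels n) (R0_rels n) \<phi>) \<and>
      (\<forall>\<phi>. generator_morphism n (H0_B_rels n) (R0_rels n) \<phi> \<longrightarrow>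
         \<phi> ` carrier (monoid_algebra (H0_B n)) = carrier (monoid_algebra (R0 n)) \<and>
         a_kernel (monoid_algebra (H0_B n)) (monoid_algebra (R0 n)) \<phi>
           \<subseteq> radical_square (monoid_algebra (H0_B n)))) \<and>
     ((\<exists>\<psi>. generator_morphism n (R0_rels n) (H0_A_rels n) \<psi>) \<and>
      (\<forall>\<psi>. generator_morphism n (R0_rels n) (H0_A_rels n) \<psi> \<longrightarrow>
         \<psi> ` carrier (monoid_algebra (R0 n)) = carrier (monoid_algebra (H0_A n)) \<and>
         a_kernel (monoid_algebra (R0 n)) (monoid_algebra (H0_A n)) \<psi>
           \<subseteq> radical_square (monoid_algebra (R0 n)))) \<and>
     digraph_iso (Ext_quiver (monoid_algebra (H0_B n))) (Ext_quiver (monoid_algebra (R0 n))) \<and>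
     digraph_iso (Ext_quiver (monoid_algebra (R0 n))) (Ext_quiver (monoid_algebra (H0_A n)))"
proof -
  note 1 = presentation_quotient.radical_square_quotient[OF presentation_quotient_H0_B_R0 R0_rels_rad_cong]
    and 2 = presentation_quotient.radical_square_quotient[OF presentation_quotient_R0_H0_A H0_A_rels_rad_cong]
  show ?thesis
    unfolding H0_B_def R0_def H0_A_def by (rule conjI[OF 1(1) conjI[OF 2(1) conjI[OF 1(2) 2(2)]]])
qed

end
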